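(* Let $\tilde N$ be a local cylindrical network with shift vector $\tilde g$ and projection $N$, let $L$ be a local lifting for $\tilde N$, let $r\ge1$, and let $\tilde{\mathbf u}=(\tilde u_1,\dots,\tilde u_r)$, $\tilde{\mathbf v}=(\tilde v_1,\dots,\tilde v_r)$ be two $r$-vertices of $\tilde N$. Define $f:\mathbb N\to K$ by $f(\ell)=\sum_{\sigma\in\mathfrak S_r}\mathrm{sgn}(\sigma)\,\tilde N(\tilde{\mathbf u},\sigma\tilde{\mathbf v}_\ell)$, where $\tilde{\mathbf v}_\ell=(\tilde v_1+\ell\tilde g,\dots,\tilde v_r+\ell\tilde g)$. Then $f$ satisfies a linear recurrence with characteristic polynomial $Q_N^{(e_r)}(t)$.
   Context: Let $K$ be a field of characteristic zero, $\mathcal S=\{A\le y\le B\}\subset\mathbb R^2$ a strip and $\tilde g=(m,0)$, $m>0$. A cylindrical network $\tilde N=(\tilde V,\tilde E,\mathrm{wt})$: $\tilde V$ a discrete subset of $\mathcal S$ with $\tilde V+\tilde g=\tilde V$; $\tilde E\subset\tilde V\times\tilde V$ a set of directed edges invariant under shifting both endpoints by $\tilde g$; $\mathrm{wt}:\tilde E\to K$ shift-invariant; each vertex has finitely many incoming and outgoing edges; if a directed path goes from $\tilde v$ to $\tilde v+\ell\tilde g$ then $\ell>0$. The projection $N$ is the finite weighted digraph $(\tilde V/\mathbb Z\tilde g,\tilde E/\mathbb Z\tilde g)$. Simple cycles of $N$: directed cycles visiting each vertex at most once; weight = product of edge weights; winding number = the $\ell$ such that a lift goes from $\tilde w$ to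 $\tilde w+\ell\tilde g$. An $r$-cycle: a collection (counted once) of $r$ pairwise vertex-disjoint simple cycles, weight the product, winding the sum; $\mathcal C^r(N)$ their set ($\mathcal C^0$ = empty collection, weight 1, winding 0). $d$ = maximal winding number of an $r$-cycle; $Q_N(t)=\sum_{r\ge0}(-1)^{d-r}\sum_{\mathbf C\in\mathcal C^r(N)}t^{d-\mathrm{wind}(\mathbf C)}\mathrm{wt}(\mathbf C)=\prod_{i=1}^d(t-\gamma_i)$ over the algebraic closure of $K$; $Q_N^{(e_r)}(t)=\prod_{1\le i_1<\dots<i_r\le d}(t-\gamma_{i_1}\cdots\gamma_{i_r})\in K[t]$. A lifting $L$ of $N$ is a subset of $\tilde V$ containing exactly one preimage of each vertex of $N$. $L$ is a local lifting if every edge of $\tilde N$ starting at a vertex of $L$ ends at a vertex of $L$ or of $L+\tilde g$; $\tilde N$ is local if it admits a local lifting. An $r$-vertex is an $r$-tuple of distinct vertices; $\sigma\tilde{\mathbf v}=(\tilde v_{\sigma(1)},\dots,\tilde v_{\sigma(r)})$. An $r$-path from $\tilde{\mathbf u}$ to $\tilde{\mathbf v}$ is an $r$-tuple of pairwise vertex-disjoint directed paths, the $i$-th from $\tilde u_i$ to $\tilde v_i$; weight = product of all edge weights; $\tilde N(\tilde{\mathbf u},\tilde{\mathbf v})$ = sum of weights of all such $r$-paths. A sequence satisfies a linear recurrence with characteristic polynomial $t^D-\alpha_1t^{D-1}+\dots+(-1)^D\alpha_D$ if $f(n+D)-\alpha_1f(n+D-1)+\dots+(-1)^D\alpha_Df(n)=0$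 for all but finitely many $n$. *)

theory Defs
  imports
    "HOL-Analysis.Analysis"
    "HOL-Combinatorics.Combinatorics"
    "HOL-Algebra.Algebraic_Closure_Type"
    "Graph_Theory.Arc_Walk"
begin

type_synonym point = "real \<times> real"

record 'k cyl_net =
  net_verts :: "point set"
  net_arcs :: "(point \<times> point) set"
  net_wt :: "point \<times> point \<Rightarrow> 'k"
  net_shift :: point

definition cover :: "'k cyl_net \<Rightarrow> (point, point \<times> point) pre_digraph" where
  "cover N = \<lparr> verts = net_verts N, arcs = net_arcs N, tail = fst, head = snd \<rparr>"

definition shift_class :: "'v::real_vector \<Rightarrow> 'v \<Rightarrow> 'v set" where
  "shift_class h x = range (\<lambda>k::int. x + of_int k *\<^sub>R h)"

abbreviation vert_class :: "'k cyl_net \<Rightarrow> point \<Rightarrow> point set" where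
  "vert_class N \<equiv> shift_class (net_shift N)"

abbreviation arc_class ::
  "'k cyl_net \<Rightarrow> point \<times> point \<Rightarrow> (point \<times> point) set" where
  "arc_class N \<equiv> shift_class (net_shift N, net_shift N)"

text \<open>The projected digraph may have parallel arcs and loops. The first (second) components of
  the members of a class of arcs form precisely the class of its tail (head).\<close>

definition projection ::
  "'k cyl_net \<Rightarrow> (point set, (point \<times> point) set) pre_digraph" where
  "projection N = \<lparr> verts = vert_class N ` net_verts N, arcs = arc_class N ` net_arcs N,
     tail = (\<lambda>c. fst ` c), head = (\<lambda>c. snd ` c) \<rparr>"

text \<open>Discreteness alone does not exclude accumulation points outside the vertex set, so
  finiteness of the projection is a separate assumption. The winding assumption
  concerns walks with at least one arc; in particular there are no directed cycles, so every walk
  visits each vertex at most once.\<close>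

locale cylindrical_network =
  fixes A B m :: real and N :: "'k::field_char_0 cyl_net"
  assumes m_pos: "m > 0"
    and shift_eq: "net_shift N = (m, 0)"
    and in_strip: "net_verts N \<subseteq> {p. A \<le> snd p \<and> snd p \<le> B}"
    and discrete_verts: "discrete (net_verts N)"
    and shift_verts: "(\<lambda>v. v + net_shift N) ` net_verts N = net_verts N"
    and arcs_subset: "net_arcs N \<subseteq> net_verts N \<times> net_verts N"
    and shift_arcs: "(\<lambda>(u, v). (u + net_shift N, v + net_shift N)) ` net_arcs N = net_arcs N"
    and shift_wt: "(u, v) \<in> net_arcs N \<Longrightarrow>
      net_wt N (u + net_shift N, v + net_shift N) = net_wt N (u, v)"
    and finite_in: "v \<in> net_verts N \<Longrightarrow> finite (in_arcs (cover N) v)"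
    and finite_out: "v \<in> net_verts N \<Longrightarrow> finite (out_arcs (cover N) v)"
    and wind_pos: "pre_digraph.awalk (cover N) v p (v + of_int l *\<^sub>R net_shift N) \<Longrightarrow>
      p \<noteq> [] \<Longrightarrow> l > 0"
    and finite_projection: "finite (verts (projection N))"

definition class_wt :: "'k cyl_net \<Rightarrow> (point \<times> point) set \<Rightarrow> 'k" where
  "class_wt N c = the_elem (net_wt N ` c)"

text \<open>A simple cycle is represented by its set of arcs, which identifies the rotations of an arc
  list: a cycle visiting each vertex at most once is determined by its arcs.\<close>

definition simple_cycles :: "'k cyl_net \<Rightarrow> (point \<times> point) set set set" where
  "simple_cycles N = {set p | p. pre_digraph.cycle (projection N) p}"

text \<open>Winding numbers of cycles are positive in a cylindrical network, so natural numbers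
  suffice.\<close>

definition cycle_wind :: "'k cyl_net \<Rightarrow> (point \<times> point) set set \<Rightarrow> nat" where
  "cycle_wind N C = (THE l. \<exists>p w.
     pre_digraph.cycle (projection N) (map (arc_class N) p) \<and> set (map (arc_class N) p) = C \<and>
     pre_digraph.awalk (cover N) w p (w + of_nat l *\<^sub>R net_shift N))"

definition cycle_verts :: "'k cyl_net \<Rightarrow> (point \<times> point) set set \<Rightarrow> point set set" where
  "cycle_verts N C = tail (projection N) ` C"

definition r_cycles :: "'k cyl_net \<Rightarrow> nat \<Rightarrow> (point \<times> point) set set set set" where
  "r_cycles N r = {Cs. Cs \<subseteq> simple_cycles N \<and> finite Cs \<and> card Cs = r \<and>
     pairwise (\<lambda>C D. disjnt (cycle_verts N C) (cycle_verts N D)) Cs}"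

definition r_cycle_wt :: "'k::comm_monoid_mult cyl_net \<Rightarrow> (point \<times> point) set set set \<Rightarrow> 'k" where
  "r_cycle_wt N Cs = (\<Prod>C\<in>Cs. \<Prod>c\<in>C. class_wt N c)"

definition r_cycle_wind :: "'k cyl_net \<Rightarrow> (point \<times> point) set set set \<Rightarrow> nat" where
  "r_cycle_wind N Cs = (\<Sum>C\<in>Cs. cycle_wind N C)"

definition max_wind :: "'k cyl_net \<Rightarrow> nat" where
  "max_wind N = Max (r_cycle_wind N ` (\<Union>r. r_cycles N r))"

text \<open>Every simple cycle winds at least once, so there are no r-cycles with \<open>r > max_wind N\<close>
  and the subtractions below are not truncated. The coefficient of degree \<open>max_wind N\<close> is
  \<open>(-1) ^ max_wind N\<close>: this polynomial equals the product of the \<open>t - \<gamma>\<^sub>i\<close> over its roots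
  up to that sign, which affects neither the roots nor \<open>poly_e\<close> below.\<close>

definition Q_poly :: "'k::comm_ring_1 cyl_net \<Rightarrow> 'k poly" where
  "Q_poly N = (\<Sum>r\<le>max_wind N. \<Sum>Cs\<in>r_cycles N r.
     Polynomial.monom ((-1) ^ (max_wind N - r) * r_cycle_wt N Cs) (max_wind N - r_cycle_wind N Cs))"

definition poly_e :: "nat \<Rightarrow> 'b::field poly \<Rightarrow> 'b poly" where
  "poly_e r Q = (let \<gamma> = (SOME \<gamma>. mset \<gamma> = proots Q) in
     \<Prod>I | I \<subseteq> {..<length \<gamma>} \<and> card I = r. [:- (\<Prod>i\<in>I. \<gamma> ! i), 1:])"

definition Q_e_closure :: "'k::field cyl_net \<Rightarrow> nat \<Rightarrow> 'k alg_closure poly" where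
  "Q_e_closure N r = poly_e r (map_poly to_ac (Q_poly N))"

definition is_lifting :: "'k cyl_net \<Rightarrow> point set \<Rightarrow> bool" where
  "is_lifting N L \<longleftrightarrow> L \<subseteq> net_verts N \<and>
     (\<forall>x\<in>verts (projection N). \<exists>!v. v \<in> L \<and> vert_class N v = x)"

definition local_lifting :: "'k cyl_net \<Rightarrow> point set \<Rightarrow> bool" where
  "local_lifting N L \<longleftrightarrow> is_lifting N L \<and>
     (\<forall>(u, v)\<in>net_arcs N. u \<in> L \<longrightarrow> v \<in> L \<union> (\<lambda>x. x + net_shift N) ` L)"

definition r_vertex :: "'k cyl_net \<Rightarrow> nat \<Rightarrow> point list \<Rightarrow> bool" where
  "r_vertex N r v \<longleftrightarrow> length v = r \<and> distinct v \<and> set v \<subseteq> net_verts N"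

definition shift_tuple :: "'k cyl_net \<Rightarrow> nat \<Rightarrow> point list \<Rightarrow> point list" where
  "shift_tuple N l v = map (\<lambda>x. x + of_nat l *\<^sub>R net_shift N) v"

text \<open>An r-path is the list of the arc lists of its components; a component without arcs is
  allowed.\<close>

definition r_paths ::
  "'k cyl_net \<Rightarrow> point list \<Rightarrow> point list \<Rightarrow> (point \<times> point) list list set" where
  "r_paths N u v = {P. length P = length u \<and> length v = length u \<and>
     (\<forall>i<length u. pre_digraph.awalk (cover N) (u ! i) (P ! i) (v ! i)) \<and>
     (\<forall>i<length u. \<forall>j<length u. i \<noteq> j \<longrightarrow>
        disjnt (set (pre_digraph.awalk_verts (cover N) (u ! i) (P ! i)))
               (set (pre_digraph.awalk_verts (cover N) (u ! j) (P ! j))))}"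

text \<open>In a cylindrical network the set of r-paths between two r-vertices is finite, by
  finiteness of the projection and positivity of winding numbers.\<close>

definition path_sum :: "'k::comm_ring_1 cyl_net \<Rightarrow> point list \<Rightarrow> point list \<Rightarrow> 'k" where
  "path_sum N u v = (\<Sum>P\<in>r_paths N u v. \<Prod>p\<leftarrow>P. \<Prod>e\<leftarrow>p. net_wt N e)"

definition satisfies_recurrence :: "(nat \<Rightarrow> 'k::comm_ring_1) \<Rightarrow> 'k poly \<Rightarrow> bool" where
  "satisfies_recurrence f P \<longleftrightarrow> Polynomial.lead_coeff P = 1 \<and>
     (\<forall>\<^sub>\<infinity>n. (\<Sum>i\<le>Polynomial.degree P. Polynomial.coeff P i * f (n + i)) = 0)"

end

(* Fix a local lifting L with n elements, and let M0 and M1 be the matrices of the weights of the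
   arcs from L to L and from L to its translate. The signed sum over families of disjoint walks
   is, by the Lindstroem-Gessel-Viennot lemma, the determinant of the matrix of walk sums, and
   unfolding the first arc of a walk shows that the vector of walk sums from L to a translated
   target is multiplied by T = (1 - M0)^(-1) M1 with every translation. So f l is eventually
   det (x_i T^l y_j), and once T is triangular with diagonal entries gamma_i, multilinearity
   shows that the minors of (T^l y_j) satisfy a triangular system of recurrences whose
   characteristic roots are the products of r distinct gamma_i. Finally the characteristic
   polynomial of T is det (t (1 - M0) - M1), whose expansion into families of disjoint cycles is
   Q_poly up to a sign and a power of t. *)

theory Submission
  imports Defs "Jordan_Normal_Form.Char_Poly"
begin

text \<open>The eigenvalues of T exist only in the algebraic closure, while the recurrence is asked
  for over the base field. So annihilation is proved after extending scalars and then pulled back,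
  and the characteristic polynomial is shown separately to have coefficients in the base field, by
  Newton's identities; this is where characteristic zero enters. Triangular instead of diagonal form
  copes with repeated eigenvalues. The matrix 1 - M0 has determinant 1 because every cycle of the
  projection winds positively and so uses an arc counted in M1. Locality makes the pencil linear in
  t: no arc climbs by more than one translate of L. T has size n but \<open>Q_poly\<close> only
  degree \<open>max_wind N\<close>; the surplus eigenvalues 0 produce factors t, that is, delays,
  and these, like the positions of the two r-vertices relative to L, only cost finitely many
  exceptional indices. The Lindstroem-Gessel-Viennot lemma is proved by a first-arc recursion, as
  the relation for T is, and not by swapping tails of intersecting walks.\<close>

unbundle no vec_syntax
unbundle no Formal_Power_Series.fps_syntax

section \<open>Triangularisation over a field\<close>

text \<open>Pick \<open>k\<close> with \<open>v $ k\<close> nonzero. The columns of \<open>P\<close>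
  are \<open>v\<close> and the unit vectors other than the k-th one, arranged by the transposition
  of 0 and \<open>k\<close>; they form a basis, and \<open>Q\<close> is the inverse written out. No
  inner product is involved, so any field is allowed.\<close>

lemma exists_invertible_mat_first_col:
  fixes v :: "'a :: field vec"
  assumes v: "v \<in> carrier_vec n" and nz: "v \<noteq> 0\<^sub>v n"
  obtains P Q where "P \<in> carrier_mat n n" "Q \<in> carrier_mat n n" "P * Q = 1\<^sub>m n" "Q * P = 1\<^sub>m n"
    "col P 0 = v"
proof -
  from nz v obtain k where k: "k < n" "v $ k \<noteq> 0"
    by (metis carrier_vecD eq_vecI index_zero_vec)
  define \<tau> where "\<tau> = Transposition.transpose 0 k"
  have \<tau>_lt: "\<tau> i < n" if "i < n" for i
    using that k by (auto simp: \<tau>_def Transposition.transpose_def)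
  have \<tau>_eq: "\<tau> i = \<tau> j \<longleftrightarrow> i = j" "\<tau> i = k \<longleftrightarrow> i = 0" "k = \<tau> i \<longleftrightarrow> i = 0" for i j
    by (auto simp: \<tau>_def Transposition.transpose_def)
  define P where "P = Matrix.mat n n (\<lambda>(i, j). if j = 0 then v $ i else if i = \<tau> j then 1 else 0)"
  define Q where "Q = Matrix.mat n n (\<lambda>(i, j). if i = 0 then (if j = k then 1 / v $ k else 0)
      else (if j = \<tau> i then 1 else 0) - (if j = k then v $ (\<tau> i) / v $ k else 0))"
  have P: "P \<in> carrier_mat n n" and Q: "Q \<in> carrier_mat n n" by (auto simp: P_def Q_def)
  have QP: "Q * P = 1\<^sub>m n"
  proof (rule eq_matI)
    fix i j assume "i < dim_row (1\<^sub>m n :: 'a mat)" "j < dim_col (1\<^sub>m n :: 'a mat)"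
    hence ij: "i < n" "j < n" by auto
    have "(Q * P) $$ (i, j) = (\<Sum>l\<in>{0..<n}. Q $$ (i, l) * P $$ (l, j))"
      using ij P Q by (simp add: scalar_prod_def)
    also have "\<dots> = (if i = 0 then P $$ (k, j) / v $ k
        else P $$ (\<tau> i, j) - v $ (\<tau> i) / v $ k * P $$ (k, j))"
    proof (cases "i = 0")
      case True
      have "(\<Sum>l\<in>{0..<n}. Q $$ (i, l) * P $$ (l, j)) =
            (\<Sum>l\<in>{0..<n}. if l = k then P $$ (l, j) / v $ k else 0)"
        using True ij by (intro sum.cong) (auto simp: Q_def)
      thus ?thesis using True k by simp
    next
      case False
      have "(\<Sum>l\<in>{0..<n}. Q $$ (i, l) * P $$ (l, j)) =
            (\<Sum>l\<in>{0..<n}. (if l = \<tau> i then P $$ (l, j) else 0) -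
               (if l = k then v $ (\<tau> i) / v $ k * P $$ (l, j) else 0))"
        using False ij by (intro sum.cong) (auto simp: Q_def left_diff_distrib)
      thus ?thesis using False k ij \<tau>_lt by (simp add: sum_subtractf)
    qed
    also have "\<dots> = 1\<^sub>m n $$ (i, j)"
      using ij k \<tau>_lt by (auto simp: P_def \<tau>_eq)
    finally show "(Q * P) $$ (i, j) = 1\<^sub>m n $$ (i, j)" .
  qed (use P Q in auto)
  have "P * Q = 1\<^sub>m n" using mat_mult_left_right_inverse[OF Q P QP] .
  moreover have "col P 0 = v" using v k by (auto simp: P_def intro!: eq_vecI)
  ultimately show ?thesis using that P Q QP by blast
qed

text \<open>Induction on the list of roots: making an eigenvector for the first root the first basis
  vector leaves that root in the corner, zeros below it, and a block whose characteristic polynomial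
  has the remaining roots. The diagonal comes out in the order of \<open>es\<close>, so entry i can
  later be identified with \<open>es ! i\<close>.\<close>

lemma similar_upper_triangular_of_split:
  fixes A :: "'a :: field mat"
  assumes "A \<in> carrier_mat n n" and "char_poly A = (\<Prod>e\<leftarrow>es. [:- e, 1:])"
  shows "\<exists>B. similar_mat A B \<and> upper_triangular B \<and> diag_mat B = es"
  using assms
proof (induction es arbitrary: n A)
  case Nil
  with degree_monic_char_poly[of A n] have "n = 0" by auto
  with Nil show ?case
    by (intro exI[of _ A]) (auto intro: similar_mat_refl simp: diag_mat_def)
next
  case (Cons e es n A)
  let ?n1 = "n - 1"
  note A = Cons.prems(1)
  have cp: "char_poly A = [: -e, 1 :] * (\<Prod>e \<leftarrow> es. [:- e, 1:])" using Cons.prems(2) by auto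
  have "eigenvalue A e"
    unfolding eigenvalue_root_char_poly[OF A] cp by simp
  then obtain v where "eigenvector A v e" unfolding eigenvalue_def by blast
  hence v: "v \<in> carrier_vec n" and v0: "v \<noteq> 0\<^sub>v n" and ev: "A *\<^sub>v v = e \<cdot>\<^sub>v v"
    using A unfolding eigenvector_def by auto
  have n: "n \<noteq> 0" using v v0 by (auto intro!: eq_vecI)
  obtain P Q where P: "P \<in> carrier_mat n n" and Q: "Q \<in> carrier_mat n n"
    and PQ: "P * Q = 1\<^sub>m n" and QP: "Q * P = 1\<^sub>m n" and P0: "col P 0 = v"
    using exists_invertible_mat_first_col[OF v v0] by metis
  define A' where "A' = Q * A * P"
  have A': "A' \<in> carrier_mat n n" using A P Q by (auto simp: A'_def)
  have "similar_mat_wit A' A Q P"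
    by (rule similar_mat_witI[of _ _ n], insert P Q PQ QP A A', auto simp: A'_def)
  hence sim: "similar_mat A' A" unfolding similar_mat_def by blast
  \<comment> \<open>As \<open>v\<close> is the first column of \<open>P\<close>, the vector
    \<open>Q v\<close> is the first unit vector, so \<open>A v = e v\<close> becomes a statement
    about the first column of \<open>A'\<close>.\<close>
  have "col A' 0 = Q * A *\<^sub>v v"
    using A P Q n unfolding A'_def P0[symmetric] by (intro col_mult2[of _ n n _ n]) auto
  also have "\<dots> = Q *\<^sub>v (e \<cdot>\<^sub>v v)" using A Q v ev by (simp add: assoc_mult_mat_vec[of _ n n _ n])
  also have "\<dots> = e \<cdot>\<^sub>v (Q *\<^sub>v v)" using Q v by (simp add: mult_mat_vec[of _ n n])
  also have "Q *\<^sub>v v = col (Q * P) 0"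
    using P Q n unfolding P0[symmetric] by (intro col_mult2[symmetric, of _ n n _ n]) auto
  finally have col0: "col A' 0 = e \<cdot>\<^sub>v col (1\<^sub>m n) 0" unfolding QP .
  have A'0: "A' $$ (i, 0) = (if i = 0 then e else 0)" if "i < n" for i
    using arg_cong[OF col0, of "\<lambda>v. v $ i"] A' n that by auto
  obtain A1 A2 A0 A3 where split: "split_block A' 1 1 = (A1,A2,A0,A3)"
    by (cases "split_block A' 1 1", auto)
  from A' n have "dim_row A' = 1 + ?n1" "dim_col A' = 1 + ?n1" by auto
  from split_block[OF split this] have A2: "A2 \<in> carrier_mat 1 ?n1"
    and A3: "A3 \<in> carrier_mat ?n1 ?n1" and A0: "A0 \<in> carrier_mat ?n1 1"
    and block: "A' = four_block_mat A1 A2 A0 A3" by auto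
  have A1id: "A1 = Matrix.mat 1 1 (\<lambda> _. e)"
    using split[unfolded split_block_def Let_def] A'0[of 0] A' n by auto
  hence A1: "A1 \<in> carrier_mat 1 1" by auto
  have A0id: "A0 = 0\<^sub>m ?n1 1"
    using split[unfolded split_block_def Let_def] A'0 A' by auto
  have "char_poly A' = [: -e,1 :] * (\<Prod> e \<leftarrow> es. [:- e, 1:])"
    using cp char_poly_similar[OF sim] by simp
  moreover have "char_poly A' = char_poly A1 * char_poly A3"
    unfolding block A0id by (rule char_poly_four_block_zeros_col[OF A1 A2 A3])
  moreover have "char_poly A1 = [: -e,1 :]"
    by (simp add: A1id char_poly_defs Determinant.det_def sign_def)
  ultimately have "char_poly A3 = (\<Prod> e \<leftarrow> es. [:- e, 1:])"
    by (metis mult_cancel_left pCons_eq_0_iff zero_neq_one)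
  from Cons.IH[OF A3 this] obtain B where B: "similar_mat A3 B" "upper_triangular B" "diag_mat B = es"
    by blast
  have Bc: "B \<in> carrier_mat ?n1 ?n1" using similar_matD[OF B(1)] A3 by auto
  from similar_mat_four_block_0_ex[OF similar_mat_refl[OF A1] B(1) A2 A1 A3]
  obtain B0 where B0: "similar_mat A' (four_block_mat A1 B0 (0\<^sub>m ?n1 1) B)"
    unfolding block A0id by blast
  have "similar_mat A (four_block_mat A1 B0 (0\<^sub>m ?n1 1) B)"
    using similar_mat_trans[OF similar_mat_sym[OF sim] B0] .
  moreover have "upper_triangular (four_block_mat A1 B0 (0\<^sub>m ?n1 1) B)"
    by (intro upper_triangular_four_block[OF A1 Bc _ B(2)]) (auto simp: A1id)
  moreover have "diag_mat (four_block_mat A1 B0 (0\<^sub>m ?n1 1) B) = e # es"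
    using diag_four_block_mat[OF A1 Bc] B(3) by (simp add: A1id diag_mat_def)
  ultimately show ?case by blast
qed

section \<open>Recurrences of determinants of vector sequences\<close>

text \<open>Composition with the transposition of \<open>a\<close> and \<open>b\<close> flips the
  sign and keeps \<open>h\<close>. Matching the terms with \<sigma> a < \<sigma> b against those
  with \<sigma> b < \<sigma> a, instead of inferring x = 0 from x = - x, makes this valid in every
  characteristic. \<open>S\<close> may be smaller than the full symmetric group, since the walk
  argument prescribes some values of \<sigma>.\<close>

lemma sign_sum_eq_0:
  fixes h :: "(nat \<Rightarrow> nat) \<Rightarrow> 'a :: comm_ring_1"
  assumes S: "S \<subseteq> {\<sigma>. \<sigma> permutes {..<r}}" and ab: "a < r" "b < r" "a \<noteq> b"
    and closed: "\<And>\<sigma>. \<sigma> \<in> S \<Longrightarrow> \<sigma> \<circ> Transposition.transpose a b \<in> S"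
    and inv: "\<And>\<sigma>. \<sigma> \<in> S \<Longrightarrow> h (\<sigma> \<circ> Transposition.transpose a b) = h \<sigma>"
  shows "(\<Sum>\<sigma>\<in>S. of_int (sign \<sigma>) * h \<sigma>) = 0"
proof -
  let ?t = "Transposition.transpose a b"
  let ?f = "\<lambda>\<sigma>. of_int (sign \<sigma>) * h \<sigma>"
  define S1 where "S1 = {\<sigma>\<in>S. \<sigma> a < \<sigma> b}"
  define S2 where "S2 = {\<sigma>\<in>S. \<sigma> b < \<sigma> a}"
  have fin: "finite S" by (rule finite_subset[OF S]) (simp add: finite_permutations)
  have S_eq: "S = S1 \<union> S2"
  proof -
    have "\<sigma> a \<noteq> \<sigma> b" if "\<sigma> \<in> S" for \<sigma>
    proof -
      have "inj \<sigma>" using that S permutes_inj by blast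
      thus ?thesis using ab by (simp add: inj_eq)
    qed
    thus ?thesis by (auto simp: S1_def S2_def neq_iff)
  qed
  have tt: "\<sigma> \<circ> ?t \<circ> ?t = \<sigma>" for \<sigma> :: "nat \<Rightarrow> nat"
    by (auto simp: fun_eq_iff Transposition.transpose_def)
  have sgn: "?f (\<sigma> \<circ> ?t) = - ?f \<sigma>" if "\<sigma> \<in> S" for \<sigma>
  proof -
    have "permutation \<sigma>" using that S permutation_permutes[of \<sigma>] by blast
    hence "sign (\<sigma> \<circ> ?t) = - sign \<sigma>" using ab by (simp add: sign_compose permutation_swap_id sign_swap_id)
    thus ?thesis using inv[OF that] by simp
  qed
  have "(\<Sum>\<sigma>\<in>S2. ?f \<sigma>) = (\<Sum>\<sigma>\<in>S1. - ?f \<sigma>)"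
  proof (rule sum.reindex_bij_witness[of _ "\<lambda>\<sigma>. \<sigma> \<circ> ?t" "\<lambda>\<sigma>. \<sigma> \<circ> ?t"])
    fix \<sigma> assume "\<sigma> \<in> S2"
    thus "\<sigma> \<circ> ?t \<in> S1" "- ?f (\<sigma> \<circ> ?t) = ?f \<sigma>"
      using closed sgn by (auto simp: S1_def S2_def)
  next
    fix \<sigma> assume "\<sigma> \<in> S1"
    thus "\<sigma> \<circ> ?t \<in> S2" using closed by (auto simp: S1_def S2_def)
  qed (use tt in auto)
  moreover have "(\<Sum>\<sigma>\<in>S. ?f \<sigma>) = (\<Sum>\<sigma>\<in>S1. ?f \<sigma>) + (\<Sum>\<sigma>\<in>S2. ?f \<sigma>)"
    using fin unfolding S_eq by (intro sum.union_disjoint) (auto simp: S1_def S2_def)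
  ultimately show ?thesis by (simp add: sum_negf)
qed

text \<open>This is p(E) f at position n, where E is the shift operator (E f) n = f (n + 1).
  Products of polynomials thus act by composition (\<open>shift_app_mult\<close>), and annihilation
  can be proved one linear factor at a time.\<close>

definition shift_app :: "'a :: comm_ring_1 poly \<Rightarrow> (nat \<Rightarrow> 'a) \<Rightarrow> nat \<Rightarrow> 'a" where
  "shift_app p f n = (\<Sum>i\<le>Polynomial.degree p. Polynomial.coeff p i * f (n + i))"

lemma shift_app_bound:
  assumes "Polynomial.degree p \<le> d"
  shows "shift_app p f n = (\<Sum>i\<le>d. Polynomial.coeff p i * f (n + i))"
  unfolding shift_app_def using assms
  by (intro sum.mono_neutral_left) (auto simp: coeff_eq_0)

lemma shift_app_add: "shift_app (p + q) f n = shift_app p f n + shift_app q f n"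
proof -
  define d where "d = max (Polynomial.degree p) (Polynomial.degree q)"
  have "Polynomial.degree p \<le> d" "Polynomial.degree q \<le> d" "Polynomial.degree (p + q) \<le> d"
    by (auto simp: d_def degree_add_le_max)
  from this[THEN shift_app_bound] show ?thesis by (simp add: algebra_simps sum.distrib)
qed

lemma shift_app_smult: "shift_app (Polynomial.smult c p) f n = c * shift_app p f n"
  using shift_app_bound[OF degree_smult_le[of c p]] shift_app_bound[of p "Polynomial.degree p"]
  by (simp add: sum_distrib_left mult.assoc)

lemma shift_app_0 [simp]: "shift_app 0 f n = 0"
  by (simp add: shift_app_def)

lemma shift_app_pCons: "shift_app (pCons a p) f n = a * f n + shift_app p f (Suc n)"
proof -
  have "shift_app (pCons a p) f n =
      (\<Sum>i\<le>Suc (Polynomial.degree p). Polynomial.coeff (pCons a p) i * f (n + i))"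
    by (rule shift_app_bound) (rule degree_pCons_le)
  also have "\<dots> = a * f n + shift_app p f (Suc n)"
    unfolding shift_app_def by (subst sum.atMost_Suc_shift) simp
  finally show ?thesis .
qed

lemma shift_app_mult: "shift_app (p * q) f n = shift_app p (shift_app q f) n"
proof (induction p arbitrary: n)
  case (pCons a p)
  have "shift_app (pCons a p * q) f n = a * shift_app q f n + shift_app (p * q) f (Suc n)"
    by (simp add: shift_app_add shift_app_smult shift_app_pCons)
  thus ?case using pCons.IH by (simp add: shift_app_pCons)
qed simp

lemma shift_app_sum:
  "shift_app p (\<lambda>n. \<Sum>k\<in>A. c k * g k n) n = (\<Sum>k\<in>A. c k * shift_app p (g k) n)"
proof -
  have "shift_app p (\<lambda>n. \<Sum>k\<in>A. c k * g k n) n =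
      (\<Sum>i\<le>Polynomial.degree p. \<Sum>k\<in>A. c k * (Polynomial.coeff p i * g k (n + i)))"
    unfolding shift_app_def by (simp add: sum_distrib_left mult_ac)
  also have "\<dots> = (\<Sum>k\<in>A. c k * shift_app p (g k) n)"
    by (subst sum.swap) (simp add: shift_app_def sum_distrib_left)
  finally show ?thesis .
qed

text \<open>\<open>y j n k\<close> is component k, at time n, of the j-th of r vector sequences, all
  driven by the same upper triangular matrix \<open>U\<close>.\<close>

locale triangular_sequences =
  fixes U :: "nat \<Rightarrow> nat \<Rightarrow> 'a :: comm_ring_1" and y :: "nat \<Rightarrow> nat \<Rightarrow> nat \<Rightarrow> 'a" and N r :: nat
  assumes upper: "i < N \<Longrightarrow> j < i \<Longrightarrow> U i j = 0"
    and step: "j < r \<Longrightarrow> k < N \<Longrightarrow> y j (Suc n) k = (\<Sum>l<N. U k l * y j n l)"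
begin

text \<open>The determinant formed by rows \<kappa> 0, ..., \<kappa> (r - 1) of the N by r matrix
  with columns \<open>y j n\<close>. Neither injectivity nor order is asked of \<kappa>, so
  expansions can run over all of \<open>maps\<close> without sorted representatives.\<close>

definition minor :: "(nat \<Rightarrow> nat) \<Rightarrow> nat \<Rightarrow> 'a" where
  "minor \<kappa> n = (\<Sum>\<sigma> | \<sigma> permutes {..<r}. of_int (sign \<sigma>) * (\<Prod>i<r. y (\<sigma> i) n (\<kappa> i)))"

abbreviation maps :: "(nat \<Rightarrow> nat) set" where
  "maps \<equiv> {..<r} \<rightarrow>\<^sub>E {..<N}"

lemma finite_maps [simp]: "finite maps"
  by (auto intro: finite_PiE)

lemma minor_not_inj:
  assumes "\<not> inj_on \<kappa> {..<r}"
  shows "minor \<kappa> n = 0"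
proof -
  from assms obtain a b where ab: "a < r" "b < r" "a \<noteq> b" "\<kappa> a = \<kappa> b"
    by (auto simp: inj_on_def)
  let ?t = "Transposition.transpose a b"
  have t: "?t permutes {..<r}" using ab by (simp add: permutes_swap_id)
  have \<kappa>t: "\<kappa> (?t i) = \<kappa> i" for i using ab by (auto simp: Transposition.transpose_def)
  show ?thesis unfolding minor_def
  proof (rule sign_sum_eq_0[OF _ ab(1-3)])
    fix \<sigma> assume "\<sigma> \<in> {\<sigma>. \<sigma> permutes {..<r}}"
    thus "\<sigma> \<circ> ?t \<in> {\<sigma>. \<sigma> permutes {..<r}}" using t by (simp add: permutes_compose)
    have "(\<Prod>i<r. y ((\<sigma> \<circ> ?t) i) n (\<kappa> i)) = (\<Prod>i<r. y (\<sigma> (?t i)) n (\<kappa> (?t i)))"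
      by (simp add: \<kappa>t)
    also have "\<dots> = (\<Prod>i<r. y (\<sigma> i) n (\<kappa> i))"
      using prod.permute[OF t, of "\<lambda>i. y (\<sigma> i) n (\<kappa> i)"] by (simp add: o_def)
    finally show "(\<Prod>i<r. y ((\<sigma> \<circ> ?t) i) n (\<kappa> i)) = (\<Prod>i<r. y (\<sigma> i) n (\<kappa> i))" .
  qed simp
qed

text \<open>Cauchy-Binet in unsorted form: multiplying out the product of sums chooses an
  intermediate index \<kappa> i for each i, and what remains of the sum over permutations is a
  minor.\<close>

lemma sum_minors:
  assumes "\<And>\<sigma> i. \<sigma> permutes {..<r} \<Longrightarrow> i < r \<Longrightarrow> z i (\<sigma> i) = (\<Sum>k<N. x i k * y (\<sigma> i) n k)"
  shows "(\<Sum>\<sigma> | \<sigma> permutes {..<r}. of_int (sign \<sigma>) * (\<Prod>i<r. z i (\<sigma> i))) =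
         (\<Sum>\<kappa>\<in>maps. (\<Prod>i<r. x i (\<kappa> i)) * minor \<kappa> n)"
proof -
  have "(\<Prod>i<r. z i (\<sigma> i)) = (\<Sum>\<kappa>\<in>maps. (\<Prod>i<r. x i (\<kappa> i)) * (\<Prod>i<r. y (\<sigma> i) n (\<kappa> i)))"
    if "\<sigma> permutes {..<r}" for \<sigma>
    using assms[OF that] by (simp add: prod_sum_PiE prod.distrib)
  hence "(\<Sum>\<sigma> | \<sigma> permutes {..<r}. of_int (sign \<sigma>) * (\<Prod>i<r. z i (\<sigma> i))) =
    (\<Sum>\<sigma> | \<sigma> permutes {..<r}. \<Sum>\<kappa>\<in>maps.
       (\<Prod>i<r. x i (\<kappa> i)) * (of_int (sign \<sigma>) * (\<Prod>i<r. y (\<sigma> i) n (\<kappa> i))))"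
    by (intro sum.cong) (auto simp: sum_distrib_left mult_ac)
  also have "\<dots> = (\<Sum>\<kappa>\<in>maps. (\<Prod>i<r. x i (\<kappa> i)) * minor \<kappa> n)"
    by (subst sum.swap) (simp add: minor_def sum_distrib_left)
  finally show ?thesis .
qed

lemma minor_step:
  assumes "\<kappa> \<in> maps"
  shows "minor \<kappa> (Suc n) = (\<Sum>\<mu>\<in>maps. (\<Prod>i<r. U (\<kappa> i) (\<mu> i)) * minor \<mu> n)"
proof -
  have "y (\<sigma> i) (Suc n) (\<kappa> i) = (\<Sum>l<N. U (\<kappa> i) l * y (\<sigma> i) n l)"
    if "\<sigma> permutes {..<r}" "i < r" for \<sigma> i
  proof (rule step)
    show "\<sigma> i < r" using that permutes_in_image[of \<sigma> "{..<r}" i] by simp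
    show "\<kappa> i < N" using that assms by auto
  qed
  thus ?thesis unfolding minor_def[of \<kappa>]
    by (rule sum_minors[where z = "\<lambda>i j. y j (Suc n) (\<kappa> i)" and x = "\<lambda>i k. U (\<kappa> i) k"])
qed

definition above :: "(nat \<Rightarrow> nat) \<Rightarrow> (nat \<Rightarrow> nat) set" where
  "above \<kappa> = {\<mu>\<in>maps. inj_on \<mu> {..<r} \<and> (\<Sum>i<r. \<kappa> i) < (\<Sum>i<r. \<mu> i)}"

text \<open>By triangularity a coefficient with some \<mu> i < \<kappa> i vanishes. A different
  \<mu> that dominates \<kappa> pointwise has a strictly larger index sum, and its minor vanishes
  unless \<mu> is injective. The coefficient of \<kappa> itself is cancelled by the linear
  factor.\<close>

lemma shift_app_minor:
  assumes \<kappa>: "\<kappa> \<in> maps"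
  shows "shift_app [:- (\<Prod>i<r. U (\<kappa> i) (\<kappa> i)), 1:] (minor \<kappa>) n =
         (\<Sum>\<mu>\<in>above \<kappa>. (\<Prod>i<r. U (\<kappa> i) (\<mu> i)) * minor \<mu> n)"
proof -
  let ?c = "\<lambda>\<mu>. (\<Prod>i<r. U (\<kappa> i) (\<mu> i))"
  have "minor \<kappa> (Suc n) = ?c \<kappa> * minor \<kappa> n + (\<Sum>\<mu>\<in>maps - {\<kappa>}. ?c \<mu> * minor \<mu> n)"
    using \<kappa> by (simp add: minor_step sum.remove)
  also have "(\<Sum>\<mu>\<in>maps - {\<kappa>}. ?c \<mu> * minor \<mu> n) = (\<Sum>\<mu>\<in>above \<kappa>. ?c \<mu> * minor \<mu> n)"
  proof (rule sum.mono_neutral_right)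
    show "above \<kappa> \<subseteq> maps - {\<kappa>}" by (auto simp: above_def)
    show "\<forall>\<mu>\<in>maps - {\<kappa>} - above \<kappa>. ?c \<mu> * minor \<mu> n = 0"
    proof
      fix \<mu> assume \<mu>: "\<mu> \<in> maps - {\<kappa>} - above \<kappa>"
      show "?c \<mu> * minor \<mu> n = 0"
      proof (cases "\<forall>i<r. \<kappa> i \<le> \<mu> i")
        case True
        from \<mu> \<kappa> have "\<mu> \<noteq> \<kappa>" "\<mu> \<in> maps" by auto
        hence "\<exists>i<r. \<mu> i \<noteq> \<kappa> i" using \<kappa> by (metis PiE_ext lessThan_iff)
        hence "\<exists>i<r. \<kappa> i < \<mu> i" using True by (metis le_neq_implies_less)
        hence "(\<Sum>i<r. \<kappa> i) < (\<Sum>i<r. \<mu> i)" using True by (intro sum_strict_mono_ex1) auto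
        hence "\<not> inj_on \<mu> {..<r}" using \<mu> by (auto simp: above_def)
        thus ?thesis by (simp add: minor_not_inj)
      next
        case False
        then obtain i where "i < r" "\<mu> i < \<kappa> i" by (auto simp: not_le)
        moreover from this have "U (\<kappa> i) (\<mu> i) = 0" using \<kappa> by (intro upper) auto
        ultimately have "?c \<mu> = 0" by (intro prod_zero) auto
        thus ?thesis by simp
      qed
    qed
  qed simp
  finally show ?thesis by (simp add: shift_app_pCons)
qed

text \<open>Descending induction on the index sum. The factor for the image of \<kappa> turns its
  minor into a combination of minors with larger index sums, which the other factors annihilate.
  Allowing any \<open>\<J>\<close> that contains this image and all r-sets of larger sum lets the
  image be struck off after use: the maps that follow have larger sums, hence other images.\<close>

lemma minor_annihilated:
  assumes "\<kappa> \<in> maps" "inj_on \<kappa> {..<r}" "finite \<J>" "\<kappa> ` {..<r} \<in> \<J>"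
    and "\<And>J. J \<subseteq> {..<N} \<Longrightarrow> card J = r \<Longrightarrow> (\<Sum>i<r. \<kappa> i) < \<Sum>J \<Longrightarrow> J \<in> \<J>"
  shows "shift_app (\<Prod>J\<in>\<J>. [:- (\<Prod>i\<in>J. U i i), 1:]) (minor \<kappa>) n = 0"
  using assms
proof (induction "N * r - (\<Sum>i<r. \<kappa> i)" arbitrary: \<kappa> \<J> n rule: less_induct)
  case less
  let ?l = "\<lambda>J. [:- (\<Prod>i\<in>J. U i i), 1:]"
  define \<J>' where "\<J>' = \<J> - {\<kappa> ` {..<r}}"
  have "(\<Prod>J\<in>\<J>. ?l J) = (\<Prod>J\<in>\<J>'. ?l J) * ?l (\<kappa> ` {..<r})"
    using less.prems(3,4) by (simp add: \<J>'_def prod.remove mult.commute)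
  moreover have "(\<Prod>i\<in>\<kappa> ` {..<r}. U i i) = (\<Prod>i<r. U (\<kappa> i) (\<kappa> i))"
    using less.prems(2) by (simp add: prod.reindex)
  moreover have "shift_app [:- (\<Prod>i<r. U (\<kappa> i) (\<kappa> i)), 1:] (minor \<kappa>) =
      (\<lambda>n. \<Sum>\<mu>\<in>above \<kappa>. (\<Prod>i<r. U (\<kappa> i) (\<mu> i)) * minor \<mu> n)"
    using less.prems(1) by (intro ext shift_app_minor)
  ultimately have "shift_app (\<Prod>J\<in>\<J>. ?l J) (minor \<kappa>) n =
      (\<Sum>\<mu>\<in>above \<kappa>. (\<Prod>i<r. U (\<kappa> i) (\<mu> i)) * shift_app (\<Prod>J\<in>\<J>'. ?l J) (minor \<mu>) n)"
    by (simp only: shift_app_mult shift_app_sum)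
  also have "\<dots> = 0"
  proof (intro sum.neutral ballI)
    fix \<mu> assume "\<mu> \<in> above \<kappa>"
    hence \<mu>: "\<mu> \<in> maps" "inj_on \<mu> {..<r}" "(\<Sum>i<r. \<kappa> i) < (\<Sum>i<r. \<mu> i)" by (auto simp: above_def)
    have sums: "\<Sum>(\<nu> ` {..<r}) = (\<Sum>i<r. \<nu> i)" if "inj_on \<nu> {..<r}" for \<nu> :: "nat \<Rightarrow> nat"
      using that by (simp add: sum.reindex)
    \<comment> \<open>\<open>N * r\<close> bounds every index sum, so the truncated subtraction in
      the induction measure decreases strictly.\<close>
    have "(\<Sum>i<r. \<mu> i) \<le> (\<Sum>i<r. N)" using \<mu>(1) by (intro sum_mono less_imp_le) auto
    hence "N * r - (\<Sum>i<r. \<mu> i) < N * r - (\<Sum>i<r. \<kappa> i)" using \<mu>(3) by (simp add: mult.commute)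
    moreover have "\<mu> ` {..<r} \<in> \<J>'"
    proof -
      have "\<mu> ` {..<r} \<in> \<J>"
        using \<mu> by (intro less.prems(5)) (auto simp: sums card_image)
      moreover have "\<mu> ` {..<r} \<noteq> \<kappa> ` {..<r}" using \<mu>(3) sums[OF \<mu>(2)] sums[OF less.prems(2)] by auto
      ultimately show ?thesis by (simp add: \<J>'_def)
    qed
    moreover have "J \<in> \<J>'" if "J \<subseteq> {..<N}" "card J = r" "(\<Sum>i<r. \<mu> i) < \<Sum>J" for J
      using less.prems(5)[OF that(1,2)] that(3) \<mu>(3) sums[OF less.prems(2)] by (auto simp: \<J>'_def)
    ultimately have "shift_app (\<Prod>J\<in>\<J>'. ?l J) (minor \<mu>) n = 0"
      using \<mu> less.prems(3) by (intro less.hyps) (auto simp: \<J>'_def)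
    thus "(\<Prod>i<r. U (\<kappa> i) (\<mu> i)) * shift_app (\<Prod>J\<in>\<J>'. ?l J) (minor \<mu>) n = 0" by simp
  qed
  finally show ?case .
qed

lemma det_annihilated:
  "shift_app (\<Prod>J | J \<subseteq> {..<N} \<and> card J = r. [:- (\<Prod>i\<in>J. U i i), 1:])
     (\<lambda>n. \<Sum>\<sigma> | \<sigma> permutes {..<r}. of_int (sign \<sigma>) * (\<Prod>i<r. \<Sum>k<N. x i k * y (\<sigma> i) n k)) n = 0"
proof -
  let ?p = "\<Prod>J | J \<subseteq> {..<N} \<and> card J = r. [:- (\<Prod>i\<in>J. U i i), 1:]"
  have "shift_app ?p (minor \<kappa>) n = 0" if "\<kappa> \<in> maps" for \<kappa>
  proof (cases "inj_on \<kappa> {..<r}")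
    case True
    thus ?thesis using that
      by (intro minor_annihilated) (auto simp: card_image)
  next
    case False
    thus ?thesis by (simp add: minor_not_inj shift_app_def)
  qed
  moreover have "(\<lambda>n. \<Sum>\<sigma> | \<sigma> permutes {..<r}. of_int (sign \<sigma>) * (\<Prod>i<r. \<Sum>k<N. x i k * y (\<sigma> i) n k)) =
      (\<lambda>n. \<Sum>\<kappa>\<in>maps. (\<Prod>i<r. x i (\<kappa> i)) * minor \<kappa> n)"
    by (intro ext sum_minors[where z = "\<lambda>i j. \<Sum>k<N. x i k * y j n k" for n]) simp
  ultimately show ?thesis by (simp add: shift_app_sum)
qed

end

section \<open>Coefficients of the polynomial of subset products\<close>

text \<open>Newton's identities as one power series equation: the logarithmic derivative of the
  product is minus the generating function of the power sums. It is stated without a quotient and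
  follows from the product rule by induction.\<close>

lemma fps_deriv_prod_linear:
  fixes z :: "'i \<Rightarrow> 'b :: comm_ring_1"
  assumes "finite A"
  shows "fps_deriv (\<Prod>i\<in>A. 1 - fps_const (z i) * fps_X) =
    - Abs_fps (\<lambda>n. \<Sum>i\<in>A. z i ^ Suc n) * (\<Prod>i\<in>A. 1 - fps_const (z i) * fps_X)"
  using assms
proof induction
  case (insert a A)
  let ?l = "\<lambda>i. 1 - fps_const (z i) * fps_X"
  let ?P = "\<Prod>i\<in>A. ?l i" and ?S = "Abs_fps (\<lambda>n. \<Sum>i\<in>A. z i ^ Suc n)"
  let ?s = "Abs_fps (\<lambda>n. z a ^ Suc n)"
  \<comment> \<open>\<open>?s\<close> is the geometric series of z a / (1 - z a X).\<close>
  have "?s * ?l a = fps_const (z a)"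
  proof (rule fps_ext)
    fix n
    have "?s * ?l a = ?s - fps_const (z a) * (?s * fps_X)" by (simp add: algebra_simps)
    hence "fps_nth (?s * ?l a) n = z a ^ Suc n - z a * (if n = 0 then 0 else z a ^ n)"
      by (cases n) simp_all
    thus "fps_nth (?s * ?l a) n = fps_nth (fps_const (z a)) n" by (cases n) auto
  qed
  hence geo: "fps_deriv (?l a) = - ?s * ?l a" by simp
  have sum: "Abs_fps (\<lambda>n. \<Sum>i\<in>insert a A. z i ^ Suc n) = ?s + ?S"
    using insert.hyps by (intro fps_ext) simp
  have "fps_deriv (\<Prod>i\<in>insert a A. ?l i) = ?l a * fps_deriv ?P + fps_deriv (?l a) * ?P"
    using insert.hyps by simp
  also have "\<dots> = - (?s + ?S) * (\<Prod>i\<in>insert a A. ?l i)"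
    unfolding insert.IH geo using insert.hyps by (simp add: algebra_simps)
  finally show ?case unfolding sum .
qed (auto intro: fps_ext)

lemma fps_nth_prod_linear:
  fixes z :: "'i \<Rightarrow> 'b :: comm_ring_1"
  assumes "finite A"
  shows "fps_nth (\<Prod>i\<in>A. 1 - fps_const (z i) * fps_X) r =
    (-1) ^ r * (\<Sum>I | I \<subseteq> A \<and> card I = r. \<Prod>i\<in>I. z i)"
proof -
  have "(\<Prod>i\<in>A. 1 - fps_const (z i) * fps_X) = (\<Prod>i\<in>A. fps_const (- z i) * fps_X + 1)"
    by (intro prod.cong) (auto simp flip: fps_const_neg)
  also have "\<dots> = (\<Sum>I\<in>Pow A. (\<Prod>i\<in>I. fps_const (- z i) * fps_X))"
    using prod_add[OF assms, of "\<lambda>i. fps_const (- z i) * fps_X" "\<lambda>_. 1"] by simp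
  also have "\<dots> = (\<Sum>I\<in>Pow A. fps_const (\<Prod>i\<in>I. - z i) * fps_X ^ card I)"
  proof (intro sum.cong refl)
    fix I assume "I \<in> Pow A"
    hence "finite I" using assms finite_subset by auto
    thus "(\<Prod>i\<in>I. fps_const (- z i) * fps_X) = fps_const (\<Prod>i\<in>I. - z i) * fps_X ^ card I"
      by induction (simp_all add: mult_ac flip: fps_const_mult)
  qed
  finally have "fps_nth (\<Prod>i\<in>A. 1 - fps_const (z i) * fps_X) r =
      (\<Sum>I\<in>Pow A. if card I = r then (\<Prod>i\<in>I. - z i) else 0)"
    by (simp add: fps_sum_nth fps_X_power_iff if_distrib eq_commute cong: if_cong)
  also have "\<dots> = (\<Sum>I | I \<subseteq> A \<and> card I = r. \<Prod>i\<in>I. - z i)"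
    using assms by (simp add: sum.If_cases Collect_conj_eq Pow_def)
  also have "\<dots> = (\<Sum>I | I \<subseteq> A \<and> card I = r. (-1) ^ r * (\<Prod>i\<in>I. z i))"
  proof (intro sum.cong refl)
    fix I assume "I \<in> {I. I \<subseteq> A \<and> card I = r}"
    thus "(\<Prod>i\<in>I. - z i) = (-1) ^ r * (\<Prod>i\<in>I. z i)"
      using prod.distrib[of "\<lambda>_. -1" z I] by auto
  qed
  finally show ?thesis by (simp add: sum_distrib_left)
qed

text \<open>The power series product is the reversal of the polynomial with roots
  \<open>z i\<close>; hence the index \<open>card A - k\<close>.\<close>

lemma fps_nth_prod_linear_coeff:
  fixes z :: "'i \<Rightarrow> 'b :: idom"
  assumes "finite A" and "k \<le> card A"
  shows "fps_nth (\<Prod>i\<in>A. 1 - fps_const (z i) * fps_X) k =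
    Polynomial.coeff (\<Prod>i\<in>A. [:- z i, 1:]) (card A - k)"
proof -
  let ?p = "\<Prod>i\<in>A. [:- z i, 1:]"
  have deg: "Polynomial.degree ?p = card A"
    by (simp add: degree_prod_eq_sum_degree)
  have "reflect_poly [:- x, 1:] = [:1, - x:]" for x :: 'b
    by (simp add: reflect_poly_def)
  hence "reflect_poly ?p = (\<Prod>i\<in>A. [:1, - z i:])" by (simp add: reflect_poly_prod)
  hence "fps_of_poly (reflect_poly ?p) = (\<Prod>i\<in>A. 1 - fps_const (z i) * fps_X)"
    by (simp add: fps_of_poly_prod fps_of_poly_pCons mult.commute flip: fps_const_neg)
  hence "fps_nth (\<Prod>i\<in>A. 1 - fps_const (z i) * fps_X) k = Polynomial.coeff (reflect_poly ?p) k"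
    by (metis fps_of_poly_nth)
  thus ?thesis using assms(2) deg by (simp add: coeff_reflect_poly)
qed

text \<open>To be instantiated with the image of the base field in its algebraic closure.\<close>

locale char_0_subfield =
  fixes R :: "'b :: field_char_0 set"
  assumes one_closed: "1 \<in> R"
    and diff_closed: "x \<in> R \<Longrightarrow> y \<in> R \<Longrightarrow> x - y \<in> R"
    and mult_closed: "x \<in> R \<Longrightarrow> y \<in> R \<Longrightarrow> x * y \<in> R"
    and inverse_closed: "x \<in> R \<Longrightarrow> inverse x \<in> R"
begin

lemma zero_closed: "0 \<in> R"
  using diff_closed[OF one_closed one_closed] by simp

lemma uminus_closed: "x \<in> R \<Longrightarrow> - x \<in> R"
  using diff_closed[OF zero_closed, of x] by simp

lemma add_closed: "x \<in> R \<Longrightarrow> y \<in> R \<Longrightarrow> x + y \<in> R"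
  using diff_closed[of x "- y"] uminus_closed by simp

lemma divide_closed: "x \<in> R \<Longrightarrow> y \<in> R \<Longrightarrow> x / y \<in> R"
  by (simp add: divide_inverse mult_closed inverse_closed)

lemma of_nat_closed: "of_nat n \<in> R"
  by (induction n) (auto intro: zero_closed one_closed add_closed)

lemma power_closed: "x \<in> R \<Longrightarrow> x ^ n \<in> R"
  by (induction n) (auto intro: one_closed mult_closed)

lemma sum_closed: "(\<And>i. i \<in> A \<Longrightarrow> f i \<in> R) \<Longrightarrow> sum f A \<in> R"
  by (induction A rule: infinite_finite_induct) (auto intro: zero_closed add_closed)

lemma fps_nth_prod_linear_closed_iff:
  assumes "finite A"
  shows "(\<forall>k. fps_nth (\<Prod>i\<in>A. 1 - fps_const (z i) * fps_X) k \<in> R) \<longleftrightarrow>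
    (\<forall>k. Polynomial.coeff (\<Prod>i\<in>A. [:- z i, 1:]) k \<in> R)"
proof (intro iffI allI)
  fix k assume F: "\<forall>k. fps_nth (\<Prod>i\<in>A. 1 - fps_const (z i) * fps_X) k \<in> R"
  show "Polynomial.coeff (\<Prod>i\<in>A. [:- z i, 1:]) k \<in> R"
  proof (cases "k \<le> card A")
    case True
    thus ?thesis using fps_nth_prod_linear_coeff[OF assms, of "card A - k" z] F
      by (metis diff_diff_cancel diff_le_self)
  next
    case False
    thus ?thesis by (subst coeff_eq_0) (auto simp: degree_prod_eq_sum_degree zero_closed)
  qed
next
  fix k assume p: "\<forall>k. Polynomial.coeff (\<Prod>i\<in>A. [:- z i, 1:]) k \<in> R"
  show "fps_nth (\<Prod>i\<in>A. 1 - fps_const (z i) * fps_X) k \<in> R"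
  proof (cases "k \<le> card A")
    case True
    thus ?thesis using fps_nth_prod_linear_coeff[OF assms, of k z] p by simp
  next
    case False
    hence "{I. I \<subseteq> A \<and> card I = k} = {}" using assms card_mono by fastforce
    hence "fps_nth (\<Prod>i\<in>A. 1 - fps_const (z i) * fps_X) k = 0"
      by (simp only: fps_nth_prod_linear[OF assms] sum.empty mult_zero_right)
    thus ?thesis using zero_closed by simp
  qed
qed

text \<open>Newton's identities can be solved recursively for either family: for the next power sum
  because the constant coefficient of the product is 1, and for the next coefficient after division
  by \<open>n + 1\<close>, which needs characteristic zero.\<close>

lemma power_sums_closed_iff:
  assumes "finite A"
  shows "(\<forall>k. (\<Sum>i\<in>A. z i ^ Suc k) \<in> R) \<longleftrightarrow>
    (\<forall>k. Polynomial.coeff (\<Prod>i\<in>A. [:- z i, 1:]) k \<in> R)"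
proof -
  let ?F = "\<Prod>i\<in>A. 1 - fps_const (z i) * fps_X"
  let ?s = "\<lambda>k. \<Sum>i\<in>A. z i ^ Suc k"
  have F0: "fps_nth ?F 0 = 1"
  proof -
    have "{I. I \<subseteq> A \<and> card I = 0} = {{}}"
      using assms by (auto simp: card_eq_0_iff dest: finite_subset)
    thus ?thesis using fps_nth_prod_linear[OF assms, of z 0] by simp
  qed
  have newton: "of_nat (Suc n) * fps_nth ?F (Suc n) = - (\<Sum>i=0..n. ?s i * fps_nth ?F (n - i))" for n
  proof -
    have "fps_nth (fps_deriv ?F) n = fps_nth (- Abs_fps ?s * ?F) n"
      using fps_deriv_prod_linear[OF assms, of z] by simp
    thus ?thesis by (simp add: fps_mult_nth sum_negf del: power_Suc)
  qed
  have "(\<forall>k. ?s k \<in> R) \<longleftrightarrow> (\<forall>k. fps_nth ?F k \<in> R)"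
  proof (intro iffI allI)
    fix k assume s: "\<forall>k. ?s k \<in> R"
    show "fps_nth ?F k \<in> R"
    proof (induction k rule: less_induct)
      case (less k)
      show ?case
      proof (cases k)
        case 0
        thus ?thesis using F0 one_closed by simp
      next
        case (Suc n)
        have "(of_nat (Suc n) :: 'b) \<noteq> 0" by (rule of_nat_neq_0)
        hence "fps_nth ?F (Suc n) = - (\<Sum>i=0..n. ?s i * fps_nth ?F (n - i)) / of_nat (Suc n)"
          using newton[of n] by (simp only: nonzero_eq_divide_eq mult.commute not_False_eq_True)
        moreover have "(\<Sum>i=0..n. ?s i * fps_nth ?F (n - i)) \<in> R"
          by (rule sum_closed, rule mult_closed) (use s less.IH Suc in \<open>simp_all del: power_Suc\<close>)
        ultimately show ?thesis unfolding Suc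
          by (simp only: divide_closed uminus_closed of_nat_closed)
      qed
    qed
  next
    fix k assume F: "\<forall>k. fps_nth ?F k \<in> R"
    show "?s k \<in> R"
    proof (induction k rule: less_induct)
      case (less n)
      have solve: "b = - a - c" if "a = - (b + c)" for a b c :: 'b using that by simp
      have "(\<Sum>i=0..n. ?s i * fps_nth ?F (n - i)) = ?s n + (\<Sum>i=0..<n. ?s i * fps_nth ?F (n - i))"
        using F0 by (simp add: sum.last_plus del: power_Suc)
      hence "?s n = - (of_nat (Suc n) * fps_nth ?F (Suc n)) - (\<Sum>i=0..<n. ?s i * fps_nth ?F (n - i))"
        using newton[of n] by (intro solve) (simp only:)
      moreover have "(\<Sum>i=0..<n. ?s i * fps_nth ?F (n - i)) \<in> R"
        by (rule sum_closed, rule mult_closed) (use F less.IH in \<open>simp_all del: power_Suc\<close>)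
      ultimately show ?case using F
        by (simp only: diff_closed uminus_closed mult_closed of_nat_closed)
    qed
  qed
  thus ?thesis using fps_nth_prod_linear_closed_iff[OF assms] by blast
qed

text \<open>The k-th power sum of the products over r-subsets is the r-th elementary symmetric function
  of the k-th powers, so Newton's identities transfer membership in \<open>R\<close> from one family to the
  other without the fundamental theorem on symmetric polynomials.\<close>

lemma subset_product_coeffs_closed:
  assumes fin: "finite A" and coeffs: "\<And>k. Polynomial.coeff (\<Prod>i\<in>A. [:- z i, 1:]) k \<in> R"
  shows "Polynomial.coeff (\<Prod>I | I \<subseteq> A \<and> card I = r. [:- (\<Prod>i\<in>I. z i), 1:]) k \<in> R"
proof -
  have s: "(\<Sum>i\<in>A. z i ^ Suc k) \<in> R" for k
    using power_sums_closed_iff[OF fin] coeffs by blast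
  have "(\<Sum>I | I \<subseteq> A \<and> card I = r. (\<Prod>i\<in>I. z i) ^ Suc k) \<in> R" for k
  proof -
    have "(\<Sum>i\<in>A. (z i ^ Suc k) ^ Suc l) \<in> R" for l
    proof -
      \<comment> \<open>Power sums are indexed from exponent 1 on, so exponent (k + 1)(l + 1) stands
        at index (k + 1)(l + 1) - 1.\<close>
      have "Suc (Suc k * Suc l - 1) = Suc k * Suc l" by simp
      thus ?thesis using s[of "Suc k * Suc l - 1"] by (simp only: power_mult)
    qed
    hence "Polynomial.coeff (\<Prod>i\<in>A. [:- (z i ^ Suc k), 1:]) j \<in> R" for j
      using power_sums_closed_iff[OF fin, of "\<lambda>i. z i ^ Suc k"] by blast
    hence F: "fps_nth (\<Prod>i\<in>A. 1 - fps_const (z i ^ Suc k) * fps_X) r \<in> R"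
      using fps_nth_prod_linear_closed_iff[OF fin, of "\<lambda>i. z i ^ Suc k"] by blast
    have "(\<Sum>I | I \<subseteq> A \<and> card I = r. (\<Prod>i\<in>I. z i) ^ Suc k) =
        (\<Sum>I | I \<subseteq> A \<and> card I = r. \<Prod>i\<in>I. z i ^ Suc k)"
      by (simp add: prod_power_distrib del: power_Suc)
    also have "\<dots> = (-1) ^ r * fps_nth (\<Prod>i\<in>A. 1 - fps_const (z i ^ Suc k) * fps_X) r"
      by (simp add: fps_nth_prod_linear[OF fin] del: power_Suc)
    finally have "(\<Sum>I | I \<subseteq> A \<and> card I = r. (\<Prod>i\<in>I. z i) ^ Suc k) =
        (-1) ^ r * fps_nth (\<Prod>i\<in>A. 1 - fps_const (z i ^ Suc k) * fps_X) r" .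
    thus ?thesis using F by (auto intro: mult_closed power_closed uminus_closed one_closed)
  qed
  thus ?thesis
    using power_sums_closed_iff[of "{I. I \<subseteq> A \<and> card I = r}" "\<lambda>I. \<Prod>i\<in>I. z i"] fin by simp
qed

end

text \<open>A set \<open>J\<close> that is not contained in \<open>{..<d}\<close> meets a padding
  zero, so its product is 0 and its factor is the monomial t; the sets inside \<open>{..<d}\<close>
  see only \<gamma>.\<close>

lemma subset_products_append_zeros:
  fixes \<gamma> :: "'a :: idom list" and r d n :: nat
  defines "es \<equiv> \<gamma> @ replicate (n - d) 0"
  assumes len: "length \<gamma> = d" and "d \<le> n"
  shows "\<exists>k. (\<Prod>J | J \<subseteq> {..<n} \<and> card J = r. [:- (\<Prod>i\<in>J. es ! i), 1:]) =
    Polynomial.monom 1 k * (\<Prod>J | J \<subseteq> {..<d} \<and> card J = r. [:- (\<Prod>i\<in>J. \<gamma> ! i), 1:])"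
proof -
  let ?S = "{J. J \<subseteq> {..<n} \<and> card J = r}" and ?S1 = "{J. J \<subseteq> {..<d} \<and> card J = r}"
  let ?l = "\<lambda>J. [:- (\<Prod>i\<in>J. es ! i), 1:]"
  have fin: "finite ?S" by simp
  have sub: "?S1 \<subseteq> ?S" using \<open>d \<le> n\<close> by auto
  have zero: "?l J = Polynomial.monom 1 1" if "J \<in> ?S - ?S1" for J
  proof -
    from that have "\<not> J \<subseteq> {..<d}" "J \<subseteq> {..<n}" by auto
    then obtain i where i: "i \<in> J" "i < n" "d \<le> i" by (auto simp: subset_iff not_less)
    hence "es ! i = 0" using len by (simp add: es_def nth_append)
    moreover have "finite J" using that by (auto intro: finite_subset)
    ultimately have "(\<Prod>i\<in>J. es ! i) = 0" using i(1) by (intro prod_zero) auto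
    thus ?thesis by (simp add: monom_altdef)
  qed
  have "(\<Prod>J\<in>?S. ?l J) = (\<Prod>J\<in>?S - ?S1. ?l J) * (\<Prod>J\<in>?S1. ?l J)"
    by (rule prod.subset_diff[OF sub fin])
  also have "(\<Prod>J\<in>?S - ?S1. ?l J) = (\<Prod>J\<in>?S - ?S1. Polynomial.monom 1 1)"
    using zero by (intro prod.cong refl) auto
  also have "\<dots> = Polynomial.monom 1 (card (?S - ?S1))"
    by (simp add: monom_altdef)
  also have "(\<Prod>J\<in>?S1. ?l J) = (\<Prod>J\<in>?S1. [:- (\<Prod>i\<in>J. \<gamma> ! i), 1:])"
  proof (intro prod.cong refl)
    fix J assume "J \<in> ?S1"
    hence "(\<Prod>i\<in>J. es ! i) = (\<Prod>i\<in>J. \<gamma> ! i)"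
      using len by (intro prod.cong refl) (auto simp: es_def nth_append)
    thus "?l J = [:- (\<Prod>i\<in>J. \<gamma> ! i), 1:]" by simp
  qed
  finally show ?thesis by blast
qed

section \<open>Determinantal sequences driven by a matrix, and descent to the base field\<close>

text \<open>Write M = P U Q with U triangular and Q inverse to P. Then z = Q y is driven by U, and
  x' = x P pairs with z as x pairs with y. The determinants are unchanged, and the triangular case
  applies.\<close>

lemma det_sequence_annihilated:
  fixes M :: "'a :: field mat" and y :: "nat \<Rightarrow> nat \<Rightarrow> nat \<Rightarrow> 'a"
  assumes M: "M \<in> carrier_mat n n" and split: "char_poly M = (\<Prod>e\<leftarrow>es. [:- e, 1:])"
    and step: "\<And>j l k. j < r \<Longrightarrow> k < n \<Longrightarrow> y j (Suc l) k = (\<Sum>k'<n. M $$ (k, k') * y j l k')"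
  shows "shift_app (\<Prod>J | J \<subseteq> {..<n} \<and> card J = r. [:- (\<Prod>i\<in>J. es ! i), 1:])
    (\<lambda>l. \<Sum>\<sigma> | \<sigma> permutes {..<r}. of_int (sign \<sigma>) * (\<Prod>i<r. \<Sum>k<n. x i k * y (\<sigma> i) l k)) l = 0"
proof -
  obtain U where U: "similar_mat M U" "upper_triangular U" "diag_mat U = es"
    using similar_upper_triangular_of_split[OF M split] by blast
  obtain P Q where PQ: "similar_mat_wit M U P Q" using U(1) unfolding similar_mat_def by blast
  note w = similar_mat_witD2[OF M PQ]
  define v where "v j l = Matrix.vec n (y j l)" for j l
  define z where "z j l k = (Q *\<^sub>v v j l) $ k" for j l k
  have v: "v j l \<in> carrier_vec n" for j l by (simp add: v_def)
  have v_step: "v j (Suc l) = M *\<^sub>v v j l" if "j < r" for j l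
    using M step[OF that] by (intro eq_vecI) (auto simp: v_def scalar_prod_def lessThan_atLeast0)
  have Qv_step: "Q *\<^sub>v v j (Suc l) = U *\<^sub>v (Q *\<^sub>v v j l)" if "j < r" for j l
  proof -
    have "Q *\<^sub>v v j (Suc l) = Q *\<^sub>v (P * U * Q *\<^sub>v v j l)" using v_step[OF that] w(3) by simp
    also have "\<dots> = (Q * (P * U * Q)) *\<^sub>v v j l"
      using w v by (intro assoc_mult_mat_vec[symmetric]) auto
    also have "Q * (P * U * Q) = Q * (P * (U * Q))"
      using w by (intro arg_cong[where f = "(*) Q"] assoc_mult_mat[of _ n n _ n _ n]) auto
    also have "\<dots> = (Q * P) * (U * Q)"
      using w by (intro assoc_mult_mat[symmetric, of _ n n _ n _ n]) auto
    also have "\<dots> = U * Q" using w by simp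
    also have "U * Q *\<^sub>v v j l = U *\<^sub>v (Q *\<^sub>v v j l)" using w v by (intro assoc_mult_mat_vec) auto
    finally show ?thesis .
  qed
  define x' where "x' i k = (\<Sum>k'<n. x i k' * P $$ (k', k))" for i k
  have Pz: "y j l k = (\<Sum>k'<n. P $$ (k, k') * z j l k')" if "k < n" for j l k
  proof -
    have "v j l = (P * Q) *\<^sub>v v j l" using w v by simp
    also have "\<dots> = P *\<^sub>v (Q *\<^sub>v v j l)" using w v by (intro assoc_mult_mat_vec) auto
    finally have "v j l $ k = (P *\<^sub>v (Q *\<^sub>v v j l)) $ k" by simp
    thus ?thesis using that w by (simp add: v_def z_def scalar_prod_def lessThan_atLeast0)
  qed
  have eq: "(\<Sum>k<n. x i k * y j l k) = (\<Sum>k<n. x' i k * z j l k)" for i j l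
  proof -
    have "(\<Sum>k<n. x i k * y j l k) = (\<Sum>k<n. \<Sum>k'<n. x i k * P $$ (k, k') * z j l k')"
      using Pz by (intro sum.cong refl) (simp add: sum_distrib_left mult.assoc)
    also have "\<dots> = (\<Sum>k<n. x' i k * z j l k)"
      by (subst sum.swap) (simp add: x'_def sum_distrib_right)
    finally show ?thesis .
  qed
  interpret triangular_sequences "\<lambda>i j. U $$ (i, j)" z n r
  proof
    show "U $$ (i, j) = 0" if "i < n" "j < i" for i j
      using U(2) w that by (auto simp: upper_triangular_def)
    show "z j (Suc l) k = (\<Sum>k'<n. U $$ (k, k') * z j l k')" if "j < r" "k < n" for j k l
      using that w unfolding z_def Qv_step[OF that(1)] by (simp add: scalar_prod_def lessThan_atLeast0)
  qed
  have diag: "U $$ (i, i) = es ! i" if "i < n" for i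
    using that w U(3) by (auto simp: diag_mat_def)
  have "(\<Prod>J | J \<subseteq> {..<n} \<and> card J = r. [:- (\<Prod>i\<in>J. es ! i), 1:]) =
      (\<Prod>J | J \<subseteq> {..<n} \<and> card J = r. [:- (\<Prod>i\<in>J. U $$ (i, i)), 1:])"
  proof (intro prod.cong refl)
    fix J assume "J \<in> {J. J \<subseteq> {..<n} \<and> card J = r}"
    hence "(\<Prod>i\<in>J. es ! i) = (\<Prod>i\<in>J. U $$ (i, i))" using diag by (intro prod.cong) auto
    thus "[:- (\<Prod>i\<in>J. es ! i), 1:] = [:- (\<Prod>i\<in>J. U $$ (i, i)), 1:]" by simp
  qed
  thus ?thesis unfolding eq by (simp only: det_annihilated)
qed

lemma prod_list_proots:
  fixes q :: "'a :: alg_closed_field poly"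
  assumes "q \<noteq> 0" and \<gamma>: "mset \<gamma> = proots q"
  shows "q = Polynomial.smult (Polynomial.lead_coeff q) (\<Prod>x\<leftarrow>\<gamma>. [:- x, 1:])"
proof -
  obtain M where M: "q = Polynomial.smult (Polynomial.lead_coeff q) (\<Prod>x\<in>#M. [:- x, 1:])"
    using alg_closed_imp_factorization[OF assms(1)] by blast
  have "proots (\<Prod>x\<in>#M. [:- x, 1:]) = M"
  proof (induction M)
    case (add x M)
    have "(\<Prod>x\<in>#M. [:- x, 1:]) \<noteq> 0" by (auto simp: prod_mset_zero_iff)
    hence "proots ([:- x, 1:] * (\<Prod>x\<in>#M. [:- x, 1:])) = {#x#} + M"
      using add by (subst proots_mult) auto
    thus ?case by simp
  qed simp
  moreover have "Polynomial.lead_coeff q \<noteq> 0" using assms(1) by simp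
  ultimately have "proots q = M" using M by (metis proots_smult)
  hence "(\<Prod>x\<in>#M. [:- x, 1:]) = (\<Prod>x\<leftarrow>\<gamma>. [:- x, 1:])"
    unfolding \<gamma>[symmetric] by (metis mset_map prod_mset_prod_list)
  thus ?thesis using M by simp
qed

lemma poly_to_ac_of_coeffs:
  assumes "\<And>k. Polynomial.coeff p k \<in> range to_ac"
  shows "\<exists>P. map_poly to_ac P = p"
proof
  show "map_poly to_ac (map_poly of_ac p) = p"
    by (intro poly_eqI) (simp add: coeff_map_poly to_ac_of_ac[OF assms])
qed

interpretation to_ac_hom: inj_comm_ring_hom "to_ac :: 'a :: field \<Rightarrow> 'a alg_closure"
  by unfold_locales auto

lemma shift_app_to_ac:
  "to_ac (shift_app P f l) = shift_app (map_poly to_ac P) (\<lambda>l. to_ac (f l)) l"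
  by (simp add: shift_app_def to_ac_sum coeff_map_poly)

text \<open>After division by the leading coefficient, the monic product over the roots has
  coefficients in the base field; \<open>subset_product_coeffs_closed\<close> passes this on to the
  products over r-subsets.\<close>

lemma poly_e_coeffs_in_base:
  fixes q :: "'a :: field_char_0 poly"
  assumes "q \<noteq> 0"
  shows "\<exists>P. map_poly to_ac P = poly_e r (map_poly to_ac q)"
proof -
  let ?Q = "map_poly to_ac q"
  \<comment> \<open>The same choice term as in \<open>poly_e\<close>, so that its unfolded
    definition speaks about this very list of roots.\<close>
  define \<gamma> where "\<gamma> = (SOME \<gamma>. mset \<gamma> = proots ?Q)"
  have \<gamma>: "mset \<gamma> = proots ?Q" unfolding \<gamma>_def using ex_mset by (rule someI_ex)
  have Q0: "?Q \<noteq> 0" using assms by simp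
  have c: "Polynomial.lead_coeff ?Q \<noteq> 0" using Q0 by simp
  have M: "?Q = Polynomial.smult (Polynomial.lead_coeff ?Q) (\<Prod>i<length \<gamma>. [:- (\<gamma> ! i), 1:])"
  proof -
    have "(\<Prod>x\<leftarrow>\<gamma>. [:- x, 1:]) = (\<Prod>i<length \<gamma>. [:- (\<gamma> ! i), 1:])"
      by (simp add: prod.list_conv_set_nth lessThan_atLeast0)
    thus ?thesis using prod_list_proots[OF Q0 \<gamma>] by (simp only:)
  qed
  interpret char_0_subfield "range (to_ac :: 'a \<Rightarrow> 'a alg_closure)"
  proof
    fix x y :: "'a alg_closure" assume "x \<in> range to_ac" "y \<in> range to_ac"
    then obtain a b where ab: "x = to_ac a" "y = to_ac b" by blast
    show "x - y \<in> range to_ac" "x * y \<in> range to_ac" "inverse x \<in> range to_ac"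
      unfolding ab to_ac_diff[symmetric] to_ac_mult[symmetric] to_ac_inverse[symmetric] by blast+
  qed (simp flip: to_ac_1)
  have "Polynomial.coeff (\<Prod>i<length \<gamma>. [:- (\<gamma> ! i), 1:]) k \<in> range to_ac" for k
  proof -
    have "Polynomial.coeff ?Q k =
        Polynomial.lead_coeff ?Q * Polynomial.coeff (\<Prod>i<length \<gamma>. [:- (\<gamma> ! i), 1:]) k"
      by (subst M) simp
    hence "Polynomial.coeff (\<Prod>i<length \<gamma>. [:- (\<gamma> ! i), 1:]) k =
        Polynomial.coeff ?Q k / Polynomial.lead_coeff ?Q"
      using c by (simp add: field_simps)
    moreover have "Polynomial.coeff ?Q j \<in> range to_ac" for j by (simp add: coeff_map_poly)
    ultimately show ?thesis using divide_closed by presburger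
  qed
  from subset_product_coeffs_closed[OF _ this]
  have "Polynomial.coeff (poly_e r ?Q) k \<in> range to_ac" for k
    by (simp add: poly_e_def Let_def flip: \<gamma>_def)
  thus ?thesis by (rule poly_to_ac_of_coeffs)
qed

text \<open>The eigenvalues of \<open>M\<close> are the roots of \<open>q\<close> and zeros; products over sets that meet the
  additional zeros contribute a power of the shift operator only.\<close>

lemma poly_e_annihilates:
  fixes M :: "'a :: field_char_0 mat" and q :: "'a poly" and x :: "nat \<Rightarrow> nat \<Rightarrow> 'a"
  assumes M: "M \<in> carrier_mat n n" and "d \<le> n"
    and cp: "char_poly M = Polynomial.smult c (Polynomial.monom 1 (n - d) * q)"
    and step: "\<And>j l k. j < r \<Longrightarrow> k < n \<Longrightarrow> y j (Suc l) k = (\<Sum>k'<n. M $$ (k, k') * y j l k')"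
    and f: "\<And>l. f (l + l0) = (\<Sum>\<sigma> | \<sigma> permutes {..<r}. of_int (sign \<sigma>) *
        (\<Prod>i<r. \<Sum>k<n. x i k * y (\<sigma> i) l k))"
  shows "\<exists>P. map_poly to_ac P = poly_e r (map_poly to_ac q) \<and> satisfies_recurrence f P"
proof -
  let ?Q = "map_poly to_ac q"
  let ?M = "map_mat to_ac M"
  have monic: "Polynomial.lead_coeff (char_poly M) = 1" "Polynomial.degree (char_poly M) = n"
    using degree_monic_char_poly[OF M] by auto
  hence q0: "q \<noteq> 0" "c \<noteq> 0" using cp by auto
  obtain P where P: "map_poly to_ac P = poly_e r ?Q" using poly_e_coeffs_in_base[OF q0(1)] by blast
  define \<gamma> where "\<gamma> = (SOME \<gamma>. mset \<gamma> = proots ?Q)"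
  have \<gamma>: "mset \<gamma> = proots ?Q" unfolding \<gamma>_def using ex_mset by (rule someI_ex)
  have poly_e: "poly_e r ?Q =
      (\<Prod>J | J \<subseteq> {..<length \<gamma>} \<and> card J = r. [:- (\<Prod>i\<in>J. \<gamma> ! i), 1:])"
    by (simp add: poly_e_def Let_def flip: \<gamma>_def)
  define es where "es = \<gamma> @ replicate (n - d) 0"
  have M': "?M \<in> carrier_mat n n" using M by simp
  have cp': "char_poly ?M = (\<Prod>e\<leftarrow>es. [:- e, 1:])"
  proof -
    have R: "?Q = Polynomial.smult (Polynomial.lead_coeff ?Q) (\<Prod>e\<leftarrow>\<gamma>. [:- e, 1:])"
      using q0 by (intro prod_list_proots[OF _ \<gamma>]) simp
    have "(\<Prod>e\<leftarrow>es. [:- e, 1:]) = Polynomial.monom 1 (n - d) * (\<Prod>e\<leftarrow>\<gamma>. [:- e, 1:])"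
      by (simp add: es_def monom_altdef prod_list_replicate)
    moreover have "char_poly ?M = map_poly to_ac (char_poly M)"
      using to_ac_hom.char_poly_hom[OF M] .
    moreover have "map_poly to_ac (char_poly M) =
        Polynomial.smult (to_ac c) (Polynomial.monom 1 (n - d) * ?Q)"
      unfolding cp
      by (intro poly_eqI) (simp add: coeff_map_poly coeff_monom_mult)
    moreover have "Polynomial.monom 1 (n - d) * ?Q =
        Polynomial.smult (Polynomial.lead_coeff ?Q) (Polynomial.monom 1 (n - d) * (\<Prod>e\<leftarrow>\<gamma>. [:- e, 1:]))"
      by (subst R) (rule mult_smult_right)
    ultimately have "char_poly ?M =
        Polynomial.smult (to_ac c * Polynomial.lead_coeff ?Q) (\<Prod>e\<leftarrow>es. [:- e, 1:])"
      by (simp only: smult_smult)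
    then obtain a where a: "char_poly ?M = Polynomial.smult a (\<Prod>e\<leftarrow>es. [:- e, 1:])" by blast
    \<comment> \<open>Both polynomials are monic, which determines the scalar \<open>a\<close>
      without any knowledge of \<open>c\<close> or the leading coefficient of
      \<open>q\<close>.\<close>
    have "Polynomial.lead_coeff (\<Prod>e\<leftarrow>es. [:- e, 1:]) = 1"
      by (rule monic_prod_list) auto
    hence "a = 1" using a degree_monic_char_poly[OF M'] by (metis lead_coeff_smult mult.right_neutral)
    thus ?thesis using a by simp
  qed
  have "Polynomial.degree (\<Prod>e\<leftarrow>es. [:- e, 1:]) = length es" by (rule degree_linear_factors)
  hence "length es = n" using cp' degree_monic_char_poly[OF M'] by simp
  hence len: "length \<gamma> = d" using \<open>d \<le> n\<close> by (simp add: es_def)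
  obtain k where k: "(\<Prod>J | J \<subseteq> {..<n} \<and> card J = r. [:- (\<Prod>i\<in>J. es ! i), 1:]) =
      Polynomial.monom 1 k * map_poly to_ac P"
    using subset_products_append_zeros[OF len \<open>d \<le> n\<close>, of r] unfolding P poly_e es_def len by blast
  define F where "F l = to_ac (f (l + l0))" for l
  have F: "F l = (\<Sum>\<sigma> | \<sigma> permutes {..<r}. of_int (sign \<sigma>) *
      (\<Prod>i<r. \<Sum>k<n. to_ac (x i k) * to_ac (y (\<sigma> i) l k)))" for l
    by (simp add: F_def f to_ac_sum to_ac_prod)
  have "shift_app (Polynomial.monom 1 k * map_poly to_ac P) F l = 0" for l
    unfolding k[symmetric] F[abs_def]
  proof (rule det_sequence_annihilated[OF M' cp'])
    fix j l k assume "j < r" "k < n"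
    thus "to_ac (y j (Suc l) k) = (\<Sum>k'<n. ?M $$ (k, k') * to_ac (y j l k'))"
      using M by (simp add: step to_ac_sum)
  qed
  \<comment> \<open>The factor t^k acts as k shifts, so the remaining factor annihilates F from
    position k on.\<close>
  moreover have "shift_app (Polynomial.monom 1 k * p) F l = shift_app p F (l + k)" for p l
    by (induction k arbitrary: l) (simp_all add: monom_Suc shift_app_pCons)
  ultimately have "shift_app (map_poly to_ac P) F (l + k) = 0" for l by simp
  moreover have "to_ac (shift_app P f (l + l0)) = shift_app (map_poly to_ac P) F l" for l
    unfolding shift_app_to_ac by (simp add: shift_app_def F_def add.assoc add.commute[of l0])
  ultimately have "to_ac (shift_app P f (l + k + l0)) = 0" for l by simp
  hence "shift_app P f l = 0" if "l \<ge> k + l0" for l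
    using that by (metis add.assoc add.commute le_Suc_ex to_ac_eq_0_iff)
  hence "\<forall>\<^sub>\<infinity>l. shift_app P f l = 0" by (auto simp: MOST_nat_le)
  moreover have "Polynomial.lead_coeff P = 1"
  proof -
    have "to_ac (Polynomial.lead_coeff P) = Polynomial.lead_coeff (map_poly to_ac P)"
      by simp
    also have "\<dots> = 1" unfolding P poly_e by (intro monic_prod) auto
    finally show ?thesis by simp
  qed
  ultimately show ?thesis using P by (auto simp: satisfies_recurrence_def shift_app_def)
qed

section \<open>Determinants as sums over families of disjoint cycles\<close>

lemma sign_cycle_of_list:
  assumes "distinct xs" "xs \<noteq> []"
  shows "sign (cycle_of_list xs) = - ((- 1) ^ length xs)"
  using assms
proof (induction xs rule: cycle_of_list.induct)
  case (1 i j cs)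
  hence "sign (cycle_of_list (i # j # cs)) = sign (Transposition.transpose i j) * sign (cycle_of_list (j # cs))"
    by (simp only: cycle_of_list.simps sign_compose permutation_swap_id permutation_of_cycle)
  thus ?case using 1 by (simp add: sign_swap_id del: cycle_of_list.simps)
qed (simp_all add: sign_id)

context pre_digraph
begin

lemma cas_iff_map: "cas u p v \<longleftrightarrow> map (tail G) p @ [v] = u # map (head G) p"
  by (induction p arbitrary: u) auto

text \<open>For a closed walk, the list of heads is the list of tails moved on by one place. This
  form mentions no starting vertex and matches the way \<open>cycle_of_list\<close> acts on a
  list.\<close>

lemma cycle_iff_rotate1:
  assumes "wf_digraph G"
  shows "cycle p \<longleftrightarrow> p \<noteq> [] \<and> set p \<subseteq> arcs G \<and> distinct (map (tail G) p) \<and>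
    map (head G) p = rotate1 (map (tail G) p)"
proof (cases p)
  case (Cons e es)
  have "cycle p \<longleftrightarrow> (\<exists>u. u \<in> verts G \<and> set p \<subseteq> arcs G \<and> cas u p u \<and> distinct (map (head G) p))"
    unfolding cycle_def awalk_def
    using awalk_verts_conv'[of _ p] Cons by auto
  also have "\<dots> \<longleftrightarrow> set p \<subseteq> arcs G \<and> map (head G) p = rotate1 (map (tail G) p) \<and>
      distinct (map (head G) p)"
    using Cons assms by (auto simp: cas_iff_map intro: wf_digraph.tail_in_verts)
  also have "\<dots> \<longleftrightarrow> p \<noteq> [] \<and> set p \<subseteq> arcs G \<and> distinct (map (tail G) p) \<and>
      map (head G) p = rotate1 (map (tail G) p)"
    using Cons distinct_rotate[of 1 "map (tail G) p"] by (metis distinct1_rotate list.distinct(1))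
  finally show ?thesis .
qed (auto simp: cycle_def)

text \<open>The r-cycles of an arbitrary digraph, for all r together; cycles are again represented
  by their arc sets.\<close>

definition cycle_families :: "'b set set set" where
  "cycle_families = {Cs. Cs \<subseteq> {set p | p. cycle p} \<and>
     pairwise (\<lambda>C D. disjnt (tail G ` C) (tail G ` D)) Cs}"

end

locale enumerated_digraph = fin_digraph G for G :: "('a, 'b) pre_digraph" +
  fixes \<nu> :: "'a \<Rightarrow> nat" and n :: nat
  assumes enum: "bij_betw \<nu> (verts G) {..<n}"
begin

definition T :: "'b \<Rightarrow> nat" where "T c = \<nu> (tail G c)"
definition H :: "'b \<Rightarrow> nat" where "H c = \<nu> (head G c)"
abbreviation cycs :: "'b set set" where "cycs \<equiv> {set p | p. cycle p}"

lemma inj_\<nu>: "inj_on \<nu> (verts G)"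
  using enum by (rule bij_betw_imp_inj_on)

lemma T_less: "c \<in> arcs G \<Longrightarrow> T c < n"
  using enum by (auto simp: bij_betw_def T_def)

lemma cycle_iff:
  "cycle p \<longleftrightarrow> p \<noteq> [] \<and> set p \<subseteq> arcs G \<and> distinct (map T p) \<and> map H p = rotate1 (map T p)"
proof (cases "set p \<subseteq> arcs G")
  case True
  hence sub: "set (map (tail G) p) \<subseteq> verts G" "set (map (head G) p) \<subseteq> verts G" by auto
  have "distinct (map T p) \<longleftrightarrow> distinct (map (tail G) p)"
    using sub inj_\<nu> distinct_map[of \<nu> "map (tail G) p"] inj_on_subset[of \<nu> "verts G"]
    by (simp add: o_def T_def[abs_def])
  moreover have "map H p = rotate1 (map T p) \<longleftrightarrow>
      map \<nu> (map (head G) p) = map \<nu> (rotate1 (map (tail G) p))"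
    by (simp add: rotate1_map o_def T_def[abs_def] H_def[abs_def])
  moreover have "\<dots> \<longleftrightarrow> map (head G) p = rotate1 (map (tail G) p)"
    using inj_on_subset[OF inj_\<nu>, of "set (map (head G) p) \<union> set (rotate1 (map (tail G) p))"] sub
    by (intro inj_on_map_eq_map) simp
  ultimately show ?thesis using cycle_iff_rotate1[OF wf_digraph] by simp
next
  case False
  thus ?thesis using cycle_iff_rotate1[OF wf_digraph] by simp
qed

lemma cycle_succ:
  assumes "cycle p" "j < length p"
  shows "H (p ! j) = T (p ! (Suc j mod length p))"
proof -
  have "map H p ! j = rotate1 (map T p) ! j" using assms(1) by (simp add: cycle_iff)
  moreover have "Suc j mod length p < length p" using assms(2) by (intro mod_less_divisor) linarith
  ultimately show ?thesis using assms(2) by (simp add: nth_rotate1)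
qed

text \<open>Since \<open>E\<close> has at most one arc for each tail, an arc of a cycle inside
  \<open>E\<close> determines its successor. From the common arc on, \<open>q\<close> therefore
  follows \<open>p\<close> all the way round.\<close>

lemma cycle_subset_of_common_arc:
  assumes p: "cycle p" and q: "cycle q" and E: "set p \<subseteq> E" "set q \<subseteq> E" "inj_on T E"
    and c: "c \<in> set p" "c \<in> set q"
  shows "set p \<subseteq> set q"
proof -
  let ?l = "length p"
  have len: "?l > 0" using p by (simp add: cycle_iff)
  obtain a where a: "a < ?l" "p ! a = c" using c(1) by (metis in_set_conv_nth)
  have step: "p ! ((a + k) mod ?l) \<in> set q" for k
  proof (induction k)
    case 0
    thus ?case using a c(2) by simp
  next
    case (Suc k)
    let ?j = "(a + k) mod ?l"
    have j: "?j < ?l" using len by simp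
    have sj: "Suc ?j mod ?l = (a + Suc k) mod ?l" by (simp add: mod_Suc_eq)
    obtain i where i: "i < length q" "q ! i = p ! ?j" using Suc by (metis in_set_conv_nth)
    let ?e = "q ! (Suc i mod length q)"
    have e: "?e \<in> set q" using i(1) by (intro nth_mem mod_less_divisor) linarith
    have "T (p ! (Suc ?j mod ?l)) = T ?e"
      using cycle_succ[OF p j] cycle_succ[OF q i(1)] i(2) by simp
    moreover have "p ! (Suc ?j mod ?l) \<in> E" using E(1) len by (intro subsetD[OF E(1)] nth_mem) simp
    ultimately have "p ! (Suc ?j mod ?l) = ?e" using e E(2,3) by (metis inj_onD subsetD)
    thus ?case using e sj by simp
  qed
  show ?thesis
  proof
    fix x assume "x \<in> set p"
    then obtain i where i: "i < ?l" "p ! i = x" by (metis in_set_conv_nth)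
    have "(a + (?l - a + i)) mod ?l = i" using a i by simp
    thus "x \<in> set q" using step[of "?l - a + i"] i by simp
  qed
qed

lemma cycs_eq_of_common_arc:
  assumes "C \<in> cycs" "D \<in> cycs" "C \<subseteq> E" "D \<subseteq> E" "inj_on T E" "c \<in> C" "c \<in> D"
  shows "C = D"
  using assms cycle_subset_of_common_arc by (smt (verit) mem_Collect_eq subset_antisym)

lemma cycs_nonempty: "C \<in> cycs \<Longrightarrow> C \<noteq> {}" and cycs_arcs: "C \<in> cycs \<Longrightarrow> C \<subseteq> arcs G"
  by (auto simp: cycle_iff)

lemma finite_cycs: "finite cycs"
  by (rule finite_subset[of _ "Pow (arcs G)"]) (use cycs_arcs in auto)

lemma finite_cycle_families: "finite cycle_families"
  by (rule finite_subset[of _ "Pow cycs"]) (use finite_cycs in \<open>auto simp: cycle_families_def\<close>)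

text \<open>The cyclic permutation of the tail numbers, in the order of the cycle, sends each tail
  to the corresponding head by the rotation description. A cycle of length l has sign (-1)^(l - 1),
  written here without subtraction.\<close>

lemma cycs_permutation:
  assumes "C \<in> cycs"
  shows "\<exists>\<sigma>. \<sigma> permutes T ` C \<and> (\<forall>c\<in>C. \<sigma> (T c) = H c) \<and>
    sign \<sigma> = - ((- 1) ^ card C) \<and> inj_on T C"
proof -
  obtain p where p: "cycle p" "C = set p" using assms by auto
  let ?s = "map T p"
  have s: "distinct ?s" "?s \<noteq> []" and H: "map H p = rotate1 ?s" using p(1) by (auto simp: cycle_iff)
  have "cycle_of_list ?s permutes T ` C" using cycle_permutes[of ?s] p(2) by simp
  moreover have "map (cycle_of_list ?s) ?s = map H p"
    using cyclic_rotation[OF s(1), of 1] H by simp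
  hence "\<forall>c\<in>C. cycle_of_list ?s (T c) = H c" using p(2) by simp
  moreover have "card C = length ?s" using s(1) p(2) by (simp add: distinct_map distinct_card)
  hence "sign (cycle_of_list ?s) = - ((- 1) ^ card C)" using sign_cycle_of_list[OF s] by simp
  ultimately show ?thesis using s(1) p(2) by (auto simp: distinct_map)
qed

text \<open>The product of the cyclic permutations of the members. They have disjoint supports
  because the tails are disjoint, and each member C contributes the sign - (-1)^(card C).\<close>

lemma cycle_family_permutation:
  assumes "finite Cs" "Cs \<in> cycle_families"
  shows "\<exists>\<sigma>. \<sigma> permutes T ` \<Union>Cs \<and> (\<forall>c\<in>\<Union>Cs. \<sigma> (T c) = H c) \<and>
    sign \<sigma> = (- 1) ^ (card Cs + card (\<Union>Cs)) \<and> inj_on T (\<Union>Cs)"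
  using assms
proof (induction Cs rule: finite_induct)
  case empty
  show ?case by (rule exI[of _ id]) (auto simp: permutes_id)
next
  case (insert C Cs)
  have fam: "C \<in> cycs" "Cs \<in> cycle_families"
    using insert.prems by (auto simp: cycle_families_def pairwise_insert)
  obtain \<sigma> where \<sigma>: "\<sigma> permutes T ` \<Union>Cs" "\<forall>c\<in>\<Union>Cs. \<sigma> (T c) = H c"
    "sign \<sigma> = (- 1) ^ (card Cs + card (\<Union>Cs))" "inj_on T (\<Union>Cs)"
    using insert.IH[OF fam(2)] by blast
  obtain \<rho> where \<rho>: "\<rho> permutes T ` C" "\<forall>c\<in>C. \<rho> (T c) = H c"
    "sign \<rho> = - ((- 1) ^ card C)" "inj_on T C"
    using cycs_permutation[OF fam(1)] by blast
  have sub: "C \<subseteq> arcs G" "\<Union>Cs \<subseteq> arcs G"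
  proof -
    have "Cs \<subseteq> cycs" using fam(2) by (simp add: cycle_families_def)
    thus "C \<subseteq> arcs G" "\<Union>Cs \<subseteq> arcs G" using fam(1) cycs_arcs by blast+
  qed
  hence fin: "finite C" "finite (\<Union>Cs)" using finite_subset by (metis finite_arcs)+
  have disj: "T c \<noteq> T d" if cd: "c \<in> C" "d \<in> \<Union>Cs" for c d
  proof -
    obtain D where D: "D \<in> Cs" "d \<in> D" using cd(2) by blast
    hence "disjnt (tail G ` C) (tail G ` D)"
      using insert.prems insert.hyps by (auto simp: cycle_families_def pairwise_insert)
    hence "tail G c \<noteq> tail G d" using cd(1) D(2) by (auto simp: disjnt_iff)
    moreover have "tail G c \<in> verts G" "tail G d \<in> verts G" using cd sub by auto
    ultimately show ?thesis unfolding T_def using inj_onD[OF inj_\<nu>, of "tail G c" "tail G d"] by blast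
  qed
  have fix_C: "\<sigma> (T c) = T c" if "c \<in> C" for c
    using that disj by (intro permutes_not_in[OF \<sigma>(1)]) auto
  have "(\<rho> \<circ> \<sigma>) (T c) = H c" if "c \<in> \<Union>(insert C Cs)" for c
  proof (cases "c \<in> C")
    case True
    thus ?thesis using fix_C \<rho>(2) by simp
  next
    case False
    hence c: "c \<in> \<Union>Cs" using that by simp
    have "\<sigma> (T c) \<in> T ` \<Union>Cs" using c permutes_in_image[OF \<sigma>(1)] by blast
    hence "\<sigma> (T c) \<notin> T ` C" using disj by (auto simp: image_iff) metis
    moreover have "\<sigma> (T c) = H c" using \<sigma>(2) c by blast
    ultimately show ?thesis using permutes_not_in[OF \<rho>(1)] by simp
  qed
  moreover have "\<rho> \<circ> \<sigma> permutes T ` \<Union>(insert C Cs)"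
    by (rule permutes_compose; rule permutes_subset[OF \<sigma>(1)] permutes_subset[OF \<rho>(1)]) auto
  moreover have "sign (\<rho> \<circ> \<sigma>) = (- 1) ^ (card (insert C Cs) + card (\<Union>(insert C Cs)))"
  proof -
    have "C \<inter> \<Union>Cs = {}" using disj by blast
    hence "card (\<Union>(insert C Cs)) = card C + card (\<Union>Cs)"
      using card_Un_disjoint[OF fin] by simp
    moreover have "permutation \<rho>" "permutation \<sigma>"
      using \<rho>(1) \<sigma>(1) fin by (auto simp: permutation_permutes)
    ultimately show ?thesis using \<sigma>(3) \<rho>(3) insert.hyps by (simp add: sign_compose power_add)
  qed
  moreover have "inj_on T (\<Union>(insert C Cs))"
    using \<sigma>(4) \<rho>(4) disj by (auto simp: inj_on_Un image_iff)
  ultimately show ?case by blast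
qed

text \<open>The sets of arcs that occur when the Leibniz term of \<open>\<sigma>\<close> is multiplied out; every vertex
  outside such a set contributes its diagonal entry.\<close>

definition balanced :: "(nat \<Rightarrow> nat) \<Rightarrow> 'b set set" where
  "balanced \<sigma> = {E. E \<subseteq> arcs G \<and> inj_on T E \<and> (\<forall>c\<in>E. \<sigma> (T c) = H c) \<and>
     (\<forall>i<n. i \<notin> T ` E \<longrightarrow> \<sigma> i = i)}"

lemma finite_balanced: "finite (balanced \<sigma>)"
  by (rule finite_subset[of _ "Pow (arcs G)"]) (auto simp: balanced_def)

lemma prod_expand_balanced:
  fixes b :: "'b \<Rightarrow> 'c :: comm_ring_1"
  shows "(\<Prod>i<n. (if i = \<sigma> i then t else 0) - (\<Sum>c | c \<in> arcs G \<and> T c = i \<and> H c = \<sigma> i. b c)) =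
    (\<Sum>E\<in>balanced \<sigma>. (\<Prod>c\<in>E. - b c) * t ^ (n - card E))"
proof -
  define Out where "Out i = {c. c \<in> arcs G \<and> T c = i \<and> H c = \<sigma> i}" for i
  have finOut: "finite (Out i)" for i unfolding Out_def by simp
  let ?\<delta> = "\<lambda>i. if i = \<sigma> i then t else 0"
  let ?term = "\<lambda>Y g. (\<Prod>i\<in>Y. - b (g i)) * (\<Prod>i\<in>{..<n} - Y. ?\<delta> i)"
  define S where "S = (SIGMA Y:Pow {..<n}. PiE Y Out)"
  define S' where "S' = {(Y, g) \<in> S. \<forall>i\<in>{..<n} - Y. \<sigma> i = i}"
  have finS: "finite S"
    unfolding S_def using finOut by (auto intro!: finite_SigmaI finite_PiE intro: finite_subset)
  have "(\<Prod>i<n. ?\<delta> i - (\<Sum>c | c \<in> arcs G \<and> T c = i \<and> H c = \<sigma> i. b c)) =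
      (\<Prod>i<n. (\<Sum>c\<in>Out i. - b c) + ?\<delta> i)"
    by (intro prod.cong refl) (simp add: Out_def sum_negf)
  also have "\<dots> = (\<Sum>Y\<in>Pow {..<n}. (\<Prod>i\<in>Y. \<Sum>c\<in>Out i. - b c) * (\<Prod>i\<in>{..<n} - Y. ?\<delta> i))"
    by (rule prod_add) simp
  also have "\<dots> = (\<Sum>Y\<in>Pow {..<n}. \<Sum>g\<in>PiE Y Out. ?term Y g)"
  proof (intro sum.cong refl)
    fix Y assume "Y \<in> Pow {..<n}"
    hence "finite Y" using finite_subset by auto
    thus "(\<Prod>i\<in>Y. \<Sum>c\<in>Out i. - b c) * (\<Prod>i\<in>{..<n} - Y. ?\<delta> i) = (\<Sum>g\<in>PiE Y Out. ?term Y g)"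
      using finOut by (simp add: prod_sum_PiE sum_distrib_right)
  qed
  also have "\<dots> = (\<Sum>(Y, g)\<in>S. ?term Y g)"
    unfolding S_def
    by (rule sum.Sigma) (use finOut in \<open>auto intro!: finite_PiE intro: finite_subset\<close>)
  also have "\<dots> = (\<Sum>(Y, g)\<in>S'. ?term Y g)"
  proof (rule sum.mono_neutral_right[OF finS])
    show "\<forall>z\<in>S - S'. (case z of (Y, g) \<Rightarrow> ?term Y g) = 0"
    proof
      fix z assume z: "z \<in> S - S'"
      obtain Y g where zY: "z = (Y, g)" by (cases z)
      then obtain i where "i \<in> {..<n} - Y" "\<sigma> i \<noteq> i" using z by (auto simp: S'_def)
      hence "(\<Prod>i\<in>{..<n} - Y. ?\<delta> i) = 0" by (intro prod_zero bexI[of _ i]) auto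
      thus "(case z of (Y, g) \<Rightarrow> ?term Y g) = 0" using zY by simp
    qed
  qed (auto simp: S'_def)
  also have "\<dots> = (\<Sum>E\<in>balanced \<sigma>. (\<Prod>c\<in>E. - b c) * t ^ (n - card E))"
  proof (rule sum.reindex_bij_witness[of _ "\<lambda>E. (T ` E, restrict (inv_into E T) (T ` E))" "\<lambda>(Y, g). g ` Y"])
    fix z assume z: "z \<in> S'"
    obtain Y g where zY: "z = (Y, g)" by (cases z)
    have Y: "Y \<subseteq> {..<n}" and g: "g \<in> PiE Y Out" and fix_out: "\<And>i. i < n \<Longrightarrow> i \<notin> Y \<Longrightarrow> \<sigma> i = i"
      using z zY by (auto simp: S'_def S_def)
    have gOut: "g i \<in> arcs G" "T (g i) = i" "H (g i) = \<sigma> i" if "i \<in> Y" for i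
      using g that by (auto simp: Out_def PiE_def Pi_def)
    have T_img: "T ` g ` Y = Y" using gOut(2) by (auto simp: image_iff) 
    have inj: "inj_on T (g ` Y)" using gOut(2) by (auto simp: inj_on_def)
    have inj_g: "inj_on g Y" using gOut(2) by (metis inj_onI)
    have "inv_into (g ` Y) T i = g i" if "i \<in> Y" for i
      using that gOut(2) inj by (intro inv_into_f_eq) auto
    hence "restrict (inv_into (g ` Y) T) Y = g"
      using g by (intro ext) (auto simp: restrict_def PiE_def extensional_def)
    thus "(case (case z of (Y, g) \<Rightarrow> g ` Y) of E \<Rightarrow> (T ` E, restrict (inv_into E T) (T ` E))) = z"
      using zY T_img by simp
    show "(case z of (Y, g) \<Rightarrow> g ` Y) \<in> balanced \<sigma>"
      using zY gOut inj fix_out T_img by (auto simp: balanced_def)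
    have "(\<Prod>i\<in>{..<n} - Y. ?\<delta> i) = (\<Prod>i\<in>{..<n} - Y. t)"
      using fix_out by (intro prod.cong) auto
    also have "\<dots> = t ^ (n - card Y)" using Y by (simp add: card_Diff_subset finite_subset)
    finally show "(\<Prod>c\<in>(case z of (Y, g) \<Rightarrow> g ` Y). - b c) * t ^ (n - card (case z of (Y, g) \<Rightarrow> g ` Y)) =
        (case z of (Y, g) \<Rightarrow> ?term Y g)"
      using zY inj_g by (simp add: prod.reindex card_image)
  next
    fix E assume "E \<in> balanced \<sigma>"
    hence E: "E \<subseteq> arcs G" "inj_on T E" "\<And>c. c \<in> E \<Longrightarrow> \<sigma> (T c) = H c"
      "\<And>i. i < n \<Longrightarrow> i \<notin> T ` E \<Longrightarrow> \<sigma> i = i" by (auto simp: balanced_def)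
    have inv: "inv_into E T (T c) = c" if "c \<in> E" for c using that E(2) by simp
    show "(case (T ` E, restrict (inv_into E T) (T ` E)) of (Y, g) \<Rightarrow> g ` Y) = E"
      using inv by (force simp: image_iff)
    show "(T ` E, restrict (inv_into E T) (T ` E)) \<in> S'"
      using E inv T_less by (auto simp: S'_def S_def Out_def)
  qed
  finally show ?thesis .
qed

definition arc_perm :: "'b set \<Rightarrow> nat \<Rightarrow> nat" where
  "arc_perm E i = (if i \<in> T ` E then H (inv_into E T i) else i)"

lemma arc_perm_eqI:
  assumes "inj_on T E" "\<And>c. c \<in> E \<Longrightarrow> \<sigma> (T c) = H c" "\<And>i. i \<notin> T ` E \<Longrightarrow> \<sigma> i = i"
  shows "arc_perm E = \<sigma>"
  using assms by (auto simp: arc_perm_def fun_eq_iff)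

lemma balanced_arc_in_cycle:
  assumes \<sigma>: "\<sigma> permutes {..<n}" and E: "E \<in> balanced \<sigma>" and c: "c \<in> E"
  shows "\<exists>C\<in>cycs. c \<in> C \<and> C \<subseteq> E"
proof -
  have E1: "E \<subseteq> arcs G" "inj_on T E" and E2: "\<And>c. c \<in> E \<Longrightarrow> \<sigma> (T c) = H c"
    and E3: "\<And>i. i < n \<Longrightarrow> i \<notin> T ` E \<Longrightarrow> \<sigma> i = i" using E by (auto simp: balanced_def)
  have perm: "permutation \<sigma>" using \<sigma> by (auto simp: permutation_permutes)
  let ?m = "least_power \<sigma> (T c)"
  let ?s = "support \<sigma> (T c)"
  have m: "?m > 0" "(\<sigma> ^^ ?m) (T c) = T c" using least_power_of_permutation[OF perm] by auto
  have stay: "\<sigma> i \<in> T ` E" if "i \<in> T ` E" for i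
  proof (rule ccontr)
    assume out: "\<sigma> i \<notin> T ` E"
    have "i < n" using that E1(1) T_less by auto
    hence "\<sigma> i < n" using permutes_in_image[OF \<sigma>, of i] by simp
    hence "\<sigma> (\<sigma> i) = \<sigma> i" using E3 out by blast
    hence "\<sigma> i = i" using permutes_inj[OF \<sigma>] by (simp add: inj_eq)
    thus False using that out by simp
  qed
  have orbit: "(\<sigma> ^^ k) (T c) \<in> T ` E" for k
    by (induction k) (use c stay in auto)
  let ?p = "map (inv_into E T) ?s"
  have inE: "set ?p \<subseteq> E" using orbit by (auto intro: inv_into_into)
  have T_p: "map T ?p = ?s" using orbit by (auto simp: f_inv_into_f)
  have "map H ?p = map \<sigma> (map T ?p)" using inE E2 by (simp add: subset_iff)
  also have "\<dots> = rotate1 (map T ?p)"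
    unfolding T_p
  proof (rule nth_equalityI)
    fix k assume "k < length (map \<sigma> ?s)"
    hence k: "k < ?m" by simp
    have rot: "rotate1 ?s ! k = ?s ! (Suc k mod ?m)" using k by (simp add: nth_rotate1)
    have lhs: "map \<sigma> ?s ! k = (\<sigma> ^^ Suc k) (T c)" using k by simp
    show "map \<sigma> ?s ! k = rotate1 ?s ! k"
    proof (cases "Suc k = ?m")
      case True
      have "Suc k mod ?m = 0" unfolding True by simp
      moreover have "?s ! 0 = T c" using m(1) by simp
      ultimately show ?thesis unfolding lhs rot using m(2) True by metis
    next
      case False
      thus ?thesis unfolding lhs rot using k by simp
    qed
  qed simp
  finally have "cycle ?p"
    using m inE E1(1) cycle_of_permutation[OF perm, of "T c"] T_p
    by (auto simp add: cycle_iff simp del: map_map)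
  moreover have "c \<in> set ?p"
  proof -
    have "T c \<in> set ?s" using m(1) by (auto intro!: image_eqI[of _ _ 0])
    hence "inv_into E T (T c) \<in> set ?p" by (metis image_eqI set_map)
    thus ?thesis using E1(2) c by simp
  qed
  ultimately show ?thesis using inE by blast
qed

text \<open>The pairs (\<sigma>, E) of the expanded Leibniz formula correspond to cycle families: E
  determines \<sigma>, and it decomposes uniquely into cycles because its tails are distinct. The
  sign of \<sigma> is (-1)^(card Cs + card E), and the factors \<open>- b c\<close> supply another
  (-1)^(card E), so only (-1)^(card Cs) survives.\<close>

theorem det_eq_sum_cycle_families:
  fixes b :: "'b \<Rightarrow> 'c :: comm_ring_1"
  shows "Determinant.det (Matrix.mat n n (\<lambda>(i, j). (if i = j then t else 0) -
      (\<Sum>c | c \<in> arcs G \<and> T c = i \<and> H c = j. b c))) =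
    (\<Sum>Cs\<in>cycle_families. (- 1) ^ card Cs * (\<Prod>C\<in>Cs. \<Prod>c\<in>C. b c) * t ^ (n - card (\<Union>Cs)))"
proof -
  let ?M = "Matrix.mat n n (\<lambda>(i, j). (if i = j then t else 0) -
      (\<Sum>c | c \<in> arcs G \<and> T c = i \<and> H c = j. b c))"
  let ?S = "SIGMA \<sigma>:{\<sigma>. \<sigma> permutes {..<n}}. balanced \<sigma>"
  have prod_eq: "(\<Prod>i<n. ?M $$ (i, \<sigma> i)) = (\<Sum>E\<in>balanced \<sigma>. (\<Prod>c\<in>E. - b c) * t ^ (n - card E))"
    if "\<sigma> permutes {..<n}" for \<sigma>
  proof -
    have "\<sigma> i < n" if "i < n" for i using permutes_in_image[OF \<open>\<sigma> permutes {..<n}\<close>, of i] that by simp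
    thus ?thesis unfolding prod_expand_balanced[symmetric] by (intro prod.cong) auto
  qed
  have "Determinant.det ?M = (\<Sum>\<sigma> | \<sigma> permutes {..<n}. of_int (sign \<sigma>) * (\<Prod>i<n. ?M $$ (i, \<sigma> i)))"
    by (subst det_def'[of _ n]) (auto simp: lessThan_atLeast0)
  also have "\<dots> = (\<Sum>\<sigma> | \<sigma> permutes {..<n}. \<Sum>E\<in>balanced \<sigma>.
      of_int (sign \<sigma>) * ((\<Prod>c\<in>E. - b c) * t ^ (n - card E)))"
    using prod_eq by (intro sum.cong) (auto simp: sum_distrib_left)
  also have "\<dots> = (\<Sum>(\<sigma>, E)\<in>?S. of_int (sign \<sigma>) * ((\<Prod>c\<in>E. - b c) * t ^ (n - card E)))"
    by (rule sum.Sigma) (auto simp: finite_permutations finite_balanced)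
  also have "\<dots> = (\<Sum>Cs\<in>cycle_families. (- 1) ^ card Cs * (\<Prod>C\<in>Cs. \<Prod>c\<in>C. b c) * t ^ (n - card (\<Union>Cs)))"
  proof (rule sum.reindex_bij_witness[of _ "\<lambda>Cs. (arc_perm (\<Union>Cs), \<Union>Cs)" "\<lambda>(\<sigma>, E). {C\<in>cycs. C \<subseteq> E}"])
    fix z assume "z \<in> ?S"
    then obtain \<sigma> E where z: "z = (\<sigma>, E)" and \<sigma>: "\<sigma> permutes {..<n}" and E: "E \<in> balanced \<sigma>" by auto
    let ?Cs = "{C\<in>cycs. C \<subseteq> E}"
    have inj: "inj_on T E" and sub: "E \<subseteq> arcs G" using E by (auto simp: balanced_def)
    have un: "\<Union>?Cs = E" using balanced_arc_in_cycle[OF \<sigma> E] by blast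
    have "arc_perm E = \<sigma>"
    proof (rule arc_perm_eqI[OF inj])
      fix i assume i: "i \<notin> T ` E"
      show "\<sigma> i = i"
      proof (cases "i < n")
        case True
        thus ?thesis using E i by (auto simp: balanced_def)
      next
        case False
        thus ?thesis using permutes_not_in[OF \<sigma>] by simp
      qed
    qed (use E in \<open>auto simp: balanced_def\<close>)
    thus "(case (case z of (\<sigma>, E) \<Rightarrow> {C\<in>cycs. C \<subseteq> E}) of Cs \<Rightarrow> (arc_perm (\<Union>Cs), \<Union>Cs)) = z"
      using z un by simp
    have "disjnt (tail G ` C) (tail G ` D)" if "C \<in> ?Cs" "D \<in> ?Cs" "C \<noteq> D" for C D
    proof (rule ccontr)
      assume "\<not> disjnt (tail G ` C) (tail G ` D)"
      then obtain c d where cd: "c \<in> C" "d \<in> D" "tail G c = tail G d" by (auto simp: disjnt_def)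
      moreover have "c \<in> E" "d \<in> E" using cd that by auto
      moreover have "T c = T d" using cd(3) by (simp add: T_def)
      ultimately have "c = d" using inj by (metis inj_onD)
      thus False using that cd inj cycs_eq_of_common_arc[of C D E c] by blast
    qed
    hence fam: "?Cs \<in> cycle_families" by (auto simp: cycle_families_def pairwise_def)
    thus "(case z of (\<sigma>, E) \<Rightarrow> {C\<in>cycs. C \<subseteq> E}) \<in> cycle_families" using z by simp
    have finCs: "finite ?Cs" using finite_cycs by simp
    \<comment> \<open>The permutation assembled from the cycles coincides with \<sigma>, as both
      equal \<open>arc_perm E\<close>; this is how the sign of \<sigma> becomes known.\<close>
    obtain \<rho> where \<rho>: "\<rho> permutes T ` E" "\<forall>c\<in>E. \<rho> (T c) = H c" "sign \<rho> = (- 1) ^ (card ?Cs + card E)"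
      using cycle_family_permutation[OF finCs fam] unfolding un by blast
    have "arc_perm E = \<rho>" using inj \<rho> permutes_not_in[OF \<rho>(1)] by (intro arc_perm_eqI) auto
    hence sgn: "sign \<sigma> = (- 1) ^ (card ?Cs + card E)" using \<rho>(3) \<open>arc_perm E = \<sigma>\<close> by simp
    have "(\<Prod>C\<in>?Cs. \<Prod>c\<in>C. b c) = (\<Prod>c\<in>E. b c)"
    proof -
      have "\<forall>C\<in>?Cs. \<forall>D\<in>?Cs. C \<noteq> D \<longrightarrow> C \<inter> D = {}"
        using cycs_eq_of_common_arc[OF _ _ _ _ inj] by blast
      moreover have "\<forall>C\<in>?Cs. finite C" using sub finite_arcs finite_subset by blast
      ultimately have "prod b (\<Union>?Cs) = (\<Prod>C\<in>?Cs. prod b C)"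
        using prod.Union_disjoint[of ?Cs b] by simp
      thus ?thesis unfolding un ..
    qed
    moreover have "(\<Prod>c\<in>E. - b c) = (- 1) ^ card E * (\<Prod>c\<in>E. b c)"
      using prod.distrib[of "\<lambda>_. - 1" b E] by simp
    moreover have "(of_int (sign \<sigma>) :: 'c) = (- 1) ^ card ?Cs * (- 1) ^ card E"
      unfolding sgn by (simp add: power_add)
    moreover have "(- 1) ^ card E * ((- 1) ^ card E * x) = (x :: 'c)" for x by simp
    ultimately have "(- 1) ^ card ?Cs * (\<Prod>C\<in>?Cs. \<Prod>c\<in>C. b c) * t ^ (n - card (\<Union>?Cs)) =
        of_int (sign \<sigma>) * ((\<Prod>c\<in>E. - b c) * t ^ (n - card E))"
      unfolding un by (simp only: mult.assoc)
    thus "(- 1) ^ card (case z of (\<sigma>, E) \<Rightarrow> {C\<in>cycs. C \<subseteq> E}) *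
        (\<Prod>C\<in>(case z of (\<sigma>, E) \<Rightarrow> {C\<in>cycs. C \<subseteq> E}). \<Prod>c\<in>C. b c) *
        t ^ (n - card (\<Union>(case z of (\<sigma>, E) \<Rightarrow> {C\<in>cycs. C \<subseteq> E}))) =
        (case z of (\<sigma>, E) \<Rightarrow> of_int (sign \<sigma>) * ((\<Prod>c\<in>E. - b c) * t ^ (n - card E)))"
      using z by simp
  next
    fix Cs assume Cs: "Cs \<in> cycle_families"
    hence "finite Cs" using finite_cycs by (auto simp: cycle_families_def intro: finite_subset)
    then obtain \<sigma> where \<sigma>: "\<sigma> permutes T ` \<Union>Cs" "\<forall>c\<in>\<Union>Cs. \<sigma> (T c) = H c" and inj: "inj_on T (\<Union>Cs)"
      using cycle_family_permutation[OF _ Cs] by blast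
    have "Cs \<subseteq> cycs" using Cs by (simp add: cycle_families_def)
    hence sub: "\<Union>Cs \<subseteq> arcs G" "Cs \<subseteq> cycs" using cycs_arcs by blast+
    have eq: "arc_perm (\<Union>Cs) = \<sigma>" using inj \<sigma> permutes_not_in[OF \<sigma>(1)] by (intro arc_perm_eqI) auto
    have "\<sigma> permutes {..<n}" using permutes_subset[OF \<sigma>(1), of "{..<n}"] sub T_less by auto
    moreover have "\<Union>Cs \<in> balanced \<sigma>"
      using sub inj \<sigma>(2) permutes_not_in[OF \<sigma>(1)] by (auto simp: balanced_def)
    ultimately show "(arc_perm (\<Union>Cs), \<Union>Cs) \<in> ?S" using eq by simp
    have "C \<in> Cs" if C: "C \<in> cycs" "C \<subseteq> \<Union>Cs" for C
    proof -
      obtain c D where "c \<in> C" "c \<in> D" "D \<in> Cs" using cycs_nonempty[OF C(1)] C(2) by blast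
      thus ?thesis using cycs_eq_of_common_arc[OF C(1) _ C(2) _ inj, of D c] sub(2) by blast
    qed
    thus "(case (arc_perm (\<Union>Cs), \<Union>Cs) of (\<sigma>, E) \<Rightarrow> {C\<in>cycs. C \<subseteq> E}) = Cs"
      using sub(2) by auto
  qed
  finally show ?thesis .
qed

end

section \<open>Signed sums over families of disjoint walks\<close>

context wf_digraph
begin

text \<open>\<open>sum\<close> over an infinite set is 0, so this has its intended meaning only when
  the set of walks is finite.\<close>

definition walk_sum :: "('b \<Rightarrow> 'k :: comm_ring_1) \<Rightarrow> 'a \<Rightarrow> 'a \<Rightarrow> 'k" where
  "walk_sum \<omega> x y = (\<Sum>p | awalk x p y. \<Prod>e\<leftarrow>p. \<omega> e)"

lemma awalks_unfold:
  assumes "x \<in> verts G"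
  shows "{p. awalk x p y} = (if x = y then {[]} else {}) \<union>
    (\<Union>e\<in>out_arcs G x. (#) e ` {p. awalk (head G e) p y})" (is "?L = ?R")
proof (rule Set.set_eqI)
  fix p show "p \<in> ?L \<longleftrightarrow> p \<in> ?R"
    using assms by (cases p) (auto simp: awalk_simps)
qed

lemma walk_sum_unfold:
  assumes "x \<in> verts G" and fin_out: "finite (out_arcs G x)" and fin: "finite {p. awalk x p y}"
  shows "walk_sum \<omega> x y =
    (if x = y then 1 else 0) + (\<Sum>e\<in>out_arcs G x. \<omega> e * walk_sum \<omega> (head G e) y)"
proof -
  let ?W = "\<lambda>p. \<Prod>e\<leftarrow>p. \<omega> e"
  have fin': "finite ((#) e ` {p. awalk (head G e) p y})" if "e \<in> out_arcs G x" for e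
    by (rule finite_subset[OF _ fin]) (use that in \<open>auto simp: awalk_simps\<close>)
  have "walk_sum \<omega> x y = (\<Sum>p\<in>(if x = y then {[]} else {}). ?W p) +
      (\<Sum>p\<in>(\<Union>e\<in>out_arcs G x. (#) e ` {p. awalk (head G e) p y}). ?W p)"
    unfolding walk_sum_def awalks_unfold[OF assms(1)] using fin_out fin'
    by (intro sum.union_disjoint) auto
  also have "(\<Sum>p\<in>(\<Union>e\<in>out_arcs G x. (#) e ` {p. awalk (head G e) p y}). ?W p) =
      (\<Sum>e\<in>out_arcs G x. \<Sum>p\<in>(#) e ` {p. awalk (head G e) p y}. ?W p)"
    using fin_out fin' by (intro sum.UNION_disjoint) auto
  also have "\<dots> = (\<Sum>e\<in>out_arcs G x. \<omega> e * walk_sum \<omega> (head G e) y)"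
    by (intro sum.cong refl) (simp add: sum.reindex walk_sum_def sum_distrib_left)
  finally show ?thesis by simp
qed

lemma finite_awalks_length_less:
  assumes "\<And>x. x \<in> verts G \<Longrightarrow> finite (out_arcs G x)"
  shows "finite {p. awalk x p y \<and> length p < n}"
proof (induction n arbitrary: x)
  case (Suc n)
  show ?case
  proof (cases "x \<in> verts G")
    case True
    have "{p. awalk x p y \<and> length p < Suc n} \<subseteq>
        {[]} \<union> (\<Union>e\<in>out_arcs G x. (#) e ` {p. awalk (head G e) p y \<and> length p < n})" (is "?L \<subseteq> ?R")
    proof
      fix p assume "p \<in> ?L" thus "p \<in> ?R" by (cases p) (auto simp: awalk_simps)
    qed
    thus ?thesis by (rule finite_subset) (use assms[OF True] Suc.IH in auto)
  next
    case False
    thus ?thesis by (simp add: awalk_def)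
  qed
qed simp

definition walk_families :: "nat set \<Rightarrow> (nat \<Rightarrow> 'a) \<Rightarrow> (nat \<Rightarrow> 'a) \<Rightarrow> (nat \<Rightarrow> 'b list) set" where
  "walk_families I s t = {P \<in> (\<Pi>\<^sub>E i\<in>I. {p. awalk (s i) p (t i)}).
     \<forall>i\<in>I. \<forall>j\<in>I. i \<noteq> j \<longrightarrow> disjnt (set (awalk_verts (s i) (P i))) (set (awalk_verts (s j) (P j)))}"

definition family_sum :: "('b \<Rightarrow> 'k :: comm_ring_1) \<Rightarrow> nat set \<Rightarrow> (nat \<Rightarrow> 'a) \<Rightarrow> (nat \<Rightarrow> 'a) \<Rightarrow> 'k" where
  "family_sum \<omega> I s t = (\<Sum>P\<in>walk_families I s t. \<Prod>i\<in>I. \<Prod>e\<leftarrow>P i. \<omega> e)"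

lemma finite_walk_families:
  assumes "finite I" and "\<And>i. i \<in> I \<Longrightarrow> finite {p. awalk (s i) p (t i)}"
  shows "finite (walk_families I s t)"
  by (rule finite_subset[OF _ finite_PiE[OF assms(1), of "\<lambda>i. {p. awalk (s i) p (t i)}"]])
     (use assms in \<open>auto simp: walk_families_def\<close>)

text \<open>No walk from another source passes through \<open>s a\<close>, so deleting or adding
  this vertex at the front of the a-th walk never affects disjointness. Families therefore split by
  the first arc of that walk just as single walks do; if the walk has no arc, index \<open>a\<close>
  drops out.\<close>

lemma family_sum_unfold:
  assumes I: "finite I" "a \<in> I" and sa: "s a \<in> verts G"
    and fin_out: "finite (out_arcs G (s a))"
    and fin: "\<And>i. i \<in> I \<Longrightarrow> finite {p. awalk (s i) p (t i)}"
    and unreachable: "\<And>j p x. j \<in> I - {a} \<Longrightarrow> awalk (s j) p x \<Longrightarrow> s a \<notin> set (awalk_verts (s j) p)"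
  shows "family_sum \<omega> I s t = (if s a = t a then family_sum \<omega> (I - {a}) s t else 0) +
    (\<Sum>e\<in>out_arcs G (s a). \<omega> e * family_sum \<omega> I (s(a := head G e)) t)"
proof -
  let ?W = "\<lambda>I P. \<Prod>i\<in>I. \<Prod>e\<leftarrow>P i. \<omega> e"
  let ?F = "walk_families I s t"
  define Z where "Z = {P \<in> ?F. P a = []}"
  define Y where "Y e = {P \<in> ?F. \<exists>p. P a = e # p}" for e
  have finF: "finite ?F" using I(1) fin by (rule finite_walk_families)
  have "?F = Z \<union> (\<Union>e\<in>out_arcs G (s a). Y e)"
  proof (rule Set.set_eqI)
    fix P
    have "awalk (s a) (P a) (t a)" if "P \<in> ?F" using that I(2) by (auto simp: walk_families_def)
    thus "P \<in> ?F \<longleftrightarrow> P \<in> Z \<union> (\<Union>e\<in>out_arcs G (s a). Y e)"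
      by (cases "P a") (auto simp: Z_def Y_def awalk_simps)
  qed
  hence "family_sum \<omega> I s t = (\<Sum>P\<in>Z \<union> (\<Union>e\<in>out_arcs G (s a). Y e). ?W I P)"
    by (simp only: family_sum_def)
  also have "\<dots> = (\<Sum>P\<in>Z. ?W I P) + (\<Sum>P\<in>(\<Union>e\<in>out_arcs G (s a). Y e). ?W I P)"
    using finF fin_out by (intro sum.union_disjoint) (auto simp: Z_def Y_def)
  also have "(\<Sum>P\<in>(\<Union>e\<in>out_arcs G (s a). Y e). ?W I P) = (\<Sum>e\<in>out_arcs G (s a). \<Sum>P\<in>Y e. ?W I P)"
    using finF fin_out by (intro sum.UNION_disjoint) (auto simp: Y_def)
  also have "(\<Sum>P\<in>Z. ?W I P) = (if s a = t a then family_sum \<omega> (I - {a}) s t else 0)"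
  proof (cases "s a = t a")
    case True
    have "(\<Sum>P\<in>Z. ?W I P) = (\<Sum>P\<in>walk_families (I - {a}) s t. ?W (I - {a}) P)"
    proof (rule sum.reindex_bij_witness[of _ "\<lambda>Q. Q(a := [])" "\<lambda>P. P(a := undefined)"])
      fix P assume P: "P \<in> Z"
      show "(P(a := undefined))(a := []) = P" using P by (auto simp: Z_def)
      show "P(a := undefined) \<in> walk_families (I - {a}) s t"
        using P by (auto simp: Z_def walk_families_def PiE_def extensional_def)
      have "?W I P = ?W (I - {a}) P" using I P by (simp add: prod.remove Z_def)
      also have "\<dots> = ?W (I - {a}) (P(a := undefined))" by (intro prod.cong) auto
      finally show "?W (I - {a}) (P(a := undefined)) = ?W I P" ..
    next
      fix Q assume Q: "Q \<in> walk_families (I - {a}) s t"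
      show "(Q(a := []))(a := undefined) = Q"
        using Q by (auto simp: walk_families_def PiE_def extensional_def)
      have notin: "s a \<notin> set (awalk_verts (s j) (Q j))" if "j \<in> I" "j \<noteq> a" for j
        using that Q by (intro unreachable[of j _ "t j"]) (auto simp: walk_families_def)
      show "Q(a := []) \<in> Z"
        using Q True sa I notin
        by (auto simp: Z_def walk_families_def PiE_def extensional_def awalk_simps disjnt_def)
    qed
    thus ?thesis using True by (simp add: family_sum_def)
  next
    case False
    have "Z = {}"
    proof -
      have "P a \<noteq> []" if "P \<in> ?F" for P
      proof -
        have "awalk (s a) (P a) (t a)" using that I(2) by (auto simp: walk_families_def)
        thus ?thesis using False by (auto simp: awalk_simps)
      qed
      thus ?thesis by (auto simp: Z_def)
    qed
    thus ?thesis using False by simp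
  qed
  also have "(\<Sum>e\<in>out_arcs G (s a). \<Sum>P\<in>Y e. ?W I P) =
      (\<Sum>e\<in>out_arcs G (s a). \<omega> e * family_sum \<omega> I (s(a := head G e)) t)"
  proof (rule sum.cong[OF refl])
    fix e assume "e \<in> out_arcs G (s a)"
    hence e: "e \<in> arcs G" "tail G e = s a" by auto
    let ?s = "s(a := head G e)"
    have "(\<Sum>P\<in>Y e. ?W I P) = (\<Sum>P\<in>walk_families I ?s t. \<omega> e * ?W I P)"
    proof (rule sum.reindex_bij_witness[of _ "\<lambda>Q. Q(a := e # Q a)" "\<lambda>P. P(a := tl (P a))"])
      fix P assume P: "P \<in> Y e"
      then obtain p where p: "P a = e # p" and PF: "P \<in> ?F" by (auto simp: Y_def)
      have Pw: "awalk (s i) (P i) (t i)" if "i \<in> I" for i using PF that by (auto simp: walk_families_def)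
      have disj: "disjnt (set (awalk_verts (s i) (P i))) (set (awalk_verts (s j) (P j)))"
        if "i \<in> I" "j \<in> I" "i \<noteq> j" for i j using PF that by (auto simp: walk_families_def)
      show "(P(a := tl (P a)))(a := e # (P(a := tl (P a))) a) = P" using p by auto
      have disj_a: "disjnt (set (awalk_verts (head G e) p)) (set (awalk_verts (s j) (P j)))"
        if "j \<in> I" "j \<noteq> a" for j
        using disj[of a j] that I(2) p by (auto simp: disjnt_def)
      show "P(a := tl (P a)) \<in> walk_families I ?s t"
        unfolding walk_families_def
      proof (intro CollectI conjI ballI impI)
        show "P(a := tl (P a)) \<in> (\<Pi>\<^sub>E i\<in>I. {p. awalk (?s i) p (t i)})"
        proof (rule PiE_I)
          fix i assume "i \<in> I"
          thus "(P(a := tl (P a))) i \<in> {p. awalk (?s i) p (t i)}"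
            using Pw[of i] p by (cases "i = a") (auto simp: awalk_simps)
        next
          fix i assume "i \<notin> I"
          thus "(P(a := tl (P a))) i = undefined"
            using PF I(2) by (cases "i = a") (auto simp: walk_families_def)
        qed
      next
        fix i j assume ij: "i \<in> I" "j \<in> I" "i \<noteq> j"
        show "disjnt (set (awalk_verts (?s i) ((P(a := tl (P a))) i)))
            (set (awalk_verts (?s j) ((P(a := tl (P a))) j)))"
        proof (cases "i = a \<or> j = a")
          case True
          thus ?thesis using ij disj_a[of j] disj_a[of i, THEN disjnt_sym] p by auto
        qed (use ij disj[of i j] in simp)
      qed
      have "?W (I - {a}) (P(a := tl (P a))) = ?W (I - {a}) P" by (intro prod.cong) auto
      thus "\<omega> e * ?W I (P(a := tl (P a))) = ?W I P" using I p by (simp add: prod.remove mult.assoc)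
    next
      fix Q assume Q: "Q \<in> walk_families I ?s t"
      have "Q \<in> (\<Pi>\<^sub>E i\<in>I. {p. awalk (?s i) p (t i)})"
        using Q by (simp only: walk_families_def mem_Collect_eq)
      hence Qw: "awalk (?s i) (Q i) (t i)" if "i \<in> I" for i using PiE_mem that by fast
      have disj: "disjnt (set (awalk_verts (?s i) (Q i))) (set (awalk_verts (?s j) (Q j)))"
        if "i \<in> I" "j \<in> I" "i \<noteq> j" for i j using Q that unfolding walk_families_def by blast
      show "(Q(a := e # Q a))(a := tl ((Q(a := e # Q a)) a)) = Q" by auto
      have notin: "s a \<notin> set (awalk_verts (s j) (Q j))" if "j \<in> I" "j \<noteq> a" for j
        using that Qw[of j] by (intro unreachable[of j _ "t j"]) auto
      have disj_a: "disjnt (set (awalk_verts (s a) (e # Q a))) (set (awalk_verts (s j) (Q j)))"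
        if "j \<in> I" "j \<noteq> a" for j
        using disj[of a j] notin[of j] that I(2) e by (auto simp: disjnt_def)
      have disj': "disjnt (set (awalk_verts (s i) (Q i))) (set (awalk_verts (s j) (Q j)))"
        if "i \<in> I" "j \<in> I" "i \<noteq> j" "i \<noteq> a" "j \<noteq> a" for i j using disj[of i j] that by auto
      have "Q(a := e # Q a) \<in> ?F"
        unfolding walk_families_def
      proof (intro CollectI conjI ballI impI)
        show "Q(a := e # Q a) \<in> (\<Pi>\<^sub>E i\<in>I. {p. awalk (s i) p (t i)})"
        proof (rule PiE_I)
          fix i assume "i \<in> I"
          thus "(Q(a := e # Q a)) i \<in> {p. awalk (s i) p (t i)}"
            using Qw[of i] e by (cases "i = a") (auto simp: awalk_simps)
        next
          fix i assume "i \<notin> I"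
          thus "(Q(a := e # Q a)) i = undefined"
            using Q I(2) by (cases "i = a") (auto simp: walk_families_def)
        qed
      next
        fix i j assume ij: "i \<in> I" "j \<in> I" "i \<noteq> j"
        show "disjnt (set (awalk_verts (s i) ((Q(a := e # Q a)) i)))
            (set (awalk_verts (s j) ((Q(a := e # Q a)) j)))"
        proof (cases "i = a \<or> j = a")
          case True
          thus ?thesis using ij disj_a[of j] disj_a[of i, THEN disjnt_sym] by auto
        qed (use ij disj'[of i j] in simp)
      qed
      thus "Q(a := e # Q a) \<in> Y e" by (auto simp: Y_def)
    qed
    thus "(\<Sum>P\<in>Y e. ?W I P) = \<omega> e * family_sum \<omega> I ?s t"
      by (simp add: family_sum_def sum_distrib_left)
  qed
  finally show ?thesis .
qed

text \<open>\<open>I\<close> holds the indices whose walks are still to be followed; the others have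
  already been matched with the target prescribed by \<tau>.\<close>

definition constrained_perms :: "nat \<Rightarrow> nat set \<Rightarrow> (nat \<Rightarrow> nat) \<Rightarrow> (nat \<Rightarrow> nat) set" where
  "constrained_perms r I \<tau> = {\<sigma>. \<sigma> permutes {..<r} \<and> (\<forall>i\<in>{..<r} - I. \<sigma> i = \<tau> i)}"

lemma finite_constrained_perms: "finite (constrained_perms r I \<tau>)"
  by (rule finite_subset[OF _ finite_permutations[of "{..<r}"]]) (auto simp: constrained_perms_def)

lemma sum_constrained_perms_split:
  assumes a: "a \<in> I" "a < r"
  shows "(\<Sum>\<sigma>\<in>constrained_perms r I \<tau>. f \<sigma>) =
    (\<Sum>j<r. \<Sum>\<sigma>\<in>constrained_perms r (I - {a}) (\<tau>(a := j)). f \<sigma>)"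
proof -
  have "(\<Sum>\<sigma>\<in>constrained_perms r I \<tau>. f \<sigma>) =
      (\<Sum>j<r. \<Sum>\<sigma> | \<sigma> \<in> constrained_perms r I \<tau> \<and> \<sigma> a = j. f \<sigma>)"
  proof (rule sum.group[symmetric, OF finite_constrained_perms])
    show "(\<lambda>\<sigma>. \<sigma> a) ` constrained_perms r I \<tau> \<subseteq> {..<r}"
    proof (rule image_subsetI)
      fix \<sigma> assume "\<sigma> \<in> constrained_perms r I \<tau>"
      hence "\<sigma> permutes {..<r}" by (simp add: constrained_perms_def)
      from permutes_in_image[OF this, of a] show "\<sigma> a \<in> {..<r}" using a by simp
    qed
  qed simp
  moreover have "{\<sigma> \<in> constrained_perms r I \<tau>. \<sigma> a = j} = constrained_perms r (I - {a}) (\<tau>(a := j))" for j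
  proof -
    have "{..<r} - (I - {a}) = insert a ({..<r} - I)" using a by auto
    moreover have "(\<forall>i\<in>{..<r} - I. \<sigma> i = (\<tau>(a := j)) i) \<longleftrightarrow> (\<forall>i\<in>{..<r} - I. \<sigma> i = \<tau> i)" for \<sigma>
      using a(1) by (intro ball_cong refl) (metis DiffD2 fun_upd_other)
    ultimately show ?thesis
      unfolding constrained_perms_def by (simp del: fun_upd_apply add: fun_upd_same) blast
  qed
  ultimately show ?thesis by (simp only:)
qed

text \<open>Without closed walks, reachability by a nonempty walk is a strict order on the finitely
  many sources; a minimal one is reached from no other.\<close>

lemma exists_unreachable_source:
  assumes acyclic: "\<And>x p. awalk x p x \<Longrightarrow> p = []"
    and I: "finite I" "I \<noteq> {}" and inj: "inj_on s I"
  shows "\<exists>a\<in>I. \<forall>j\<in>I - {a}. \<forall>p x. awalk (s j) p x \<longrightarrow> s a \<notin> set (awalk_verts (s j) p)"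
proof -
  define R where "R = {(i, j) \<in> I \<times> I. \<exists>p. p \<noteq> [] \<and> awalk (s i) p (s j)}"
  have "trans R"
  proof (rule transI)
    fix i j k assume "(i, j) \<in> R" "(j, k) \<in> R"
    then obtain p q where "i \<in> I" "k \<in> I" "p \<noteq> []" "awalk (s i) p (s j)" "awalk (s j) q (s k)"
      by (auto simp: R_def)
    moreover from this have "awalk (s i) (p @ q) (s k)" by (metis awalk_appendI)
    ultimately show "(i, k) \<in> R" unfolding R_def by blast
  qed
  moreover have "irrefl R" using acyclic by (auto simp: R_def irrefl_def)
  moreover have "finite R" by (rule finite_subset[of _ "I \<times> I"]) (use I in \<open>auto simp: R_def\<close>)
  ultimately have wf: "wf R" by (simp add: acyclic_irrefl finite_acyclic_wf)
  obtain i where i: "i \<in> I" using I(2) by blast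
  obtain a where a: "a \<in> I" "\<And>j. (j, a) \<in> R \<Longrightarrow> j \<notin> I"
    by (rule wfE_min[OF wf i]) (rule that)
  have "s a \<notin> set (awalk_verts (s j) p)" if j: "j \<in> I - {a}" and p: "awalk (s j) p x" for j p x
  proof
    assume "s a \<in> set (awalk_verts (s j) p)"
    then obtain q where q: "awalk (s j) q (s a)" using awalk_decomp[OF p] by blast
    have "s j \<noteq> s a" using inj j a(1) by (auto simp: inj_on_def)
    hence "q \<noteq> []" using q by (auto simp: awalk_simps)
    hence "(j, a) \<in> R" using q j a(1) by (auto simp: R_def)
    thus False using a(2) j by blast
  qed
  thus ?thesis using a(1) by blast
qed

text \<open>Both sides obey the same recursion on the first arc at an unreachable source, which
  either moves that source along an arc or finishes its index. A moved source may hit another one: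
  then there are no disjoint families, and the products of walk sums cancel under the transposition
  of the two indices. A length bound 0 leaves no walk at all, so both sides vanish. The induction
  measure adds \<open>Suc (b i)\<close>, so that it drops in both kinds of step.\<close>

lemma sum_sign_family_sum:
  fixes \<omega> :: "'b \<Rightarrow> 'k :: comm_ring_1"
  assumes fin_out: "\<And>x. x \<in> verts G \<Longrightarrow> finite (out_arcs G x)"
    and acyclic: "\<And>x p. awalk x p x \<Longrightarrow> p = []"
    and I: "I \<subseteq> {..<r}" and s: "\<And>i. i \<in> I \<Longrightarrow> s i \<in> verts G"
    and bound: "\<And>i j p. i \<in> I \<Longrightarrow> j < r \<Longrightarrow> awalk (s i) p (t j) \<Longrightarrow> length p < b i"
  shows "(\<Sum>\<sigma>\<in>constrained_perms r I \<tau>. of_int (sign \<sigma>) * family_sum \<omega> I s (t \<circ> \<sigma>)) =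
    (\<Sum>\<sigma>\<in>constrained_perms r I \<tau>. of_int (sign \<sigma>) * (\<Prod>i\<in>I. walk_sum \<omega> (s i) (t (\<sigma> i))))"
  using I s bound
proof (induction "\<Sum>i\<in>I. Suc (b i)" arbitrary: I s b \<tau> rule: less_induct)
  case less
  let ?P = "constrained_perms r I \<tau>"
  note I = less.prems(1) and s = less.prems(2) and bound = less.prems(3)
  have finI: "finite I" using I finite_subset by blast
  have \<sigma>_lt: "\<sigma> i < r" if "\<sigma> \<in> ?P" "i \<in> I" for \<sigma> i
    using that I permutes_in_image[of \<sigma> "{..<r}" i] by (auto simp: constrained_perms_def)
  have fin: "finite {p. awalk (s i) p (t j)}" if "i \<in> I" "j < r" for i j
    by (rule finite_subset[OF _ finite_awalks_length_less[OF fin_out, of "s i" "t j" "b i"]])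
       (use bound that in auto)
  consider "I = {}" | i where "i \<in> I" "b i = 0" | "\<not> inj_on s I"
    | "I \<noteq> {}" "\<forall>i\<in>I. b i \<noteq> 0" "inj_on s I" by blast
  thus ?case
  proof cases
    case 1
    thus ?thesis by (simp add: family_sum_def walk_families_def)
  next
    case (2 i)
    hence none: "\<not> awalk (s i) p (t (\<sigma> i))" if "\<sigma> \<in> ?P" for \<sigma> p
      using bound[of i "\<sigma> i" p] \<sigma>_lt[OF that] by auto
    have "family_sum \<omega> I s (t \<circ> \<sigma>) = 0" if "\<sigma> \<in> ?P" for \<sigma>
    proof -
      have "walk_families I s (t \<circ> \<sigma>) = {}"
        using none[OF that] 2(1) unfolding walk_families_def PiE_def Pi_def by auto
      thus ?thesis by (simp add: family_sum_def)
    qed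
    moreover have "(\<Prod>i\<in>I. walk_sum \<omega> (s i) (t (\<sigma> i))) = 0" if "\<sigma> \<in> ?P" for \<sigma>
      by (rule prod_zero[OF finI]) (use none[OF that] 2(1) in \<open>auto simp: walk_sum_def intro!: bexI[of _ i]\<close>)
    ultimately show ?thesis by simp
  next
    case 3
    then obtain i j where ij: "i \<in> I" "j \<in> I" "i \<noteq> j" "s i = s j" by (auto simp: inj_on_def)
    let ?t = "Transposition.transpose i j"
    have t: "?t permutes I" using ij by (simp add: permutes_swap_id)
    have t_r: "?t permutes {..<r}" using ij I by (intro permutes_swap_id) auto
    have s_t: "s (?t k) = s k" for k using ij by (auto simp: Transposition.transpose_def)
    have "walk_families I s (t \<circ> \<sigma>) = {}" for \<sigma>
    proof -
      have False if "P \<in> walk_families I s (t \<circ> \<sigma>)" for P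
      proof -
        have "awalk (s i) (P i) (t (\<sigma> i))" "awalk (s j) (P j) (t (\<sigma> j))"
          using that ij(1,2) by (auto simp: walk_families_def)
        hence "s i \<in> set (awalk_verts (s i) (P i))" "s i \<in> set (awalk_verts (s j) (P j))"
          using ij(4) by (auto dest: hd_in_awalk_verts)
        moreover have "disjnt (set (awalk_verts (s i) (P i))) (set (awalk_verts (s j) (P j)))"
          using that ij by (auto simp: walk_families_def)
        ultimately show False by (auto simp: disjnt_def)
      qed
      thus ?thesis by blast
    qed
    hence "(\<Sum>\<sigma>\<in>?P. of_int (sign \<sigma>) * family_sum \<omega> I s (t \<circ> \<sigma>)) = 0"
      by (simp add: family_sum_def)
    moreover have "(\<Sum>\<sigma>\<in>?P. of_int (sign \<sigma>) * (\<Prod>i\<in>I. walk_sum \<omega> (s i) (t (\<sigma> i)))) = 0"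
    proof (rule sign_sum_eq_0[of _ r i j])
      show "?P \<subseteq> {\<sigma>. \<sigma> permutes {..<r}}" by (auto simp: constrained_perms_def)
      show "i < r" "j < r" "i \<noteq> j" using ij I by auto
      fix \<sigma> assume \<sigma>: "\<sigma> \<in> ?P"
      have "?t k = k" if "k \<notin> I" for k using t that by (simp add: permutes_not_in)
      thus "\<sigma> \<circ> ?t \<in> ?P" using \<sigma> permutes_compose[OF t_r] by (auto simp: constrained_perms_def)
      have "(\<Prod>k\<in>I. walk_sum \<omega> (s k) (t ((\<sigma> \<circ> ?t) k))) = (\<Prod>k\<in>I. walk_sum \<omega> (s (?t k)) (t (\<sigma> (?t k))))"
        by (simp add: s_t)
      also have "\<dots> = (\<Prod>k\<in>I. walk_sum \<omega> (s k) (t (\<sigma> k)))"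
        using prod.permute[OF t, of "\<lambda>k. walk_sum \<omega> (s k) (t (\<sigma> k))"] by (simp add: o_def)
      finally show "(\<Prod>k\<in>I. walk_sum \<omega> (s k) (t ((\<sigma> \<circ> ?t) k))) = (\<Prod>k\<in>I. walk_sum \<omega> (s k) (t (\<sigma> k)))" .
    qed
    ultimately show ?thesis by simp
  next
    case 4
    obtain a where a: "a \<in> I"
      and unreachable: "\<And>j p x. j \<in> I - {a} \<Longrightarrow> awalk (s j) p x \<Longrightarrow> s a \<notin> set (awalk_verts (s j) p)"
    proof -
      have "\<exists>a\<in>I. \<forall>j\<in>I - {a}. \<forall>p x. awalk (s j) p x \<longrightarrow> s a \<notin> set (awalk_verts (s j) p)"
        by (rule exists_unreachable_source) (use acyclic finI 4 in simp_all)
      thus ?thesis using that by blast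
    qed
    let ?J = "I - {a}"
    let ?O = "out_arcs G (s a)"
    let ?sg = "\<lambda>\<sigma>. of_int (sign \<sigma>) :: 'k"
    let ?W = "\<lambda>I s \<sigma>. \<Prod>i\<in>I. walk_sum \<omega> (s i) (t (\<sigma> i))"
    let ?F = "\<lambda>I s \<sigma>. family_sum \<omega> I s (t \<circ> \<sigma>)"
    have finO: "finite ?O" using fin_out s[OF a] .
    have F: "?F I s \<sigma> = (if s a = t (\<sigma> a) then ?F ?J s \<sigma> else 0) +
        (\<Sum>e\<in>?O. \<omega> e * ?F I (s(a := head G e)) \<sigma>)" if "\<sigma> \<in> ?P" for \<sigma>
    proof -
      have "?F I s \<sigma> = (if s a = (t \<circ> \<sigma>) a then ?F ?J s \<sigma> else 0) +
          (\<Sum>e\<in>?O. \<omega> e * ?F I (s(a := head G e)) \<sigma>)"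
      proof (rule family_sum_unfold[where a = a and s = s and t = "t \<circ> \<sigma>", OF finI a s[OF a] finO])
        show "finite {p. awalk (s i) p ((t \<circ> \<sigma>) i)}" if "i \<in> I" for i
          using fin[OF that] \<sigma>_lt[OF \<open>\<sigma> \<in> ?P\<close> that] by simp
      qed (rule unreachable)
      thus ?thesis by simp
    qed
    have W: "?W I s \<sigma> = (if s a = t (\<sigma> a) then ?W ?J s \<sigma> else 0) +
        (\<Sum>e\<in>?O. \<omega> e * ?W I (s(a := head G e)) \<sigma>)" if "\<sigma> \<in> ?P" for \<sigma>
    proof -
      have upd: "?W I (s(a := x)) \<sigma> = walk_sum \<omega> x (t (\<sigma> a)) * ?W ?J s \<sigma>" for x
      proof -
        have "?W ?J (s(a := x)) \<sigma> = ?W ?J s \<sigma>" by (intro prod.cong) auto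
        thus ?thesis using finI a by (simp add: prod.remove)
      qed
      have "?W I s \<sigma> = walk_sum \<omega> (s a) (t (\<sigma> a)) * ?W ?J s \<sigma>"
        using finI a by (simp add: prod.remove)
      also have "walk_sum \<omega> (s a) (t (\<sigma> a)) = (if s a = t (\<sigma> a) then 1 else 0) +
          (\<Sum>e\<in>?O. \<omega> e * walk_sum \<omega> (head G e) (t (\<sigma> a)))"
        using walk_sum_unfold[OF s[OF a] finO fin[OF a \<sigma>_lt[OF that a]]] .
      finally show ?thesis unfolding upd by (simp add: distrib_right sum_distrib_right mult.assoc)
    qed
    have weight_J: "(\<Sum>i\<in>?J. Suc (b i)) < (\<Sum>i\<in>I. Suc (b i))"
      using finI a by (simp add: sum.remove)
    \<comment> \<open>Index \<open>a\<close> ends with an empty walk. The condition depends on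
      \<sigma> only through j = \<sigma> a, so the sum is grouped by j, and this value becomes a new
      constraint on the permutations.\<close>
    have part1: "(\<Sum>\<sigma>\<in>?P. ?sg \<sigma> * (if s a = t (\<sigma> a) then ?F ?J s \<sigma> else 0)) =
        (\<Sum>\<sigma>\<in>?P. ?sg \<sigma> * (if s a = t (\<sigma> a) then ?W ?J s \<sigma> else 0))"
    proof -
      have split: "(\<Sum>\<sigma>\<in>?P. ?sg \<sigma> * (if s a = t (\<sigma> a) then H \<sigma> else 0)) =
        (\<Sum>j<r. if s a = t j then \<Sum>\<sigma>\<in>constrained_perms r ?J (\<tau>(a := j)). ?sg \<sigma> * H \<sigma> else 0)" for H
      proof -
        have "(\<Sum>\<sigma>\<in>constrained_perms r ?J (\<tau>(a := j)). ?sg \<sigma> * (if s a = t (\<sigma> a) then H \<sigma> else 0)) =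
            (if s a = t j then \<Sum>\<sigma>\<in>constrained_perms r ?J (\<tau>(a := j)). ?sg \<sigma> * H \<sigma> else 0)"
          if "j < r" for j
        proof -
          have "(\<Sum>\<sigma>\<in>constrained_perms r ?J (\<tau>(a := j)). ?sg \<sigma> * (if s a = t (\<sigma> a) then H \<sigma> else 0)) =
              (\<Sum>\<sigma>\<in>constrained_perms r ?J (\<tau>(a := j)). ?sg \<sigma> * (if s a = t j then H \<sigma> else 0))"
          proof (intro sum.cong refl)
            fix \<sigma> assume "\<sigma> \<in> constrained_perms r ?J (\<tau>(a := j))"
            hence "\<sigma> a = j" using a I by (auto simp: constrained_perms_def)
            thus "?sg \<sigma> * (if s a = t (\<sigma> a) then H \<sigma> else 0) = ?sg \<sigma> * (if s a = t j then H \<sigma> else 0)"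
              by simp
          qed
          thus ?thesis by (cases "s a = t j") simp_all
        qed
        moreover have "a < r" using a I by auto
        ultimately show ?thesis using a by (simp add: sum_constrained_perms_split[of a])
      qed
      have "(\<Sum>\<sigma>\<in>constrained_perms r ?J (\<tau>(a := j)). ?sg \<sigma> * ?F ?J s \<sigma>) =
          (\<Sum>\<sigma>\<in>constrained_perms r ?J (\<tau>(a := j)). ?sg \<sigma> * ?W ?J s \<sigma>)" for j
        by (rule less.hyps[OF weight_J]) (use I s bound in auto)
      thus ?thesis unfolding split by (simp only:)
    qed
    \<comment> \<open>The a-th source moves along \<open>e\<close>. The walks left are shorter by
      one arc, and \<open>b a\<close> is not 0 here, so the bound can be lowered.\<close>
    have part2: "(\<Sum>\<sigma>\<in>?P. ?sg \<sigma> * ?F I (s(a := head G e)) \<sigma>) =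
        (\<Sum>\<sigma>\<in>?P. ?sg \<sigma> * ?W I (s(a := head G e)) \<sigma>)" if e: "e \<in> ?O" for e
    proof (rule less.hyps[of "b(a := b a - 1)" I])
      have "(\<Sum>i\<in>?J. Suc ((b(a := b a - 1)) i)) = (\<Sum>i\<in>?J. Suc (b i))" by (intro sum.cong) auto
      thus "(\<Sum>i\<in>I. Suc ((b(a := b a - 1)) i)) < (\<Sum>i\<in>I. Suc (b i))"
        using 4(2) finI a by (simp add: sum.remove)
      show "I \<subseteq> {..<r}" by fact
      show "(s(a := head G e)) i \<in> verts G" if "i \<in> I" for i using that s e by auto
      show "length p < (b(a := b a - 1)) i"
        if "i \<in> I" "j < r" "awalk ((s(a := head G e)) i) p (t j)" for i j p
      proof (cases "i = a")
        case True
        hence "awalk (s a) (e # p) (t j)" using that(3) e by (auto simp: awalk_simps)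
        thus ?thesis using bound[OF a that(2)] True by fastforce
      qed (use that bound in auto)
    qed
    have expand: "(\<Sum>\<sigma>\<in>?P. ?sg \<sigma> * (A \<sigma> + (\<Sum>e\<in>?O. \<omega> e * B e \<sigma>))) =
        (\<Sum>\<sigma>\<in>?P. ?sg \<sigma> * A \<sigma>) + (\<Sum>e\<in>?O. \<omega> e * (\<Sum>\<sigma>\<in>?P. ?sg \<sigma> * B e \<sigma>))" for A B
    proof -
      have "(\<Sum>\<sigma>\<in>?P. \<Sum>e\<in>?O. ?sg \<sigma> * (\<omega> e * B e \<sigma>)) = (\<Sum>e\<in>?O. \<Sum>\<sigma>\<in>?P. ?sg \<sigma> * (\<omega> e * B e \<sigma>))"
        by (rule sum.swap)
      thus ?thesis
        by (simp add: distrib_left sum.distrib sum_distrib_left mult.left_commute)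
    qed
    have "(\<Sum>\<sigma>\<in>?P. ?sg \<sigma> * ?F I s \<sigma>) =
        (\<Sum>\<sigma>\<in>?P. ?sg \<sigma> * ((if s a = t (\<sigma> a) then ?F ?J s \<sigma> else 0) +
          (\<Sum>e\<in>?O. \<omega> e * ?F I (s(a := head G e)) \<sigma>)))"
      by (intro sum.cong refl arg_cong2[where f = "(*)"] F)
    also have "\<dots> = (\<Sum>\<sigma>\<in>?P. ?sg \<sigma> * (if s a = t (\<sigma> a) then ?F ?J s \<sigma> else 0)) +
        (\<Sum>e\<in>?O. \<omega> e * (\<Sum>\<sigma>\<in>?P. ?sg \<sigma> * ?F I (s(a := head G e)) \<sigma>))"
      by (rule expand)
    also have "\<dots> = (\<Sum>\<sigma>\<in>?P. ?sg \<sigma> * (if s a = t (\<sigma> a) then ?W ?J s \<sigma> else 0)) +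
        (\<Sum>e\<in>?O. \<omega> e * (\<Sum>\<sigma>\<in>?P. ?sg \<sigma> * ?W I (s(a := head G e)) \<sigma>))"
      by (intro arg_cong2[where f = "(+)"] part1 sum.cong refl arg_cong2[where f = "(*)"] part2)
    also have "\<dots> = (\<Sum>\<sigma>\<in>?P. ?sg \<sigma> * ((if s a = t (\<sigma> a) then ?W ?J s \<sigma> else 0) +
          (\<Sum>e\<in>?O. \<omega> e * ?W I (s(a := head G e)) \<sigma>)))"
      by (rule expand[symmetric])
    also have "\<dots> = (\<Sum>\<sigma>\<in>?P. ?sg \<sigma> * ?W I s \<sigma>)"
      by (intro sum.cong refl arg_cong2[where f = "(*)"] W[symmetric])
    finally show ?thesis .
  qed
qed

theorem lindstrom_gessel_viennot:
  fixes \<omega> :: "'b \<Rightarrow> 'k :: comm_ring_1"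
  assumes fin_out: "\<And>x. x \<in> verts G \<Longrightarrow> finite (out_arcs G x)"
    and acyclic: "\<And>x p. awalk x p x \<Longrightarrow> p = []"
    and s: "\<And>i. i < r \<Longrightarrow> s i \<in> verts G"
    and fin: "\<And>i j. i < r \<Longrightarrow> j < r \<Longrightarrow> finite {p. awalk (s i) p (t j)}"
  shows "(\<Sum>\<sigma> | \<sigma> permutes {..<r}. of_int (sign \<sigma>) * family_sum \<omega> {..<r} s (t \<circ> \<sigma>)) =
    (\<Sum>\<sigma> | \<sigma> permutes {..<r}. of_int (sign \<sigma>) * (\<Prod>i<r. walk_sum \<omega> (s i) (t (\<sigma> i))))"
proof -
  \<comment> \<open>There are finitely many walks between all sources and targets, so their maximal
    length gives one bound for the induction.\<close>
  define L where "L = length ` (\<Union>i<r. \<Union>j<r. {p. awalk (s i) p (t j)})"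
  have L: "finite L" using fin by (auto simp: L_def)
  have "length p < Suc (Max L)" if "i < r" "j < r" "awalk (s i) p (t j)" for i j p
    using that by (intro le_imp_less_Suc Max_ge[OF L]) (auto simp: L_def)
  from sum_sign_family_sum[OF fin_out acyclic, where I = "{..<r}" and r = r and s = s and t = t
      and b = "\<lambda>_. Suc (Max L)" and \<tau> = id and \<omega> = \<omega>] this s
  show ?thesis by (simp add: constrained_perms_def)
qed

end

section \<open>Cylindrical networks with a local lifting\<close>

locale local_network = cylindrical_network A B m N
  for A B m :: real and N :: "'k :: field_char_0 cyl_net" +
  fixes L :: "point set"
  assumes local: "local_lifting N L"
begin

abbreviation "V \<equiv> net_verts N"
abbreviation "E \<equiv> net_arcs N"
abbreviation "wt \<equiv> net_wt N"

definition sh :: "point \<Rightarrow> int \<Rightarrow> point" where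
  "sh x k = x + of_int k *\<^sub>R net_shift N"

lemma sh_0 [simp]: "sh x 0 = x"
  by (simp add: sh_def)

lemma sh_sh [simp]: "sh (sh x k) l = sh x (k + l)"
  by (simp add: sh_def algebra_simps)

lemma sh_eq_iff [simp]: "sh x k = sh x l \<longleftrightarrow> k = l"
  using m_pos shift_eq by (auto simp: sh_def)

lemma sh_eq_iff' [simp]: "sh x k = sh y k \<longleftrightarrow> x = y"
  by (simp add: sh_def)

lemma sh_move: "sh x k = y \<longleftrightarrow> x = sh y (- k)"
  by (auto simp: sh_def)

lemma sh_1: "sh x 1 = x + net_shift N"
  by (simp add: sh_def)

lemma sh_pred: "sh x k = y + net_shift N \<Longrightarrow> sh x (k - 1) = y"
proof -
  have "sh x (k - 1) = sh x k - net_shift N" by (simp add: sh_def scaleR_left_diff_distrib)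
  thus "sh x k = y + net_shift N \<Longrightarrow> sh x (k - 1) = y" by simp
qed

lemma int_closed:
  fixes P :: "int \<Rightarrow> bool"
  assumes "P 0" "\<And>k. P k \<Longrightarrow> P (k + 1)" "\<And>k. P k \<Longrightarrow> P (k - 1)"
  shows "P k"
  by (induction k rule: int_induct[where k = 0]) (use assms in auto)

lemma sh_vert: "x \<in> V \<Longrightarrow> sh x k \<in> V"
proof (induction k rule: int_closed)
  case (2 k)
  have "sh x (k + 1) = sh x k + net_shift N" by (simp add: sh_1[symmetric])
  thus ?case using 2 shift_verts by blast
next
  case (3 k)
  then obtain y where "y \<in> V" "sh x k = y + net_shift N" using shift_verts by blast
  moreover from this have "sh x (k - 1) = y" by (intro sh_pred)
  ultimately show ?case by simp
qed simp

lemma sh_vert_iff [simp]: "sh x k \<in> V \<longleftrightarrow> x \<in> V"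
  using sh_vert[of x k] sh_vert[of "sh x k" "- k"] by auto

lemma sh_arc_wt: "(x, y) \<in> E \<Longrightarrow> (sh x k, sh y k) \<in> E \<and> wt (sh x k, sh y k) = wt (x, y)"
proof (induction k rule: int_closed)
  case (2 k)
  have eq: "sh x (k + 1) = sh x k + net_shift N" "sh y (k + 1) = sh y k + net_shift N"
    by (simp_all add: sh_1[symmetric])
  have "(\<lambda>(u, v). (u + net_shift N, v + net_shift N)) (sh x k, sh y k) \<in> E"
    using 2 by (subst shift_arcs[symmetric]) blast
  thus ?case using 2 shift_wt[of "sh x k" "sh y k"] unfolding eq by simp
next
  case (3 k)
  then obtain a b where ab: "(a, b) \<in> E" "sh x k = a + net_shift N" "sh y k = b + net_shift N"
  proof -
    have "(sh x k, sh y k) \<in> (\<lambda>(u, v). (u + net_shift N, v + net_shift N)) ` E"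
      unfolding shift_arcs using 3 by blast
    thus ?thesis using that by auto
  qed
  hence "sh x (k - 1) = a" "sh y (k - 1) = b" by (auto intro: sh_pred)
  thus ?case using ab shift_wt[OF ab(1)] 3 by simp
qed simp

lemma sh_arc_iff [simp]: "(sh x k, sh y k) \<in> E \<longleftrightarrow> (x, y) \<in> E"
  using sh_arc_wt[of x y k] sh_arc_wt[of "sh x k" "sh y k" "- k"] by auto

lemma sh_wt: "(x, y) \<in> E \<Longrightarrow> wt (sh x k, sh y k) = wt (x, y)"
  using sh_arc_wt by blast

lemma arc_verts: "(x, y) \<in> E \<Longrightarrow> x \<in> V" "(x, y) \<in> E \<Longrightarrow> y \<in> V"
  using arcs_subset by auto

lemma vert_class_sh: "vert_class N x = range (sh x)"
  by (simp add: shift_class_def sh_def)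

lemma vert_class_eq_iff: "vert_class N x = vert_class N y \<longleftrightarrow> (\<exists>k. y = sh x k)"
proof
  assume "vert_class N x = vert_class N y"
  moreover have "sh y 0 \<in> range (sh y)" by blast
  ultimately have "y \<in> range (sh x)" by (simp add: vert_class_sh)
  thus "\<exists>k. y = sh x k" by blast
next
  assume "\<exists>k. y = sh x k"
  then obtain k where y: "y = sh x k" ..
  have "sh x l \<in> range (sh y)" for l
    unfolding y by (rule image_eqI[of _ _ "l - k"]) auto
  thus "vert_class N x = vert_class N y" unfolding vert_class_sh y by auto
qed

lemma L_sub: "L \<subseteq> V"
  using local by (simp add: local_lifting_def is_lifting_def)

lemma ex1_height: "x \<in> V \<Longrightarrow> \<exists>!k. sh x (- k) \<in> L"
proof -
  assume "x \<in> V"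
  hence "vert_class N x \<in> verts (projection N)" by (simp add: projection_def)
  then obtain v where v: "v \<in> L" "vert_class N x = vert_class N v"
    and uniq: "\<And>w. w \<in> L \<Longrightarrow> vert_class N w = vert_class N x \<Longrightarrow> w = v"
    using local unfolding local_lifting_def is_lifting_def by metis
  obtain k where k: "v = sh x k" using v(2) vert_class_eq_iff by blast
  show ?thesis
  proof (rule ex1I[of _ "- k"])
    show "sh x (- (- k)) \<in> L" using v(1) k by simp
    fix l assume "sh x (- l) \<in> L"
    moreover have "vert_class N (sh x (- l)) = vert_class N x" by (metis vert_class_eq_iff)
    ultimately have "sh x (- l) = sh x k" using uniq k by blast
    thus "l = - k" by simp
  qed
qed

text \<open>The index of the translate of \<open>L\<close> that contains \<open>x\<close>. This
  integer, rather than the horizontal coordinate, measures the progress of walks.\<close>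

definition ht :: "point \<Rightarrow> int" where
  "ht x = (THE k. sh x (- k) \<in> L)"

definition base :: "point \<Rightarrow> point" where
  "base x = sh x (- ht x)"

lemma base_in_L: "x \<in> V \<Longrightarrow> base x \<in> L"
  unfolding base_def ht_def by (rule theI', rule ex1_height)

lemma ht_eqI: "x \<in> V \<Longrightarrow> sh x (- k) \<in> L \<Longrightarrow> ht x = k"
  unfolding ht_def using ex1_height by (intro the1_equality)

lemma ht_sh [simp]: "x \<in> V \<Longrightarrow> ht (sh x k) = ht x + k"
  using base_in_L[of x] by (intro ht_eqI) (auto simp: base_def)

lemma ht_L [simp]: "x \<in> L \<Longrightarrow> ht x = 0"
  using L_sub by (intro ht_eqI) auto

lemma sh_base: "sh (base x) (ht x) = x"
  by (simp add: base_def)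

lemma vert_class_base: "vert_class N (base x) = vert_class N x"
  by (metis sh_base vert_class_eq_iff)

text \<open>The locality condition speaks only of arcs that start in \<open>L\<close>; translation
  by \<open>- ht x\<close> carries it over to every arc.\<close>

lemma arc_ht: "(x, y) \<in> E \<Longrightarrow> ht y = ht x \<or> ht y = ht x + 1"
proof -
  assume e: "(x, y) \<in> E"
  hence xy: "x \<in> V" "y \<in> V" using arc_verts by auto
  have "(base x, sh y (- ht x)) \<in> E" using e by (simp add: base_def)
  hence "sh y (- ht x) \<in> L \<or> sh y (- ht x) \<in> (\<lambda>x. x + net_shift N) ` L"
    using local base_in_L[OF xy(1)] unfolding local_lifting_def by blast
  thus ?thesis
  proof
    assume "sh y (- ht x) \<in> L"
    thus ?thesis using ht_eqI[OF xy(2)] by blast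
  next
    assume "sh y (- ht x) \<in> (\<lambda>x. x + net_shift N) ` L"
    then obtain z where z: "z \<in> L" "sh y (- ht x) = sh z 1" by (auto simp: sh_1)
    hence "sh y (- (ht x + 1)) = z" by (simp add: sh_move[of _ "- ht x"] sh_move)
    thus ?thesis using ht_eqI[OF xy(2)] z(1) by blast
  qed
qed

lemma bij_vert_class: "bij_betw (vert_class N) L (verts (projection N))"
proof (rule bij_betwI')
  fix x y assume xy: "x \<in> L" "y \<in> L"
  show "vert_class N x = vert_class N y \<longleftrightarrow> x = y"
  proof
    assume "vert_class N x = vert_class N y"
    then obtain k where k: "y = sh x k" using vert_class_eq_iff by blast
    hence "k = 0" using xy ht_sh[of x k] L_sub by auto
    thus "x = y" using k by simp
  qed simp
next
  fix x assume "x \<in> L"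
  thus "vert_class N x \<in> verts (projection N)" using L_sub by (auto simp: projection_def)
next
  fix c assume "c \<in> verts (projection N)"
  then obtain x where "x \<in> V" "c = vert_class N x" by (auto simp: projection_def)
  thus "\<exists>x\<in>L. c = vert_class N x" using base_in_L vert_class_base by metis
qed

lemma finite_L: "finite L"
  using bij_vert_class finite_projection bij_betw_finite by blast

lemma cover_simps [simp]:
  "verts (cover N) = V" "arcs (cover N) = E" "tail (cover N) = fst" "head (cover N) = snd"
  by (simp_all add: cover_def)

sublocale cover: wf_digraph "cover N"
  by unfold_locales (use arc_verts in auto)

lemma awalk_ht: "cover.awalk x p y \<Longrightarrow> ht y = ht x + (\<Sum>(a, b)\<leftarrow>p. ht b - ht a)"
  by (induction p arbitrary: x) (auto simp: cover.awalk_simps)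

lemma awalk_ht_mono: "cover.awalk x p y \<Longrightarrow> ht x \<le> ht y"
proof (induction p arbitrary: x)
  case (Cons e p)
  hence "e \<in> E" "x = fst e" "ht (snd e) \<le> ht y" by (auto simp: cover.awalk_simps)
  thus ?case using arc_ht[of "fst e" "snd e"] by auto
qed (auto simp: cover.awalk_simps)

lemma acyclic: "cover.awalk x p x \<Longrightarrow> p = []"
  using wind_pos[of x p 0] by auto

lemma awalk_distinct:
  assumes "cover.awalk x p y"
  shows "distinct (cover.awalk_verts x p)"
proof (rule ccontr)
  assume "\<not> distinct (cover.awalk_verts x p)"
  then obtain w r where "length r > 0" "cover.awalk w r w"
    using cover.awalk_not_distinct_decomp[OF assms] by blast
  thus False using acyclic by blast
qed

lemma finite_out_arcs: "x \<in> verts (cover N) \<Longrightarrow> finite (out_arcs (cover N) x)"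
  using finite_out by simp

text \<open>Heights do not decrease along a walk, so it stays in the translates of the finite set
  \<open>L\<close> with heights between those of its ends. It repeats no vertex, which bounds its
  length.\<close>

lemma finite_awalks: "finite {p. cover.awalk x p y}"
proof -
  define W where "W = (\<lambda>(v, k). sh v k) ` (L \<times> {ht x..ht y})"
  have finW: "finite W" using finite_L by (simp add: W_def)
  have "length p < card W" if p: "cover.awalk x p y" for p
  proof -
    have "set (cover.awalk_verts x p) \<subseteq> W"
    proof
      fix z assume z: "z \<in> set (cover.awalk_verts x p)"
      then obtain q r where "cover.awalk x q z" "cover.awalk z r y"
        using cover.awalk_decomp[OF p] by blast
      hence "ht x \<le> ht z" "ht z \<le> ht y" "z \<in> V"
        using awalk_ht_mono cover.awalk_hd_in_verts by auto
      thus "z \<in> W" unfolding W_def using base_in_L sh_base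
        by (intro image_eqI[of _ _ "(base z, ht z)"]) auto
    qed
    hence "card (set (cover.awalk_verts x p)) \<le> card W" using finW card_mono by blast
    thus ?thesis using distinct_card[OF awalk_distinct[OF p]] by (simp add: cover.length_awalk_verts)
  qed
  hence "{p. cover.awalk x p y} \<subseteq> {p. cover.awalk x p y \<and> length p < card W}" by blast
  thus ?thesis using cover.finite_awalks_length_less[OF finite_out_arcs] finite_subset by blast
qed

abbreviation W :: "point \<Rightarrow> point \<Rightarrow> 'k" where
  "W \<equiv> cover.walk_sum wt"

lemma awalk_sh: "cover.awalk (sh x k) (map (\<lambda>(a, b). (sh a k, sh b k)) p) (sh y k) \<longleftrightarrow> cover.awalk x p y"
  by (induction p arbitrary: x) (auto simp: cover.awalk_simps)

lemma W_sh: "W (sh x k) (sh y k) = W x y"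
  unfolding cover.walk_sum_def
proof (rule sum.reindex_bij_witness[of _ "map (\<lambda>(a, b). (sh a k, sh b k))" "map (\<lambda>(a, b). (sh a (- k), sh b (- k)))"])
  have inv: "map (\<lambda>(a, b). (sh a k, sh b k)) (map (\<lambda>(a, b). (sh a (- k), sh b (- k))) p) = p"
    "map (\<lambda>(a, b). (sh a (- k), sh b (- k))) (map (\<lambda>(a, b). (sh a k, sh b k)) p) = p" for p
    by (auto intro!: map_idI)
  fix p
  {
    assume p: "p \<in> {p. cover.awalk (sh x k) p (sh y k)}"
    show "map (\<lambda>(a, b). (sh a k, sh b k)) (map (\<lambda>(a, b). (sh a (- k), sh b (- k))) p) = p" by (rule inv)
    show "map (\<lambda>(a, b). (sh a (- k), sh b (- k))) p \<in> {p. cover.awalk x p y}"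
      using p awalk_sh[of "sh x k" "- k" p "sh y k"] by simp
    have "set p \<subseteq> E" using p by (simp add: cover.awalk_def)
    hence "map wt (map (\<lambda>(a, b). (sh a (- k), sh b (- k))) p) = map wt p"
    proof -
      have "wt (case e of (a, b) \<Rightarrow> (sh a (- k), sh b (- k))) = wt e" if "e \<in> set p" for e
        using that \<open>set p \<subseteq> E\<close> sh_wt[of "fst e" "snd e" "- k"] by (auto simp: case_prod_beta)
      thus ?thesis by simp
    qed
    thus "(\<Prod>e\<leftarrow>map (\<lambda>(a, b). (sh a (- k), sh b (- k))) p. wt e) = (\<Prod>e\<leftarrow>p. wt e)" by (simp only:)
  next
    assume p: "p \<in> {p. cover.awalk x p y}"
    show "map (\<lambda>(a, b). (sh a (- k), sh b (- k))) (map (\<lambda>(a, b). (sh a k, sh b k)) p) = p" by (rule inv)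
    show "map (\<lambda>(a, b). (sh a k, sh b k)) p \<in> {p. cover.awalk (sh x k) p (sh y k)}"
      using p awalk_sh[of x k p y] by simp
  }
qed

definition arc_wt :: "point \<Rightarrow> point \<Rightarrow> 'k" where
  "arc_wt x y = (if (x, y) \<in> E then wt (x, y) else 0)"

text \<open>By locality the first arc from \<open>x\<close> ends in \<open>L\<close> or in its
  translate, and these sets are disjoint, having heights 0 and 1.\<close>

lemma W_unfold:
  assumes x: "x \<in> L"
  shows "W x y = (if x = y then 1 else 0) +
    (\<Sum>z\<in>L. arc_wt x z * W z y + arc_wt x (sh z 1) * W (sh z 1) y)"
proof -
  let ?F = "\<lambda>z. arc_wt x z * W z y"
  have xV: "x \<in> verts (cover N)" using x L_sub by auto
  let ?L' = "(\<lambda>z. sh z 1) ` L"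
  have inj: "inj_on (\<lambda>z. sh z 1) L" by (rule inj_onI) simp
  have disj: "L \<inter> ?L' = {}"
  proof -
    have "ht (sh z 1) = 1" if "z \<in> L" for z using that L_sub by auto
    thus ?thesis using ht_L by fastforce
  qed
  have out: "out_arcs (cover N) x = Pair x ` {z \<in> L \<union> ?L'. (x, z) \<in> E}"
  proof -
    have "z \<in> L \<union> ?L'" if "(x, z) \<in> E" for z
      using that local x unfolding local_lifting_def by (auto simp: sh_1)
    thus ?thesis by (auto simp: out_arcs_def)
  qed
  have "W x y = (if x = y then 1 else 0) + (\<Sum>e\<in>out_arcs (cover N) x. wt e * W (snd e) y)"
    using cover.walk_sum_unfold[OF xV finite_out_arcs[OF xV] finite_awalks, of wt] by simp
  also have "(\<Sum>e\<in>out_arcs (cover N) x. wt e * W (snd e) y) =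
      (\<Sum>z | z \<in> L \<union> ?L' \<and> (x, z) \<in> E. wt (x, z) * W z y)"
    unfolding out by (subst sum.reindex) (auto simp: inj_on_def)
  also have "\<dots> = (\<Sum>z\<in>L \<union> ?L'. ?F z)"
    using finite_L by (intro sum.mono_neutral_cong_left) (auto simp: arc_wt_def)
  also have "\<dots> = (\<Sum>z\<in>L. ?F z) + (\<Sum>z\<in>?L'. ?F z)"
    using finite_L disj by (intro sum.union_disjoint) auto
  also have "(\<Sum>z\<in>?L'. ?F z) = (\<Sum>z\<in>L. ?F (sh z 1))"
    by (simp add: sum.reindex[OF inj] o_def)
  finally show ?thesis by (simp add: sum.distrib)
qed

end

section \<open>Cycles of the projection and the determinant behind \<open>Q_poly\<close>\<close>

locale enumerated_local_network = local_network A B m N L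
  for A B m :: real and N :: "'k :: field_char_0 cyl_net" and L +
  fixes \<l> :: "nat \<Rightarrow> point" and n :: nat
  assumes enum_L: "bij_betw \<l> {..<n} L"
begin

abbreviation "\<pi> \<equiv> projection N"

lemma \<l>_in_L [simp]: "i < n \<Longrightarrow> \<l> i \<in> L"
  using enum_L by (auto simp: bij_betw_def)

lemma \<l>_in_V [simp]: "i < n \<Longrightarrow> \<l> i \<in> V"
  using L_sub by auto

lemma L_index: "x \<in> L \<Longrightarrow> \<exists>i<n. x = \<l> i"
  using enum_L by (auto simp: bij_betw_def)

lemma arc_class_sh: "arc_class N (x, y) = range (\<lambda>k. (sh x k, sh y k))"
  by (simp add: shift_class_def sh_def)

lemma tail_arc_class [simp]: "tail \<pi> (arc_class N (x, y)) = vert_class N x"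
  and head_arc_class [simp]: "head \<pi> (arc_class N (x, y)) = vert_class N y"
  by (simp_all add: projection_def arc_class_sh vert_class_sh image_image)

lemma projection_simps: "verts \<pi> = vert_class N ` V" "arcs \<pi> = arc_class N ` E"
  by (simp_all add: projection_def)

lemma arc_class_shift: "arc_class N (sh x k, sh y k) = arc_class N (x, y)"
proof -
  have "(sh x l, sh y l) \<in> range (\<lambda>l. (sh (sh x k) l, sh (sh y k) l))" for l
    by (rule image_eqI[of _ _ "l - k"]) auto
  thus ?thesis unfolding arc_class_sh by auto
qed

lemma arc_class_base: "arc_class N (x, y) = arc_class N (base x, sh y (- ht x))"
  using arc_class_shift[of x "- ht x" y] by (simp add: base_def)

lemma arcs_projection: "arcs \<pi> = arc_class N ` {e \<in> E. fst e \<in> L}"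
proof -
  have "arc_class N (x, y) \<in> arc_class N ` {e \<in> E. fst e \<in> L}" if "(x, y) \<in> E" for x y
  proof (rule image_eqI)
    show "arc_class N (x, y) = arc_class N (base x, sh y (- ht x))" by (rule arc_class_base)
    show "(base x, sh y (- ht x)) \<in> {e \<in> E. fst e \<in> L}"
      using that arc_verts[OF that] base_in_L by (auto simp: base_def)
  qed
  thus ?thesis unfolding projection_simps by auto
qed

lemma finite_arcs_projection: "finite (arcs \<pi>)"
proof -
  have "{e \<in> E. fst e \<in> L} = (\<Union>x\<in>L. out_arcs (cover N) x)" by (auto simp: out_arcs_def)
  moreover have "finite (\<Union>x\<in>L. out_arcs (cover N) x)"
    using finite_L finite_out_arcs L_sub by auto
  ultimately show ?thesis unfolding arcs_projection by simp
qed

definition vert_index :: "point set \<Rightarrow> nat" where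
  "vert_index = inv_into {..<n} (\<lambda>i. vert_class N (\<l> i))"

lemma bij_classes: "bij_betw (\<lambda>i. vert_class N (\<l> i)) {..<n} (verts \<pi>)"
  using bij_betw_trans[OF enum_L bij_vert_class] by (simp add: o_def)

lemma vert_index_\<l> [simp]: "i < n \<Longrightarrow> vert_index (vert_class N (\<l> i)) = i"
  using bij_classes unfolding vert_index_def bij_betw_def by (intro inv_into_f_eq) auto

sublocale proj: enumerated_digraph \<pi> vert_index n
proof unfold_locales
  fix e assume "e \<in> arcs \<pi>"
  then obtain x y where e: "e = arc_class N (x, y)" "(x, y) \<in> E"
    by (auto simp: projection_simps)
  thus "tail \<pi> e \<in> verts \<pi>" "head \<pi> e \<in> verts \<pi>"
    using arc_verts[OF e(2)] by (auto simp: projection_simps)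
next
  show "finite (verts \<pi>)" by (rule finite_projection)
  show "finite (arcs \<pi>)" by (rule finite_arcs_projection)
  show "bij_betw vert_index (verts \<pi>) {..<n}"
    unfolding vert_index_def by (rule bij_betw_inv_into[OF bij_classes])
qed

lemma proj_T: "i < n \<Longrightarrow> proj.T (arc_class N (\<l> i, y)) = i"
  by (simp add: proj.T_def)

lemma proj_H: "j < n \<Longrightarrow> proj.H (arc_class N (x, sh (\<l> j) k)) = j"
proof -
  assume j: "j < n"
  have "vert_class N (sh (\<l> j) k) = vert_class N (\<l> j)" by (metis vert_class_eq_iff)
  thus ?thesis using j by (simp add: proj.H_def)
qed

lemma class_wt_arc_class: "(x, y) \<in> E \<Longrightarrow> class_wt N (arc_class N (x, y)) = wt (x, y)"
proof -
  assume "(x, y) \<in> E"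
  hence "wt ` arc_class N (x, y) = {wt (x, y)}" by (simp add: arc_class_sh image_image sh_wt)
  thus ?thesis by (simp add: class_wt_def)
qed

text \<open>Locality makes this number 0 or 1.\<close>

definition class_step :: "(point \<times> point) set \<Rightarrow> nat" where
  "class_step c = the_elem ((\<lambda>(x, y). nat (ht y - ht x)) ` c)"

lemma class_step_arc_class: "(x, y) \<in> E \<Longrightarrow> class_step (arc_class N (x, y)) = nat (ht y - ht x)"
proof -
  assume "(x, y) \<in> E"
  hence "(\<lambda>(x, y). nat (ht y - ht x)) ` arc_class N (x, y) = {nat (ht y - ht x)}"
    using arc_verts[of x y] by (simp add: arc_class_sh image_image)
  thus ?thesis by (simp add: class_step_def)
qed

lemma class_step_le: "c \<in> arcs \<pi> \<Longrightarrow> class_step c \<le> 1"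
proof -
  assume "c \<in> arcs \<pi>"
  then obtain x y where "(x, y) \<in> E" "c = arc_class N (x, y)" by (auto simp: projection_simps)
  thus ?thesis using arc_ht[of x y] by (auto simp: class_step_arc_class)
qed

text \<open>Path lifting: an arc class that starts at the class of \<open>x\<close> has a translate
  that starts at \<open>x\<close> itself.\<close>

lemma lift_cas:
  assumes "set q \<subseteq> arcs \<pi>" "pre_digraph.cas \<pi> (vert_class N x) q c" "x \<in> V"
  shows "\<exists>p y. map (arc_class N) p = q \<and> cover.awalk x p y \<and> c = vert_class N y"
  using assms
proof (induction q arbitrary: x)
  case Nil
  thus ?case by (intro exI[of _ "[]"] exI[of _ x]) (auto simp: cover.awalk_simps)
next
  case (Cons c0 q)
  then obtain a b where ab: "c0 = arc_class N (a, b)" "(a, b) \<in> E" by (auto simp: projection_simps)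
  have "vert_class N a = vert_class N x" using Cons.prems(2) ab(1) by simp
  then obtain k where k: "x = sh a k" using vert_class_eq_iff by blast
  have e: "(x, sh b k) \<in> E" "c0 = arc_class N (x, sh b k)" using ab k arc_class_shift by auto
  have "pre_digraph.cas \<pi> (vert_class N (sh b k)) q c" using Cons.prems(2) e(2) by simp
  from Cons.IH[OF _ this] obtain p y
    where "map (arc_class N) p = q" "cover.awalk (sh b k) p y" "c = vert_class N y"
    using Cons.prems(1) arc_verts[OF e(1)] by auto
  hence "map (arc_class N) ((x, sh b k) # p) = c0 # q" "cover.awalk x ((x, sh b k) # p) y"
    "c = vert_class N y" using e by (auto simp: cover.awalk_simps)
  thus ?case by (intro exI conjI)
qed

text \<open>The height differences along the lift telescope to \<open>l\<close>. As no arc class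
  repeats, the total depends only on the set of classes and not on the lift or its starting
  point.\<close>

lemma lifted_wind:
  assumes "cover.awalk w p (sh w l)" "w \<in> V" "distinct (map (arc_class N) p)"
  shows "l = int (\<Sum>c\<in>set (map (arc_class N) p). class_step c)"
proof -
  have step: "ht b - ht a = int (class_step (arc_class N (a, b)))" if "(a, b) \<in> set p" for a b
  proof -
    have "set p \<subseteq> E" using assms(1) by (simp add: cover.awalk_def)
    hence "(a, b) \<in> E" using that by blast
    thus ?thesis using arc_ht[of a b] by (auto simp: class_step_arc_class)
  qed
  have "l = (\<Sum>(a, b)\<leftarrow>p. ht b - ht a)" using awalk_ht[OF assms(1)] assms(2) by simp
  also have "\<dots> = (\<Sum>e\<leftarrow>p. int (class_step (arc_class N e)))"
    using step by (intro arg_cong[where f = sum_list] map_cong) auto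
  also have "\<dots> = (\<Sum>c\<leftarrow>map (arc_class N) p. int (class_step c))" by (simp add: o_def)
  also have "\<dots> = (\<Sum>c\<in>set (map (arc_class N) p). int (class_step c))"
    using assms(3) by (rule sum_list_distinct_conv_sum_set)
  finally show ?thesis by simp
qed

text \<open>\<open>lift_cas\<close> supplies a lift and \<open>lifted_wind\<close> shows that all
  lifts agree, so the definite description is well defined; positivity is
  \<open>wind_pos\<close>.\<close>

lemma cycle_wind_eq:
  assumes "C \<in> simple_cycles N"
  shows "cycle_wind N C = (\<Sum>c\<in>C. class_step c)" "cycle_wind N C > 0"
proof -
  obtain q where q: "proj.cycle q" "C = set q" using assms by (auto simp: simple_cycles_def)
  then obtain u where u: "proj.awalk u q u" "q \<noteq> []" by (auto simp: proj.cycle_def)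
  have "u \<in> vert_class N ` V"
    using proj.awalk_hd_in_verts[OF u(1)] by (simp only: projection_simps)
  then obtain x where x: "x \<in> V" "u = vert_class N x" by blast
  obtain p y where p: "map (arc_class N) p = q" "cover.awalk x p y" "vert_class N x = vert_class N y"
    using lift_cas[of q x u] u x by (auto simp: proj.awalk_def)
  obtain l where l: "y = sh x l" using p(3) vert_class_eq_iff by blast
  have wp: "cover.awalk x p (x + of_int l *\<^sub>R net_shift N)" "p \<noteq> []"
    using p(1,2) l u(2) by (auto simp: sh_def)
  have "l > 0" using wind_pos[OF wp] .
  have dist: "distinct q" using q(1) by (auto simp: proj.cycle_iff distinct_map)
  have l_eq: "l = int (\<Sum>c\<in>C. class_step c)"
    using lifted_wind[of x p l] p l x dist q(2) by simp
  show wind: "cycle_wind N C = (\<Sum>c\<in>C. class_step c)"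
    unfolding cycle_wind_def
  proof (rule the_equality)
    have "x + of_nat (\<Sum>c\<in>C. class_step c) *\<^sub>R net_shift N = y"
      unfolding l sh_def l_eq by simp
    thus "\<exists>p w. proj.cycle (map (arc_class N) p) \<and> set (map (arc_class N) p) = C \<and>
        cover.awalk w p (w + of_nat (\<Sum>c\<in>C. class_step c) *\<^sub>R net_shift N)"
      using p q by (intro exI[of _ p] exI[of _ x]) simp
  next
    fix k assume "\<exists>p w. proj.cycle (map (arc_class N) p) \<and> set (map (arc_class N) p) = C \<and>
        cover.awalk w p (w + of_nat k *\<^sub>R net_shift N)"
    then obtain p w where pw: "proj.cycle (map (arc_class N) p)" "set (map (arc_class N) p) = C"
      "cover.awalk w p (sh w (int k))" by (auto simp: sh_def)
    have "distinct (map (arc_class N) p)"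
      using pw(1) distinct_map[of proj.T "map (arc_class N) p"] by (simp only: proj.cycle_iff)
    moreover have "w \<in> V" using cover.awalk_hd_in_verts[OF pw(3)] by simp
    ultimately have "int k = int (\<Sum>c\<in>C. class_step c)" using lifted_wind[OF pw(3)] pw(2) by simp
    thus "k = (\<Sum>c\<in>C. class_step c)" by (simp only: of_nat_eq_iff)
  qed
  show "cycle_wind N C > 0" using \<open>l > 0\<close> unfolding wind l_eq by (simp only: of_nat_0_less_iff)
qed

definition M0 :: "nat \<Rightarrow> nat \<Rightarrow> 'k" where "M0 i j = arc_wt (\<l> i) (\<l> j)"
definition M1 :: "nat \<Rightarrow> nat \<Rightarrow> 'k" where "M1 i j = arc_wt (\<l> i) (sh (\<l> j) 1)"

text \<open>Arcs of the cover are pairs of points and climb by 0 or 1, so two classes are joined by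
  at most one arc class of each step. \<open>b\<close> is left open because two determinants use
  this: one with powers of t and one with the arcs of step 1 switched off.\<close>

lemma sum_parallel_arcs:
  assumes ij: "i < n" "j < n"
  shows "(\<Sum>c | c \<in> arcs \<pi> \<and> proj.T c = i \<and> proj.H c = j. b (class_wt N c) (class_step c)) =
    (if (\<l> i, \<l> j) \<in> E then b (wt (\<l> i, \<l> j)) 0 else 0) +
    (if (\<l> i, sh (\<l> j) 1) \<in> E then b (wt (\<l> i, sh (\<l> j) 1)) 1 else (0 :: 'c :: comm_monoid_add))"
proof -
  let ?e0 = "(\<l> i, \<l> j)" and ?e1 = "(\<l> i, sh (\<l> j) 1)"
  let ?S = "{e \<in> {?e0, ?e1}. e \<in> E}"
  have ne: "sh (\<l> j) 1 \<noteq> \<l> j" using sh_eq_iff[of "\<l> j" 1 0] by simp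
  have stp: "class_step (arc_class N e) = (if e = ?e0 then 0 else 1)" if "e \<in> ?S" for e
    using that ij ne by (auto simp: class_step_arc_class)
  have "{c. c \<in> arcs \<pi> \<and> proj.T c = i \<and> proj.H c = j} = arc_class N ` ?S"
  proof (intro equalityI subsetI)
    fix c assume c: "c \<in> {c. c \<in> arcs \<pi> \<and> proj.T c = i \<and> proj.H c = j}"
    then obtain x y where xy: "(x, y) \<in> E" "x \<in> L" "c = arc_class N (x, y)"
      unfolding arcs_projection by auto
    obtain i' where i': "i' < n" "x = \<l> i'" using L_index xy(2) by blast
    hence x: "x = \<l> i" using c proj_T[of i' y] xy(3) by simp
    have y: "y \<in> V" using arc_verts[OF xy(1)] by simp
    obtain j' where j': "j' < n" "base y = \<l> j'" using L_index base_in_L[OF y] by blast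
    have y_eq: "y = sh (\<l> j') (ht y)" using sh_base[of y] j'(2) by simp
    have "proj.H c = j'" using proj_H[OF j'(1), of x "ht y"] y_eq xy(3) by simp
    hence "j' = j" using c by simp
    moreover have "ht y = 0 \<or> ht y = 1" using arc_ht[OF xy(1)] xy(2) by simp
    ultimately have "y = \<l> j \<or> y = sh (\<l> j) 1" using y_eq by (metis sh_0)
    hence "(x, y) \<in> ?S" using x xy(1) by blast
    thus "c \<in> arc_class N ` ?S" using xy(3) by blast
  next
    fix c assume "c \<in> arc_class N ` ?S"
    thus "c \<in> {c. c \<in> arcs \<pi> \<and> proj.T c = i \<and> proj.H c = j}"
      using proj_T[OF ij(1), of "\<l> j"] proj_T[OF ij(1), of "sh (\<l> j) 1"]
        proj_H[OF ij(2), of "\<l> i" 0] proj_H[OF ij(2), of "\<l> i" 1]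
      by (auto simp: projection_simps)
  qed
  moreover have "inj_on (arc_class N) ?S"
  proof (rule inj_onI)
    fix e e' assume e: "e \<in> ?S" "e' \<in> ?S" "arc_class N e = arc_class N e'"
    hence "(if e = ?e0 then 0 else 1 :: nat) = (if e' = ?e0 then 0 else 1)"       using stp[OF e(1)] stp[OF e(2)] e(3) by (simp only:)
    thus "e = e'" using e(1,2) by (auto split: if_splits)
  qed
  ultimately have "(\<Sum>c | c \<in> arcs \<pi> \<and> proj.T c = i \<and> proj.H c = j. b (class_wt N c) (class_step c)) =
      (\<Sum>e\<in>?S. b (class_wt N (arc_class N e)) (class_step (arc_class N e)))"
    by (simp add: sum.reindex)
  also have "\<dots> = (\<Sum>e\<in>?S. b (wt e) (if e = ?e0 then 0 else 1))"
  proof (intro sum.cong refl)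
    fix e assume e: "e \<in> ?S"
    hence "class_wt N (arc_class N e) = wt e" using class_wt_arc_class[of "fst e" "snd e"] by simp
    thus "b (class_wt N (arc_class N e)) (class_step (arc_class N e)) = b (wt e) (if e = ?e0 then 0 else 1)"
      by (simp only: stp[OF e])
  qed
  also have "\<dots> = (\<Sum>e\<in>{?e0, ?e1}. if e \<in> E then b (wt e) (if e = ?e0 then 0 else 1) else 0)"
    by (rule sum.inter_filter) simp
  finally show ?thesis using ne by (simp add: eq_commute[of "\<l> j"])
qed

lemma cycle_families_eq: "proj.cycle_families = (\<Union>r. r_cycles N r)"
  and r_cycles_eq: "r_cycles N r = {Cs \<in> proj.cycle_families. card Cs = r}"
proof -
  have "finite Cs" if "Cs \<in> proj.cycle_families" for Cs
    using that proj.finite_cycs by (auto simp: proj.cycle_families_def intro: finite_subset)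
  thus "proj.cycle_families = (\<Union>r. r_cycles N r)"
    "r_cycles N r = {Cs \<in> proj.cycle_families. card Cs = r}"
    unfolding r_cycles_def proj.cycle_families_def simple_cycles_def cycle_verts_def by blast+
qed

text \<open>Members are disjoint and each arc has step 0 or 1, so the winding number counts the arcs
  of step 1 and its difference to \<open>card (\<Union>Cs)\<close> those of step 0. Distinct tails
  allow at most n arcs, and every member winds at least once. These bounds keep the subtractions in
  later exponents exact.\<close>

lemma
  assumes Cs: "Cs \<in> proj.cycle_families"
  shows wind_eq: "r_cycle_wind N Cs = (\<Sum>C\<in>Cs. \<Sum>c\<in>C. class_step c)"
    and wind_le: "r_cycle_wind N Cs \<le> card (\<Union>Cs)"
    and card_arcs_le: "card (\<Union>Cs) \<le> n"
    and card_le_wind: "card Cs \<le> r_cycle_wind N Cs"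
    and sum_steps: "(\<Sum>C\<in>Cs. \<Sum>c\<in>C. 1 - class_step c) = card (\<Union>Cs) - r_cycle_wind N Cs"
proof -
  have sub: "Cs \<subseteq> simple_cycles N" using Cs by (auto simp: proj.cycle_families_def simple_cycles_def)
  hence sub': "Cs \<subseteq> proj.cycs" by (simp add: simple_cycles_def)
  hence fin: "finite Cs" using proj.finite_cycs finite_subset by blast
  show w: "r_cycle_wind N Cs = (\<Sum>C\<in>Cs. \<Sum>c\<in>C. class_step c)"
    unfolding r_cycle_wind_def using sub cycle_wind_eq(1) by (intro sum.cong refl) blast
  have finC: "finite C" if "C \<in> Cs" for C using that sub' by auto
  have arcs: "\<Union>Cs \<subseteq> arcs \<pi>" using sub' proj.cycs_arcs by blast
  have "\<forall>C\<in>Cs. \<forall>D\<in>Cs. C \<noteq> D \<longrightarrow> C \<inter> D = {}"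
    using Cs unfolding proj.cycle_families_def pairwise_def disjnt_def by blast
  hence card: "card (\<Union>Cs) = (\<Sum>C\<in>Cs. \<Sum>c\<in>C. 1)"
    using card_Union_disjoint[of Cs] finC by (simp add: pairwise_def disjnt_def)
  have split: "(\<Sum>C\<in>Cs. \<Sum>c\<in>C. 1 - class_step c) + (\<Sum>C\<in>Cs. \<Sum>c\<in>C. class_step c) = card (\<Union>Cs)"
    unfolding card sum.distrib[symmetric] using arcs class_step_le
    by (intro sum.cong refl le_add_diff_inverse2) blast
  show "r_cycle_wind N Cs \<le> card (\<Union>Cs)"
    "(\<Sum>C\<in>Cs. \<Sum>c\<in>C. 1 - class_step c) = card (\<Union>Cs) - r_cycle_wind N Cs"
    using split w by auto
  have "inj_on proj.T (\<Union>Cs)" using proj.cycle_family_permutation[OF fin Cs] by blast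
  moreover have "proj.T ` \<Union>Cs \<subseteq> {..<n}" using arcs proj.T_less by blast
  ultimately have "card (\<Union>Cs) \<le> card {..<n}" by (intro card_inj_on_le) auto
  thus "card (\<Union>Cs) \<le> n" by simp
  have "card Cs = (\<Sum>C\<in>Cs. 1)" by simp
  also have "\<dots> \<le> r_cycle_wind N Cs"
    unfolding r_cycle_wind_def using sub cycle_wind_eq(2)
    by (intro sum_mono) (auto simp: Suc_le_eq)
  finally show "card Cs \<le> r_cycle_wind N Cs" .
qed

lemma empty_cycle_family: "{} \<in> proj.cycle_families"
  by (simp add: proj.cycle_families_def)

abbreviation "d \<equiv> max_wind N"

lemma wind_le_max: "Cs \<in> proj.cycle_families \<Longrightarrow> r_cycle_wind N Cs \<le> d"
  unfolding max_wind_def cycle_families_eq[symmetric] using proj.finite_cycle_families by simp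

lemma max_wind_le: "d \<le> n"
proof -
  have "d \<in> r_cycle_wind N ` proj.cycle_families"
    unfolding max_wind_def cycle_families_eq[symmetric]
    using proj.finite_cycle_families empty_cycle_family by (intro Max_in) auto
  thus ?thesis using wind_le card_arcs_le by fastforce
qed

text \<open>The range of r in the definition loses no family, because the number of cycles is at
  most the winding number.\<close>

lemma Q_poly_eq:
  "Q_poly N = (\<Sum>Cs\<in>proj.cycle_families.
     Polynomial.monom ((- 1) ^ (d - card Cs) * r_cycle_wt N Cs) (d - r_cycle_wind N Cs))"
proof -
  let ?t = "\<lambda>Cs. Polynomial.monom ((- 1) ^ (d - card Cs) * r_cycle_wt N Cs) (d - r_cycle_wind N Cs)"
  have "card ` proj.cycle_families \<subseteq> {..d}"
    using card_le_wind wind_le_max by (fastforce intro: order.trans)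
  hence "(\<Sum>r\<le>d. \<Sum>Cs | Cs \<in> proj.cycle_families \<and> card Cs = r. ?t Cs) =
      (\<Sum>Cs\<in>proj.cycle_families. ?t Cs)"
    by (intro sum.group proj.finite_cycle_families) auto
  moreover have "Q_poly N = (\<Sum>r\<le>d. \<Sum>Cs | Cs \<in> proj.cycle_families \<and> card Cs = r. ?t Cs)"
    unfolding Q_poly_def r_cycles_eq by (intro sum.cong refl) auto
  ultimately show ?thesis by simp
qed

text \<open>This is t (1 - M0) - M1. An arc of step 0 brings a factor t, and so does every vertex
  off the family, which together gives t^(n - wind) = t^(n - d) t^(d - wind). The sign (-1)^d turns
  the (-1)^(d - r) of \<open>Q_poly\<close> into the (-1)^r of the expansion.\<close>

lemma det_pencil:
  "Determinant.det (Matrix.mat n n (\<lambda>(i, j). (if i = j then [:0, 1:] else 0) - [:M1 i j, M0 i j:])) =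
    Polynomial.smult ((- 1) ^ d) (Polynomial.monom 1 (n - d) * Q_poly N)"
proof -
  let ?b = "\<lambda>c. Polynomial.monom (class_wt N c) (1 - class_step c)"
  have mat: "Matrix.mat n n (\<lambda>(i, j). (if i = j then [:0, 1:] else 0) - [:M1 i j, M0 i j:]) =
      Matrix.mat n n (\<lambda>(i, j). (if i = j then [:0, 1:] else 0) -
        (\<Sum>c | c \<in> arcs \<pi> \<and> proj.T c = i \<and> proj.H c = j. ?b c))"
  proof -
    have "(\<Sum>c | c \<in> arcs \<pi> \<and> proj.T c = i \<and> proj.H c = j. ?b c) = [:M1 i j, M0 i j:]"
      if "i < n" "j < n" for i j
      unfolding sum_parallel_arcs[OF that, of "\<lambda>w s. Polynomial.monom w (1 - s)"]
      by (simp add: M0_def M1_def arc_wt_def monom_Suc monom_0)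
    thus ?thesis by (intro eq_matI) (simp_all del: One_nat_def)
  qed
  have summand: "(- 1) ^ card Cs * (\<Prod>C\<in>Cs. \<Prod>c\<in>C. ?b c) * [:0, 1:] ^ (n - card (\<Union>Cs)) =
      Polynomial.smult ((- 1) ^ d) (Polynomial.monom 1 (n - d) *
        Polynomial.monom ((- 1) ^ (d - card Cs) * r_cycle_wt N Cs) (d - r_cycle_wind N Cs))"
    if Cs: "Cs \<in> proj.cycle_families" for Cs
  proof -
    have monom_prod: "(\<Prod>x\<in>S. Polynomial.monom (a x) (k x)) = Polynomial.monom (prod a S) (sum k S)"
      for S and a :: "'x \<Rightarrow> 'k" and k
      by (induction S rule: infinite_finite_induct) (auto simp: mult_monom one_pCons monom_0)
    have "(\<Prod>C\<in>Cs. \<Prod>c\<in>C. ?b c) =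
        Polynomial.monom (r_cycle_wt N Cs) (card (\<Union>Cs) - r_cycle_wind N Cs)"
      by (simp add: monom_prod r_cycle_wt_def sum_steps[OF Cs] del: One_nat_def)
    moreover have "[:0, 1:] ^ k = (Polynomial.monom 1 k :: 'k poly)" for k
      by (simp add: monom_altdef)
    moreover have "(- 1 :: 'k poly) ^ k * Polynomial.monom a l = Polynomial.monom ((- 1) ^ k * a) l" for k a l
      by (induction k) (simp_all flip: minus_monom)
    moreover have "card (\<Union>Cs) - r_cycle_wind N Cs + (n - card (\<Union>Cs)) = n - r_cycle_wind N Cs"
      using wind_le[OF Cs] card_arcs_le[OF Cs] by simp
    moreover have "n - d + (d - r_cycle_wind N Cs) = n - r_cycle_wind N Cs"
      using max_wind_le wind_le_max[OF Cs] by simp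
    moreover have "(- 1 :: 'k) ^ d * (- 1) ^ (d - card Cs) = (- 1) ^ card Cs"
    proof -
      have "card Cs \<le> d" using card_le_wind[OF Cs] wind_le_max[OF Cs] by simp
      then obtain k where "d = card Cs + k" by (metis le_Suc_ex)
      thus ?thesis by (simp add: power_add)
    qed
    ultimately show ?thesis
      by (simp add: mult_monom smult_monom mult.assoc[symmetric])
  qed
  show ?thesis
    unfolding mat proj.det_eq_sum_cycle_families Q_poly_eq sum_distrib_left smult_sum2
    by (intro sum.cong refl summand)
qed

text \<open>Weigh the arcs of step 1 by 0 in the cycle expansion. A cycle winds at least once and so
  contains such an arc; only the empty family survives.\<close>

lemma det_one_minus_M0:
  "Determinant.det (Matrix.mat n n (\<lambda>(i, j). (if i = j then 1 else 0) - M0 i j)) = 1"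
proof -
  let ?b = "\<lambda>c. if class_step c = 0 then class_wt N c else 0"
  have mat: "Matrix.mat n n (\<lambda>(i, j). (if i = j then 1 else 0) - M0 i j) =
      Matrix.mat n n (\<lambda>(i, j). (if i = j then 1 else 0) -
        (\<Sum>c | c \<in> arcs \<pi> \<and> proj.T c = i \<and> proj.H c = j. ?b c))"
    by (rule eq_matI)
       (auto simp: sum_parallel_arcs[where b = "\<lambda>w s. if s = 0 then w else 0"] M0_def arc_wt_def)
  have "(\<Prod>C\<in>Cs. \<Prod>c\<in>C. ?b c) = 0" if Cs: "Cs \<in> proj.cycle_families - {{}}" for Cs
  proof -
    have sub: "Cs \<subseteq> simple_cycles N" using Cs by (auto simp: proj.cycle_families_def simple_cycles_def)
    obtain C where C: "C \<in> Cs" using Cs by auto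
    hence "C \<in> proj.cycs" using sub by (auto simp: simple_cycles_def)
    hence finC: "finite C" by auto
    have "(\<Sum>c\<in>C. class_step c) > 0" using cycle_wind_eq[of C] C sub by auto
    then obtain c where "c \<in> C" "class_step c \<noteq> 0" by (metis less_irrefl sum.neutral)
    hence "(\<Prod>c\<in>C. ?b c) = 0" using finC by (intro prod_zero bexI[of _ c]) auto
    moreover have "finite Cs"
      using Cs proj.finite_cycs by (auto simp: proj.cycle_families_def intro: finite_subset)
    ultimately show ?thesis using prod_zero[of Cs "\<lambda>C. \<Prod>c\<in>C. ?b c"] C by blast
  qed
  hence "(\<Sum>Cs\<in>proj.cycle_families - {{}}. (- 1) ^ card Cs * (\<Prod>C\<in>Cs. \<Prod>c\<in>C. ?b c) *
      1 ^ (n - card (\<Union>Cs))) = 0"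
    by (intro sum.neutral) auto
  thus ?thesis
    unfolding mat proj.det_eq_sum_cycle_families
      sum.remove[OF proj.finite_cycle_families empty_cycle_family] by simp
qed

end

section \<open>The signed path sum as a determinant of walk sums\<close>

context local_network
begin

text \<open>Only the encoding changes, from lists of length r to extensional functions on
  \<open>{..<r}\<close>.\<close>

lemma path_sum_eq_family_sum:
  assumes len: "length u = r" "length v = r" and t: "\<And>i. i < r \<Longrightarrow> v ! i = t i"
  shows "path_sum N u v = cover.family_sum wt {..<r} ((!) u) t"
  unfolding path_sum_def cover.family_sum_def
proof (rule sum.reindex_bij_witness[of _ "\<lambda>Q. map Q [0..<r]" "\<lambda>P. restrict ((!) P) {..<r}"])
  fix P assume P: "P \<in> r_paths N u v"
  hence lP: "length P = r" using len by (simp add: r_paths_def)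
  show "map (restrict ((!) P) {..<r}) [0..<r] = P" using lP by (intro nth_equalityI) auto
  show "restrict ((!) P) {..<r} \<in> cover.walk_families {..<r} ((!) u) t"
    using P len t by (auto simp: r_paths_def cover.walk_families_def)
  show "(\<Prod>i<r. \<Prod>e\<leftarrow>restrict ((!) P) {..<r} i. wt e) = (\<Prod>p\<leftarrow>P. \<Prod>e\<leftarrow>p. wt e)"
    using lP by (simp add: prod.list_conv_set_nth lessThan_atLeast0)
next
  fix Q assume Q: "Q \<in> cover.walk_families {..<r} ((!) u) t"
  show "restrict ((!) (map Q [0..<r])) {..<r} = Q"
    using Q by (intro ext) (auto simp: cover.walk_families_def PiE_def extensional_def restrict_def)
  show "map Q [0..<r] \<in> r_paths N u v"
    using Q len t by (auto simp: r_paths_def cover.walk_families_def)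
qed

lemma signed_path_sums:
  assumes u: "r_vertex N r u" and v: "r_vertex N r v"
  shows "(\<Sum>\<sigma> | \<sigma> permutes {..<r}.
      of_int (sign \<sigma>) * path_sum N u (permute_list \<sigma> (shift_tuple N l v))) =
    (\<Sum>\<sigma> | \<sigma> permutes {..<r}. of_int (sign \<sigma>) * (\<Prod>i<r. W (u ! i) (sh (v ! \<sigma> i) (int l))))"
proof -
  let ?t = "\<lambda>j. sh (v ! j) (int l)"
  have len: "length u = r" "length v = r" using u v by (auto simp: r_vertex_def)
  have "path_sum N u (permute_list \<sigma> (shift_tuple N l v)) = cover.family_sum wt {..<r} ((!) u) (?t \<circ> \<sigma>)"
    if "\<sigma> permutes {..<r}" for \<sigma>
  proof (rule path_sum_eq_family_sum)
    fix i assume i: "i < r"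
    have "\<sigma> i < r" using permutes_in_image[OF that, of i] i by simp
    thus "permute_list \<sigma> (shift_tuple N l v) ! i = (?t \<circ> \<sigma>) i"
      using i len that by (simp add: permute_list_nth shift_tuple_def sh_def)
  qed (use len in \<open>auto simp: shift_tuple_def\<close>)
  hence "(\<Sum>\<sigma> | \<sigma> permutes {..<r}.
      of_int (sign \<sigma>) * path_sum N u (permute_list \<sigma> (shift_tuple N l v))) =
    (\<Sum>\<sigma> | \<sigma> permutes {..<r}. of_int (sign \<sigma>) * cover.family_sum wt {..<r} ((!) u) (?t \<circ> \<sigma>))"
    by (intro sum.cong) auto
  also have "\<dots> = (\<Sum>\<sigma> | \<sigma> permutes {..<r}. of_int (sign \<sigma>) * (\<Prod>i<r. W (u ! i) (?t (\<sigma> i))))"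
  proof (rule cover.lindstrom_gessel_viennot)
    show "finite (out_arcs (cover N) x)" if "x \<in> verts (cover N)" for x using finite_out_arcs[OF that] .
    show "p = []" if "cover.awalk x p x" for x p using acyclic[OF that] .
    show "u ! i \<in> verts (cover N)" if "i < r" for i
      using u that nth_mem[of i u] by (auto simp: r_vertex_def)
    show "finite {p. cover.awalk (u ! i) p (?t j)}" for i j by (rule finite_awalks)
  qed
  finally show ?thesis .
qed

end

section \<open>The transfer matrix and the final recurrence\<close>

context enumerated_local_network
begin

definition A0 :: "'k mat" where
  "A0 = Matrix.mat n n (\<lambda>(i, j). (if i = j then 1 else 0) - M0 i j)"
definition A1 :: "'k mat" where
  "A1 = Matrix.mat n n (\<lambda>(i, j). M1 i j)"
text \<open>The matrix T: as \<open>A0\<close> has determinant 1, its adjugate is its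
  inverse.\<close>

definition transfer :: "'k mat" where
  "transfer = adj_mat A0 * A1"

lemma A0: "A0 \<in> carrier_mat n n" and A1: "A1 \<in> carrier_mat n n"
  and transfer: "transfer \<in> carrier_mat n n"
  using adj_mat(1)[of A0 n] by (auto simp: A0_def A1_def transfer_def)

lemma A0_inverse: "A0 * adj_mat A0 = 1\<^sub>m n" "adj_mat A0 * A0 = 1\<^sub>m n"
  using adj_mat[OF A0] det_one_minus_M0 unfolding A0_def by auto

lemma A0_transfer: "A0 * transfer = A1"
proof -
  have "A0 * transfer = (A0 * adj_mat A0) * A1"
    unfolding transfer_def using A0 A1 adj_mat(1)[OF A0] by (simp add: assoc_mult_mat[of _ n n _ n _ n])
  thus ?thesis using A0_inverse A1 by simp
qed

text \<open>Multiplying t - T from the left by \<open>A0\<close>, which has determinant 1, gives the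
  pencil t A0 - A1 of \<open>det_pencil\<close>.\<close>

lemma char_poly_transfer:
  "char_poly transfer = Polynomial.smult ((- 1) ^ d) (Polynomial.monom 1 (n - d) * Q_poly N)"
proof -
  interpret const: comm_ring_hom "\<lambda>a :: 'k. [:a:]" by unfold_locales (auto simp: one_pCons)
  let ?K = "map_mat (\<lambda>a. [:a:]) A0"
  let ?C = "char_poly_matrix transfer"
  let ?P = "Matrix.mat n n (\<lambda>(i, j). (if i = j then [:0, 1:] else 0) - [:M1 i j, M0 i j:])"
  have K: "?K \<in> carrier_mat n n" and C: "?C \<in> carrier_mat n n"
    using A0 transfer by auto
  have "?K * ?C = ?P"
  proof (rule eq_matI)
    fix i j assume "i < dim_row ?P" "j < dim_col ?P"
    hence ij: "i < n" "j < n" by auto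
    have "(?K * ?C) $$ (i, j) = (\<Sum>k<n. [:A0 $$ (i, k):] * ?C $$ (k, j))"
      using ij K C A0 by (simp add: scalar_prod_def lessThan_atLeast0)
    also have "\<dots> = (\<Sum>k<n. (if k = j then [:0, A0 $$ (i, k):] else 0) - [:A0 $$ (i, k) * transfer $$ (k, j):])"
      using ij transfer by (intro sum.cong refl) (auto simp: char_poly_matrix_def algebra_simps)
    also have "\<dots> = [:0, A0 $$ (i, j):] - [:\<Sum>k<n. A0 $$ (i, k) * transfer $$ (k, j):]"
      using ij by (simp add: sum_subtractf const.hom_sum)
    also have "(\<Sum>k<n. A0 $$ (i, k) * transfer $$ (k, j)) = (A0 * transfer) $$ (i, j)"
      using ij A0 transfer by (simp add: scalar_prod_def lessThan_atLeast0)
    also have "\<dots> = M1 i j" unfolding A0_transfer using ij by (simp add: A1_def)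
    also have "[:0, A0 $$ (i, j):] - [:M1 i j:] = ?P $$ (i, j)"
      using ij by (auto simp: A0_def)
    finally show "(?K * ?C) $$ (i, j) = ?P $$ (i, j)" .
  qed (use K C in auto)
  hence "Determinant.det ?K * char_poly transfer = Determinant.det ?P"
    using det_mult[OF K C] by (simp add: char_poly_def)
  moreover have "Determinant.det A0 = 1" unfolding A0_def by (rule det_one_minus_M0)
  ultimately show ?thesis using det_pencil by simp
qed

abbreviation \<phi> :: "point \<Rightarrow> int \<Rightarrow> nat \<Rightarrow> 'k" where
  "\<phi> y k i \<equiv> W (\<l> i) (sh y k)"

text \<open>The hypothesis on \<open>ht y + k\<close> gives the target height at least 1, so it lies
  outside \<open>L\<close> and the empty walk does not contribute. Translating back the walks that
  continue from the translate of \<open>L\<close> then yields A0 w1 = A1 w0.\<close>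

lemma \<phi>_step:
  assumes y: "y \<in> V" and k: "ht y + k \<ge> 0" and i: "i < n"
  shows "\<phi> y (k + 1) i = (\<Sum>j<n. transfer $$ (i, j) * \<phi> y k j)"
proof -
  define w0 where "w0 = Matrix.vec n (\<phi> y k)"
  define w1 where "w1 = Matrix.vec n (\<phi> y (k + 1))"
  have w: "w0 \<in> carrier_vec n" "w1 \<in> carrier_vec n" by (auto simp: w0_def w1_def)
  have "A0 *\<^sub>v w1 = A1 *\<^sub>v w0"
  proof (rule eq_vecI)
    fix i assume "i < dim_vec (A1 *\<^sub>v w0)"
    hence i: "i < n" using A1 by simp
    have "\<l> i \<noteq> sh y (k + 1)" using ht_L[OF \<l>_in_L[OF i]] ht_sh[OF y, of "k + 1"] k by auto
    hence "\<phi> y (k + 1) i = (\<Sum>z\<in>L. arc_wt (\<l> i) z * W z (sh y (k + 1)) +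
        arc_wt (\<l> i) (sh z 1) * W (sh z 1) (sh y (k + 1)))"
      using W_unfold[OF \<l>_in_L[OF i], of "sh y (k + 1)"] by simp
    also have "\<dots> = (\<Sum>j<n. M0 i j * \<phi> y (k + 1) j + M1 i j * \<phi> y k j)"
      using sum.reindex_bij_betw[OF enum_L, of "\<lambda>z. arc_wt (\<l> i) z * W z (sh y (k + 1)) +
        arc_wt (\<l> i) (sh z 1) * W (sh z 1) (sh y (k + 1))"] W_sh[of _ 1 "sh y k"]
      by (simp add: M0_def M1_def)
    finally have "\<phi> y (k + 1) i - (\<Sum>j<n. M0 i j * \<phi> y (k + 1) j) = (\<Sum>j<n. M1 i j * \<phi> y k j)"
      by (simp add: sum.distrib)
    moreover have "(\<Sum>j<n. ((if i = j then 1 else 0) - M0 i j) * \<phi> y (k + 1) j) =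
        \<phi> y (k + 1) i - (\<Sum>j<n. M0 i j * \<phi> y (k + 1) j)"
    proof -
      have "(\<Sum>j<n. ((if i = j then 1 else 0) - M0 i j) * \<phi> y (k + 1) j) =
          (\<Sum>j<n. (if i = j then \<phi> y (k + 1) j else 0) - M0 i j * \<phi> y (k + 1) j)"
        by (intro sum.cong refl) (simp add: left_diff_distrib)
      thus ?thesis using i by (simp add: sum_subtractf)
    qed
    ultimately show "(A0 *\<^sub>v w1) $ i = (A1 *\<^sub>v w0) $ i"
      using i by (simp add: A0_def A1_def w0_def w1_def scalar_prod_def lessThan_atLeast0)
  qed (use A0 A1 in auto)
  hence "adj_mat A0 *\<^sub>v (A0 *\<^sub>v w1) = adj_mat A0 *\<^sub>v (A1 *\<^sub>v w0)" by simp
  also have "adj_mat A0 *\<^sub>v (A1 *\<^sub>v w0) = transfer *\<^sub>v w0"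
    unfolding transfer_def using assoc_mult_mat_vec[OF adj_mat(1)[OF A0] A1 w(1)] by simp
  also have "adj_mat A0 *\<^sub>v (A0 *\<^sub>v w1) = w1"
    using assoc_mult_mat_vec[OF adj_mat(1)[OF A0] A0 w(2)] A0_inverse(2) w(2) by simp
  finally have "w1 = transfer *\<^sub>v w0" .
  hence "w1 $ i = (transfer *\<^sub>v w0) $ i" by simp
  thus ?thesis using i transfer by (simp add: w0_def w1_def scalar_prod_def lessThan_atLeast0)
qed

text \<open>The witness is row i of the c-th power of \<open>transfer\<close>. That it depends on
  neither \<open>y\<close> nor \<open>k\<close> is the point: one row vector serves all targets and
  all times.\<close>

lemma \<phi>_shift_linear:
  "i < n \<Longrightarrow> \<exists>x. \<forall>y\<in>V. \<forall>k. ht y + k \<ge> 0 \<longrightarrow> \<phi> y (k + int c) i = (\<Sum>j<n. x j * \<phi> y k j)"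
proof (induction c)
  case 0
  have "\<phi> y k i = (\<Sum>j<n. (if j = i then 1 else 0) * \<phi> y k j)" for y k
    using 0 by (simp add: if_distrib[of "\<lambda>a. a * _"] cong: if_cong)
  thus ?case by (intro exI[of _ "\<lambda>j. if j = i then 1 else 0"]) simp
next
  case (Suc c)
  then obtain x where x: "\<And>y k. y \<in> V \<Longrightarrow> ht y + k \<ge> 0 \<Longrightarrow>
      \<phi> y (k + int c) i = (\<Sum>j<n. x j * \<phi> y k j)" by blast
  show ?case
  proof (intro exI[of _ "\<lambda>l. \<Sum>j<n. x j * transfer $$ (j, l)"] ballI allI impI)
    fix y k assume y: "y \<in> V" "ht y + k \<ge> 0"
    have "\<phi> y (k + int (Suc c)) i = \<phi> y ((k + 1) + int c) i" by (simp add: ac_simps)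
    also have "\<dots> = (\<Sum>j<n. x j * \<phi> y (k + 1) j)" using x[OF y(1), of "k + 1"] y(2) by simp
    also have "\<dots> = (\<Sum>j<n. \<Sum>l<n. x j * transfer $$ (j, l) * \<phi> y k l)"
      using \<phi>_step[OF y] by (intro sum.cong refl) (simp add: sum_distrib_left mult.assoc)
    also have "\<dots> = (\<Sum>l<n. (\<Sum>j<n. x j * transfer $$ (j, l)) * \<phi> y k l)"
      by (subst sum.swap) (simp add: sum_distrib_right)
    finally show "\<phi> y (k + int (Suc c)) i = (\<Sum>l<n. (\<Sum>j<n. x j * transfer $$ (j, l)) * \<phi> y k l)" .
  qed
qed

text \<open>Moving the source into \<open>L\<close> by a translation leaves \<open>c - ht u\<close>
  applications of \<open>transfer\<close>; one \<open>c\<close> that dominates all source heights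
  thus serves every source.\<close>

lemma W_source_linear:
  assumes u: "u \<in> V" "ht u \<le> int c"
  shows "\<exists>x. \<forall>y\<in>V. \<forall>k. ht y + k \<ge> 0 \<longrightarrow> W u (sh y (k + int c)) = (\<Sum>j<n. x j * \<phi> y k j)"
proof -
  obtain i where i: "i < n" "base u = \<l> i" using L_index base_in_L[OF u(1)] by blast
  define b where "b = nat (int c - ht u)"
  have b: "int b = int c - ht u" using u(2) by (simp add: b_def)
  have u_eq: "u = sh (\<l> i) (ht u)" using sh_base[of u] i(2) by simp
  have "W u (sh y (k + int c)) = \<phi> y (k + int b) i" for y k
    using W_sh[of "\<l> i" "ht u" "sh y (k + int b)"] b by (subst u_eq) simp
  thus ?thesis using \<phi>_shift_linear[OF i(1), of b] by simp
qed

lemma recurrence: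
  assumes u: "r_vertex N r u" and v: "r_vertex N r v"
    and f: "\<And>l. f l = (\<Sum>\<sigma> | \<sigma> permutes {..<r}.
           of_int (sign \<sigma>) * path_sum N u (permute_list \<sigma> (shift_tuple N l v)))"
  shows "\<exists>P. map_poly to_ac P = Q_e_closure N r \<and> satisfies_recurrence f P"
proof -
  have uV: "u ! i \<in> V" and vV: "v ! i \<in> V" if "i < r" for i
    using u v that by (auto simp: r_vertex_def)
  \<comment> \<open>\<open>c\<close> is a common upper bound for the source heights, and
    \<open>b\<close> raises all targets to height at least 0, as \<open>\<phi>_step\<close>
    requires. From index b + c on, \<open>f\<close> is the determinant of pairings of row vectors
    with vectors driven by \<open>transfer\<close>.\<close>
  define c where "c = (\<Sum>i<r. nat \<bar>ht (u ! i)\<bar>)"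
  define b where "b = (\<Sum>i<r. nat \<bar>ht (v ! i)\<bar>)"
  have c: "ht (u ! i) \<le> int c" if "i < r" for i
  proof -
    have "nat \<bar>ht (u ! i)\<bar> \<le> c" unfolding c_def using that by (intro member_le_sum) auto
    thus ?thesis by linarith
  qed
  have b: "ht (v ! i) + int b \<ge> 0" if "i < r" for i
  proof -
    have "nat \<bar>ht (v ! i)\<bar> \<le> b" unfolding b_def using that by (intro member_le_sum) auto
    thus ?thesis by linarith
  qed
  have "\<exists>x. \<forall>i<r. \<forall>y\<in>V. \<forall>k. ht y + k \<ge> 0 \<longrightarrow>
      W (u ! i) (sh y (k + int c)) = (\<Sum>j<n. x i j * \<phi> y k j)"
    using W_source_linear[OF uV c] by (intro choice_iff'[THEN iffD1]) blast
  then obtain x where x: "\<And>i y k. i < r \<Longrightarrow> y \<in> V \<Longrightarrow> ht y + k \<ge> 0 \<Longrightarrow>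
      W (u ! i) (sh y (k + int c)) = (\<Sum>j<n. x i j * \<phi> y k j)" by blast
  define y where "y j l k = \<phi> (v ! j) (int l + int b) k" for j l k
  show ?thesis unfolding Q_e_closure_def
  proof (rule poly_e_annihilates[OF transfer max_wind_le char_poly_transfer])
    fix j l k assume "j < r" "k < n"
    thus "y j (Suc l) k = (\<Sum>k'<n. transfer $$ (k, k') * y j l k')"
      using \<phi>_step[OF vV, of j "int l + int b" k] b[of j] by (simp add: y_def ac_simps)
  next
    fix l
    have "W (u ! i) (sh (v ! \<sigma> i) (int (l + (b + c)))) = (\<Sum>k<n. x i k * y (\<sigma> i) l k)"
      if "\<sigma> permutes {..<r}" "i < r" for \<sigma> i
    proof -
      have "\<sigma> i < r" using permutes_in_image[OF that(1), of i] that(2) by simp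
      thus ?thesis using x[OF that(2) vV, of "\<sigma> i" "int l + int b"] b[of "\<sigma> i"]
        by (simp add: y_def ac_simps)
    qed
    thus "f (l + (b + c)) = (\<Sum>\<sigma> | \<sigma> permutes {..<r}. of_int (sign \<sigma>) *
        (\<Prod>i<r. \<Sum>k<n. x i k * y (\<sigma> i) l k))"
      unfolding f signed_path_sums[OF u v] by (intro sum.cong refl) auto
  qed
qed

end

theorem theorem4p9:
  fixes N :: "'k::field_char_0 cyl_net" and A B m :: real and L :: "point set"
    and r :: nat and u v :: "point list" and f :: "nat \<Rightarrow> 'k"
  assumes "cylindrical_network A B m N"
    and "local_lifting N L"
    and "r \<ge> 1"
    and "r_vertex N r u"
    and "r_vertex N r v"
    and "\<And>l. f l = (\<Sum>\<sigma> | \<sigma> permutes {..<r}.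
           of_int (sign \<sigma>) * path_sum N u (permute_list \<sigma> (shift_tuple N l v)))"
  shows "\<exists>P :: 'k poly. map_poly to_ac P = Q_e_closure N r \<and> satisfies_recurrence f P"
proof -
  interpret local_network A B m N L
    using assms(1,2) by (simp add: local_network_def local_network_axioms_def)
  obtain \<l> where "bij_betw \<l> {0..<card L} L" using ex_bij_betw_nat_finite[OF finite_L] by blast
  then interpret enumerated_local_network A B m N L \<l> "card L"
    by unfold_locales (simp add: lessThan_atLeast0)
  show ?thesis by (rule recurrence[OF assms(4,5,6)])
qed

end
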